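(* Let $\Phi:\mathbb{C}^n\to\mathbb{R}$ be strictly convex, real-valued, and quadratic. For $\alpha\in\mathbb{N}_0^n$ write $$\Pi_\alpha u(x)=(\alpha!)^{-1}(\partial^\alpha u(0))x^\alpha:\ H_\Phi(\mathbb{C}^n;1)\to H_\Phi(\mathbb{C}^n;1).$$ Then there exist another quadratic strictly convex weight $\Phi^\dagger:\mathbb{C}^n\to\mathbb{R}$ and a constant $C_\Phi$ such that, for all $\alpha\in\mathbb{N}_0^n$, $$\|\Pi_\alpha\|_{\mathcal{L}(H_\Phi(\mathbb{C}^n;1))}=\frac{C_\Phi}{\alpha!\,2^{|\alpha|}}\,\|x^\alpha\|_{H_\Phi(\mathbb{C}^n;1)}\,\|x^\alpha\|_{H_{\Phi^\dagger}(\mathbb{C}^n;1)}.$$ Here $C_\Phi=(2\pi)^{-n}\det(1-C_+^*C_+)^{-1/4}$, where the symmetric matrix $C_+\in\mathbb{C}^{n\times n}$ associated with $\Phi$ and the weight $\Phi^\dagger$ are those given by the explicit formulas in the context.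
   Context: $H_\Phi(\mathbb{C}^n;h)=\operatorname{Hol}(\mathbb{C}^n)\cap L^2(\mathbb{C}^n;e^{-2\Phi(x)/h}dL(x))$ with the weighted $L^2$ norm, $dL$ being Lebesgue measure on $\mathbb{C}^n\cong\mathbb{R}^{2n}$. "Quadratic" means a quadratic form in $(\operatorname{Re}x,\operatorname{Im}x)\in\mathbb{R}^{2n}$. Derivatives of holomorphic functions are holomorphic derivatives, and $\partial_x=\frac12(\partial_{\operatorname{Re}x}-i\partial_{\operatorname{Im}x})$. $(\cdot,\cdot)$ is the bilinear dot product on $\mathbb{C}^n$. $\mathcal{L}(\mathcal{H})$ carries the operator norm. Write $(\Phi''_{\bar xx})_{jk}=\partial_{\bar x_j}\partial_{x_k}\Phi$ and $(\Phi''_{xx})_{jk}=\partial_{x_j}\partial_{x_k}\Phi$; then $\Phi(x)=(\Phi''_{\bar xx}x,\bar x)+\operatorname{Re}(\Phi''_{xx}x,x)$, and for $\Phi$ strictly convex $\Phi''_{\bar xx}$ is a positive definite Hermitian matrix. Set $$G=2(\Phi''_{\bar xx})^{1/2},\qquad C_+=-4\,G^{-t}\Phi''_{xx}G^{-1},$$ where $G^{-t}=(G^{t})^{-1}$; thus $\Phi(x)=\frac14(|Gx|^2-\operatorname{Re}(Gx,C_+Gx))$, and $1-C_+^*C_+$ is positive definite. Set $$E=(1-C_+^*C_+)^{-1/2},\qquad G^\dagger=E(G^* )^{-1},\qquad C_+^\dagger=-E^{-t}C_+E,$$ $$\Phi^\dagger(x)=\tfrac14\big(|G^\dagger x|^2-\operatorname{Re}(G^\dagger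 x,C_+^\dagger G^\dagger x)\big).$$ *)

theory Defs
  imports "HOL-Analysis.Analysis"
begin

section \<open>Quadratic, strictly convex weights\<close>

text \<open>A quadratic form in the real variables $(\mathrm{Re}\,x, \mathrm{Im}\,x)$:
  \<open>bilinear\<close> refers to the real vector space structure of \<open>complex ^ 'n\<close>.\<close>

definition quadratic_form :: "(complex ^ 'n \<Rightarrow> real) \<Rightarrow> bool" where
  "quadratic_form \<Phi> \<longleftrightarrow> (\<exists>B. bilinear B \<and> (\<forall>x. \<Phi> x = B x x))"

definition strictly_convex :: "('a::real_vector \<Rightarrow> real) \<Rightarrow> bool" where
  "strictly_convex f \<longleftrightarrow>
    (\<forall>x y t. x \<noteq> y \<longrightarrow> 0 < t \<longrightarrow> t < 1 \<longrightarrow>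
      f ((1 - t) *\<^sub>R x + t *\<^sub>R y) < (1 - t) * f x + t * f y)"

section \<open>Weighted spaces of entire functions\<close>

text \<open>Complex differentiability on all of $\mathbb{C}^n$: the real Frechet derivative exists
  everywhere and is complex linear.\<close>

definition entire :: "(complex ^ 'n \<Rightarrow> complex) \<Rightarrow> bool" where
  "entire u \<longleftrightarrow>
    (\<forall>x. \<exists>u'. (u has_derivative u') (at x) \<and> (\<forall>c v. u' (c *s v) = c * u' v))"

definition H_space :: "(complex ^ 'n \<Rightarrow> real) \<Rightarrow> real \<Rightarrow> (complex ^ 'n \<Rightarrow> complex) set" where
  "H_space \<Phi> h =
    {u. entire u \<and> integrable lborel (\<lambda>x. (cmod (u x))\<^sup>2 * exp (- 2 * \<Phi> x / h))}"

definition H_norm :: "(complex ^ 'n \<Rightarrow> real) \<Rightarrow> real \<Rightarrow> (complex ^ 'n \<Rightarrow> complex) \<Rightarrow> real" where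
  "H_norm \<Phi> h u = sqrt (LINT x|lborel. (cmod (u x))\<^sup>2 * exp (- 2 * \<Phi> x / h))"

text \<open>Since \<open>H_space \<Phi> h\<close> is a set and not a type, bounded linear operators on it are functions
  whose behaviour off \<open>H_space \<Phi> h\<close> is irrelevant; \<open>H_opnorm\<close> follows \<open>onorm\<close>
  (including $0/0 = 0$), and is meaningful for operators satisfying \<open>H_bounded_linear\<close>.\<close>

definition H_bounded_linear ::
    "(complex ^ 'n \<Rightarrow> real) \<Rightarrow> real \<Rightarrow>
     ((complex ^ 'n \<Rightarrow> complex) \<Rightarrow> (complex ^ 'n \<Rightarrow> complex)) \<Rightarrow> bool" where
  "H_bounded_linear \<Phi> h T \<longleftrightarrow>
    (\<forall>u \<in> H_space \<Phi> h. T u \<in> H_space \<Phi> h) \<and>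
    (\<forall>u \<in> H_space \<Phi> h. \<forall>v \<in> H_space \<Phi> h. T (\<lambda>x. u x + v x) = (\<lambda>x. T u x + T v x)) \<and>
    (\<forall>c. \<forall>u \<in> H_space \<Phi> h. T (\<lambda>x. c * u x) = (\<lambda>x. c * T u x)) \<and>
    (\<exists>K. \<forall>u \<in> H_space \<Phi> h. H_norm \<Phi> h (T u) \<le> K * H_norm \<Phi> h u)"

definition H_opnorm ::
    "(complex ^ 'n \<Rightarrow> real) \<Rightarrow> real \<Rightarrow>
     ((complex ^ 'n \<Rightarrow> complex) \<Rightarrow> (complex ^ 'n \<Rightarrow> complex)) \<Rightarrow> real" where
  "H_opnorm \<Phi> h T = (SUP u \<in> H_space \<Phi> h. H_norm \<Phi> h (T u) / H_norm \<Phi> h u)"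

section \<open>Multi-indices and the Taylor projections\<close>

definition mi_fact :: "('n::finite \<Rightarrow> nat) \<Rightarrow> nat" where
  "mi_fact \<alpha> = (\<Prod>j\<in>UNIV. fact (\<alpha> j))"

definition mi_size :: "('n::finite \<Rightarrow> nat) \<Rightarrow> nat" where
  "mi_size \<alpha> = (\<Sum>j\<in>UNIV. \<alpha> j)"

definition monomial :: "('n::finite \<Rightarrow> nat) \<Rightarrow> complex ^ 'n \<Rightarrow> complex" where
  "monomial \<alpha> x = (\<Prod>j\<in>UNIV. (x $ j) ^ \<alpha> j)"

definition holo_partial ::
    "'n::finite \<Rightarrow> (complex ^ 'n \<Rightarrow> complex) \<Rightarrow> complex ^ 'n \<Rightarrow> complex" where
  "holo_partial j u x = deriv (\<lambda>z. u (x + axis j z)) 0"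

text \<open>The index type carries no order, so the partial derivatives are taken along some list in which
  each \<open>j\<close> occurs \<open>\<alpha> j\<close> times; on entire functions, partial derivatives commute and the
  choice is immaterial.\<close>

definition holo_multi_deriv ::
    "('n::finite \<Rightarrow> nat) \<Rightarrow> (complex ^ 'n \<Rightarrow> complex) \<Rightarrow> complex ^ 'n \<Rightarrow> complex" where
  "holo_multi_deriv \<alpha> u = foldr holo_partial (SOME js. \<forall>j. count_list js j = \<alpha> j) u"

definition Taylor_proj ::
    "('n::finite \<Rightarrow> nat) \<Rightarrow> (complex ^ 'n \<Rightarrow> complex) \<Rightarrow> complex ^ 'n \<Rightarrow> complex" where
  "Taylor_proj \<alpha> u = (\<lambda>x. holo_multi_deriv \<alpha> u 0 / of_nat (mi_fact \<alpha>) * monomial \<alpha> x)"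

section \<open>Complex matrices\<close>

definition cdot :: "complex ^ 'n \<Rightarrow> complex ^ 'n \<Rightarrow> complex" where
  "cdot x y = (\<Sum>j\<in>UNIV. x $ j * y $ j)"

definition ctranspose :: "complex ^ 'n ^ 'm \<Rightarrow> complex ^ 'm ^ 'n" where
  "ctranspose A = (\<chi> i j. cnj (A $ j $ i))"

definition pos_def_matrix :: "complex ^ 'n ^ 'n \<Rightarrow> bool" where
  "pos_def_matrix A \<longleftrightarrow>
    ctranspose A = A \<and> (\<forall>x. x \<noteq> 0 \<longrightarrow> 0 < Re (cdot (A *v x) (\<chi> j. cnj (x $ j))))"

text \<open>The positive definite square root; only meaningful for positive definite arguments.\<close>

definition matrix_sqrt :: "complex ^ 'n ^ 'n \<Rightarrow> complex ^ 'n ^ 'n" where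
  "matrix_sqrt A = (THE S. pos_def_matrix S \<and> S ** S = A)"

section \<open>Wirtinger derivatives and the dual weight\<close>

definition real_dir_deriv ::
    "complex ^ 'n \<Rightarrow> (complex ^ 'n \<Rightarrow> complex) \<Rightarrow> complex ^ 'n \<Rightarrow> complex" where
  "real_dir_deriv v f x = vector_derivative (\<lambda>t::real. f (x + t *\<^sub>R v)) (at 0)"

definition wirt ::
    "'n::finite \<Rightarrow> (complex ^ 'n \<Rightarrow> complex) \<Rightarrow> complex ^ 'n \<Rightarrow> complex" where
  "wirt j f x =
    (real_dir_deriv (axis j 1) f x - \<i> * real_dir_deriv (axis j \<i>) f x) / 2"

definition wirt_bar ::
    "'n::finite \<Rightarrow> (complex ^ 'n \<Rightarrow> complex) \<Rightarrow> complex ^ 'n \<Rightarrow> complex" where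
  "wirt_bar j f x =
    (real_dir_deriv (axis j 1) f x + \<i> * real_dir_deriv (axis j \<i>) f x) / 2"

text \<open>Second derivatives of a quadratic form are constant, so they are evaluated at \<open>0\<close>.\<close>

definition hess_bar :: "(complex ^ 'n \<Rightarrow> real) \<Rightarrow> complex ^ 'n ^ 'n" where
  "hess_bar \<Phi> = (\<chi> j k. wirt_bar j (wirt k (\<lambda>x. complex_of_real (\<Phi> x))) 0)"

definition hess_holo :: "(complex ^ 'n \<Rightarrow> real) \<Rightarrow> complex ^ 'n ^ 'n" where
  "hess_holo \<Phi> = (\<chi> j k. wirt j (wirt k (\<lambda>x. complex_of_real (\<Phi> x))) 0)"

definition G_mat :: "(complex ^ 'n \<Rightarrow> real) \<Rightarrow> complex ^ 'n ^ 'n" where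
  "G_mat \<Phi> = 2 *\<^sub>R matrix_sqrt (hess_bar \<Phi>)"

definition C_plus :: "(complex ^ 'n \<Rightarrow> real) \<Rightarrow> complex ^ 'n ^ 'n" where
  "C_plus \<Phi> =
    (- 4) *\<^sub>R (matrix_inv (transpose (G_mat \<Phi>)) ** hess_holo \<Phi> ** matrix_inv (G_mat \<Phi>))"

definition E_mat :: "(complex ^ 'n \<Rightarrow> real) \<Rightarrow> complex ^ 'n ^ 'n" where
  "E_mat \<Phi> = matrix_inv (matrix_sqrt (mat 1 - ctranspose (C_plus \<Phi>) ** C_plus \<Phi>))"

definition G_dual :: "(complex ^ 'n \<Rightarrow> real) \<Rightarrow> complex ^ 'n ^ 'n" where
  "G_dual \<Phi> = E_mat \<Phi> ** matrix_inv (ctranspose (G_mat \<Phi>))"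

definition C_dual :: "(complex ^ 'n \<Rightarrow> real) \<Rightarrow> complex ^ 'n ^ 'n" where
  "C_dual \<Phi> = - (matrix_inv (transpose (E_mat \<Phi>)) ** C_plus \<Phi> ** E_mat \<Phi>)"

definition dual_weight :: "(complex ^ 'n \<Rightarrow> real) \<Rightarrow> complex ^ 'n \<Rightarrow> real" where
  "dual_weight \<Phi> x =
    ((norm (G_dual \<Phi> *v x))\<^sup>2
      - Re (cdot (G_dual \<Phi> *v x) (C_dual \<Phi> *v (G_dual \<Phi> *v x)))) / 4"

text \<open>The determinant is that of a positive definite matrix, hence a positive real number.\<close>

definition C_const :: "(complex ^ 'n \<Rightarrow> real) \<Rightarrow> real" where
  "C_const \<Phi> =
    Re (det (mat 1 - ctranspose (C_plus \<Phi>) ** C_plus \<Phi>)) powr (- 1 / 4) / (2 * pi) ^ CARD('n)"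

end

theory Submission
  imports Defs "HOL-Probability.Characteristic_Functions" "HOL-Complex_Analysis.Cauchy_Integral_Formula"
begin

text \<open>With the real inner product on \<open>\<complex>\<^sup>n\<close>, write \<open>4 \<Phi>(x) = P x \<bullet> x\<close>. The formulas for the dual weight say
  that \<open>2 \<Phi>d\<close> is the Legendre transform of \<open>2 \<Phi>\<close>, that is \<open>4 \<Phi>d(x) = P\<inverse> x \<bullet> x\<close>; in particular \<open>C_dual = - C_plus\<close>.
  Completing the square in the Gaussian integral of \<open>exp ((s \<cdot> cnj x + cnj t \<cdot> x) / 2)\<close> against
  \<open>exp (- 2 \<Phi>d)\<close> therefore reproduces the polarization of \<open>exp (2 \<Phi>)\<close>, which up to a constant is the
  reproducing kernel of \<open>H_space \<Phi> 1\<close> (by the mean value property over rotations \<open>z \<mapsto> \<zeta> z\<close>). Hence evaluation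
  at \<open>s\<close> corresponds, isometrically up to the factor \<open>C_const \<Phi>\<close>, to the function \<open>exp (s \<cdot> cnj x / 2)\<close> in
  \<open>L2 (exp (- 2 \<Phi>d))\<close>. Differentiating in \<open>s\<close>, the functional \<open>u \<mapsto> \<partial>\<^sup>\<alpha> u(0)\<close> corresponds to \<open>(cnj x / 2)\<^sup>\<alpha>\<close>, and
  its norm is read off from that of the monomial in the dual space.\<close>

section \<open>Linear changes of variables\<close>

text \<open>\<open>P\<close> and \<open>1 - R\<close> are only real linear, so their Jacobians are
  not given by complex determinants, yet the constant has to come out as a power of det(1 - C* C).
  Jacobians are therefore treated as volumes of images of a cube. They meet complex determinants
  only at the positive definite matrix \<open>H\<close>, the product of 1 - R and 1 + R: its volume
  factor is the square of its determinant, and the two factors share it equally. The volume factor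
  of \<open>G\<close> enters the kernel constant and the Gaussian integral alike and cancels. A
  second obstacle is that derivatives are represented by L2 limits of combinations of exponentials.
  The isometry is thus proved on the span of the exponentials and carried to its closure, where the
  difference quotients in \<open>s\<close> converge. The representing function is then an explicit
  element of \<open>H_space \<Phi> 1\<close>, and the rank one operator attains its norm
  there.\<close>

lemma translation_invariant_nn_integral:
  fixes M :: "'a::euclidean_space measure"
  assumes sets_M [measurable_cong]: "sets M = sets borel" and "sigma_finite_measure M"
    and inv: "\<And>a. distr M borel ((+) a) = M"
    and f [measurable]: "f \<in> borel_measurable borel" and g [measurable]: "g \<in> borel_measurable borel"
  shows "(\<integral>\<^sup>+x. f x \<partial>M) * (\<integral>\<^sup>+y. g y \<partial>lborel) = (\<integral>\<^sup>+x. g (- x) \<partial>M) * (\<integral>\<^sup>+y. f y \<partial>lborel)"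
proof -
  interpret M: sigma_finite_measure M by fact
  interpret pair_sigma_finite M lborel ..
  have shift: "(\<integral>\<^sup>+x. h x \<partial>M) = (\<integral>\<^sup>+x. h (a + x) \<partial>M)"
    if [measurable]: "h \<in> borel_measurable borel" for h :: "'a \<Rightarrow> ennreal" and a
    by (subst inv [of a, symmetric], subst nn_integral_distr) auto
  have shift': "(\<integral>\<^sup>+x. h x \<partial>lborel) = (\<integral>\<^sup>+x. h (a + x) \<partial>lborel)"
    if [measurable]: "h \<in> borel_measurable borel" for h :: "'a \<Rightarrow> ennreal" and a
    by (subst lborel_distr_plus [of a, symmetric], subst nn_integral_distr) auto
  have "(\<integral>\<^sup>+x. f x \<partial>M) * (\<integral>\<^sup>+y. g y \<partial>lborel) = (\<integral>\<^sup>+y. (\<integral>\<^sup>+x. f x * g y \<partial>M) \<partial>lborel)"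
    by (simp add: nn_integral_multc nn_integral_cmult)
  \<comment> \<open>Fubini for the double integral of f(y + x) g(y): a shift in \<open>x\<close> for
    \<open>M\<close>, one in \<open>y\<close> for Lebesgue measure and another in \<open>x\<close>
    separate the variables. With \<open>g\<close> the indicator of a cube, this is uniqueness of
    translation invariant measures up to a factor.\<close>
  also have "\<dots> = (\<integral>\<^sup>+y. (\<integral>\<^sup>+x. f (y + x) * g y \<partial>M) \<partial>lborel)"
    by (intro nn_integral_cong shift) measurable
  also have "\<dots> = (\<integral>\<^sup>+x. (\<integral>\<^sup>+y. f (y + x) * g y \<partial>lborel) \<partial>M)"
    by (intro Fubini') measurable
  also have "\<dots> = (\<integral>\<^sup>+x. (\<integral>\<^sup>+y. f y * g (y - x) \<partial>lborel) \<partial>M)"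
  proof (rule nn_integral_cong)
    fix x
    show "(\<integral>\<^sup>+y. f (y + x) * g y \<partial>lborel) = (\<integral>\<^sup>+y. f y * g (y - x) \<partial>lborel)"
      by (subst (2) shift' [of _ x]) (auto simp: add.commute)
  qed
  also have "\<dots> = (\<integral>\<^sup>+y. (\<integral>\<^sup>+x. f y * g (y - x) \<partial>M) \<partial>lborel)"
    by (intro Fubini' [symmetric]) measurable
  also have "\<dots> = (\<integral>\<^sup>+y. f y * (\<integral>\<^sup>+x. g (- x) \<partial>M) \<partial>lborel)"
  proof (rule nn_integral_cong)
    fix y
    show "(\<integral>\<^sup>+x. f y * g (y - x) \<partial>M) = f y * (\<integral>\<^sup>+x. g (- x) \<partial>M)"
      by (subst shift [of _ y]) (auto simp: nn_integral_cmult)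
  qed
  also have "\<dots> = (\<integral>\<^sup>+x. g (- x) \<partial>M) * (\<integral>\<^sup>+y. f y \<partial>lborel)"
    by (simp add: nn_integral_multc mult.commute)
  finally show ?thesis .
qed

text \<open>The absolute value of the real determinant, phrased through volume so that it makes
  sense on any Euclidean space and for maps of \<open>complex ^ 'n\<close> that are only real
  linear.\<close>

definition vol_factor :: "('a::euclidean_space \<Rightarrow> 'a) \<Rightarrow> real" where
  "vol_factor T = measure lborel (T ` cbox 0 One)"

lemma linear_bij_inv:
  fixes T :: "'a::euclidean_space \<Rightarrow> 'a"
  assumes "linear T" "bij T"
  shows "linear (inv T)" "bij (inv T)" "T (inv T x) = x" "inv T (T x) = x"
proof -
  show "T (inv T x) = x" for x using assms by (simp add: bij_is_surj surj_f_inv_f)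
  show "inv T (T x) = x" for x using assms by (simp add: bij_is_inj)
  show "bij (inv T)" using assms by (simp add: bij_imp_bij_inv)
  show "linear (inv T)"
    using assms by (metis bij_is_inj bij_is_surj inj_linear_imp_inv_linear)
qed

lemma linear_measurable:
  "linear (T :: 'a::euclidean_space \<Rightarrow> 'b::real_normed_vector) \<Longrightarrow> T \<in> borel_measurable borel"
  by (intro borel_measurable_continuous_onI linear_continuous_on linear_conv_bounded_linear [THEN iffD1])

text \<open>The image of Lebesgue measure under \<open>T\<close> is sigma-finite and translation
  invariant, hence a multiple of Lebesgue measure; testing on the image of the unit cube identifies
  the multiple.\<close>

lemma vol_factor_nn_integral:
  fixes T :: "'a::euclidean_space \<Rightarrow> 'a"
  assumes T: "linear T" "bij T"
  shows "vol_factor T > 0"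
    and "f \<in> borel_measurable borel \<Longrightarrow>
      (\<integral>\<^sup>+x. f x \<partial>lborel) = ennreal (vol_factor T) * (\<integral>\<^sup>+x. f (T x) \<partial>lborel)"
proof -
  define M where "M = distr lborel borel T"
  note inv = linear_bij_inv [OF T]
  have [measurable]: "T \<in> borel_measurable borel" "inv T \<in> borel_measurable borel"
    using T inv by (auto intro: linear_measurable)
  have [measurable_cong]: "sets M = sets borel" by (simp add: M_def)
  have int_M: "(\<integral>\<^sup>+x. h x \<partial>M) = (\<integral>\<^sup>+x. h (T x) \<partial>lborel)"
    if [measurable]: "h \<in> borel_measurable borel" for h
    unfolding M_def by (subst nn_integral_distr) auto
  have img: "T ` A = inv T -` A" for A
  proof (intro equalityI subsetI)
    show "x \<in> T ` A" if "x \<in> inv T -` A" for x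
      using inv(3) [of x] that by (metis imageI vimageE)
  qed (auto simp: inv(4))
  have em: "emeasure M (T ` A) = emeasure lborel A" if "A \<in> sets borel" for A
  proof -
    have "T ` A \<in> sets borel"
      unfolding img using measurable_sets [of "inv T" borel borel A] that by simp
    then show ?thesis
      using inv(4) T unfolding M_def
      by (subst emeasure_distr) (auto simp: inj_vimage_image_eq bij_is_inj)
  qed
  have sf: "sigma_finite_measure M"
  proof -
    let ?F = "range (\<lambda>n::nat. T ` cball 0 (real n))"
    have "T ` cball 0 r \<in> sets borel" for r
      using T by (intro borel_compact compact_continuous_image linear_continuous_on)
        (auto simp: linear_conv_bounded_linear)
    moreover have "\<Union> ?F = UNIV"
    proof -
      have "y \<in> \<Union> ?F" for y
      proof -
        obtain n :: nat where "norm (inv T y) \<le> n" using real_arch_simple by blast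
        then have "y \<in> T ` cball 0 (real n)" by (auto simp: img)
        then show ?thesis by blast
      qed
      then show ?thesis by auto
    qed
    moreover have "emeasure M (T ` cball 0 r) \<noteq> \<infinity>" for r
      by (subst em) (use emeasure_lborel_cball_finite in \<open>auto simp: top.not_eq_extremum\<close>)
    ultimately show ?thesis
      by (intro sigma_finite_measure.intro exI [of _ ?F]) (auto simp: M_def)
  qed
  have tr: "distr M borel ((+) a) = M" for a
  proof -
    have "distr M borel ((+) a) = distr (distr lborel borel ((+) (inv T a))) borel T"
      unfolding M_def using inv(3) T
      by (subst (1 2) distr_distr) (auto simp: o_def linear_add)
    then show ?thesis by (simp add: lborel_distr_plus M_def)
  qed
  note key = translation_invariant_nn_integral [OF \<open>sets M = sets borel\<close> sf tr]
  define Q :: "'a set" where "Q = cbox 0 One"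
  have TQ: "T ` Q \<in> sets borel" "bounded (T ` Q)"
    using T by (auto simp: Q_def linear_conv_bounded_linear
       intro!: borel_compact compact_continuous_image linear_continuous_on bounded_linear_image)
  have Q1: "emeasure lborel Q = 1" by (auto simp: Q_def emeasure_lborel_cbox_eq)
  have vol: "emeasure lborel (T ` Q) = ennreal (vol_factor T)"
    using emeasure_bounded_finite [OF TQ(2)] unfolding vol_factor_def Q_def
    by (simp add: emeasure_eq_ennreal_measure top.not_eq_extremum)
  define c where "c = (\<integral>\<^sup>+x. indicator Q (- x) \<partial>M)"
  have key': "(\<integral>\<^sup>+x. f (T x) \<partial>lborel) = c * (\<integral>\<^sup>+x. f x \<partial>lborel)"
    if [measurable]: "f \<in> borel_measurable borel" for f
    using key [of f "indicator Q"] Q1 by (simp add: int_M c_def Q_def)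
  have "emeasure M (T ` Q) = 1" using em [of Q] Q1 by (simp add: Q_def)
  then have 1: "c * ennreal (vol_factor T) = 1"
    using key' [of "indicator (T ` Q)"] TQ(1) vol int_M [of "indicator (T ` Q)"]
    by (simp add: M_def)
  then show "vol_factor T > 0"
    by (metis ennreal_eq_0_iff linorder_not_less mult_zero_right zero_neq_one)
  show "(\<integral>\<^sup>+x. f x \<partial>lborel) = ennreal (vol_factor T) * (\<integral>\<^sup>+x. f (T x) \<partial>lborel)"
    if "f \<in> borel_measurable borel"
    using key' [OF that] 1 by (metis mult.assoc mult.commute mult.right_neutral)
qed

text \<open>Testing on the image of the unit cube shows that any change of variables formula for
  \<open>T\<close> determines its volume factor; this is how volume factors are computed
  below.\<close>

lemma vol_factor_unique:
  fixes T :: "'a::euclidean_space \<Rightarrow> 'a"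
  assumes "linear T" "bij T" "c \<ge> 0"
    and c: "\<And>f. f \<in> borel_measurable borel \<Longrightarrow>
      (\<integral>\<^sup>+x. f x \<partial>lborel) = ennreal c * (\<integral>\<^sup>+x. f (T x) \<partial>lborel)"
  shows "vol_factor T = c"
proof -
  let ?f = "indicator (T ` cbox 0 One) :: 'a \<Rightarrow> ennreal"
  have TQ: "T ` cbox 0 One \<in> sets borel" "bounded (T ` cbox 0 One)"
    using assms by (auto simp: linear_conv_bounded_linear
       intro!: borel_compact compact_continuous_image linear_continuous_on bounded_linear_image)
  have "?f (T x) = indicator (cbox 0 One) x" for x
    using assms(2) by (auto simp: indicator_def bij_is_inj inj_image_mem_iff)
  then have "emeasure lborel (T ` cbox 0 One) = ennreal c"
    using c [of ?f] TQ(1) by (simp add: emeasure_lborel_cbox_eq)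
  then show ?thesis
    using assms(3) by (simp add: vol_factor_def measure_def)
qed

lemma vol_factor_comp:
  fixes S T :: "'a::euclidean_space \<Rightarrow> 'a"
  assumes S: "linear S" "bij S" and T: "linear T" "bij T"
  shows "vol_factor (\<lambda>x. S (T x)) = vol_factor S * vol_factor T"
proof (rule vol_factor_unique)
  have [measurable]: "S \<in> borel_measurable borel" "T \<in> borel_measurable borel"
    using S T by (auto intro: linear_measurable)
  show "linear (\<lambda>x. S (T x))" "bij (\<lambda>x. S (T x))"
    using linear_compose [OF T(1) S(1)] bij_comp [OF T(2) S(2)] by (auto simp: o_def)
  show "vol_factor S * vol_factor T \<ge> 0"
    using vol_factor_nn_integral(1) [OF S] vol_factor_nn_integral(1) [OF T] by simp
  show "(\<integral>\<^sup>+x. f x \<partial>lborel) =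
      ennreal (vol_factor S * vol_factor T) * (\<integral>\<^sup>+x. f (S (T x)) \<partial>lborel)"
    if [measurable]: "f \<in> borel_measurable borel" for f
    using vol_factor_nn_integral(1) [OF S] vol_factor_nn_integral(1) [OF T]
      vol_factor_nn_integral(2) [OF S, of f] vol_factor_nn_integral(2) [OF T, of "\<lambda>x. f (S x)"]
    by (simp add: ennreal_mult mult.assoc)
qed

lemma vol_factor_id: "vol_factor (\<lambda>x::'a::euclidean_space. x) = 1"
  by (rule vol_factor_unique) (auto simp: bij_id [unfolded id_def] linear_ident)

text \<open>The involution \<open>U\<close> conjugates \<open>T\<close> into its inverse. The volume
  factors of \<open>U\<close> and \<open>T\<close> are thus positive numbers with square 1.\<close>

lemma vol_factor_conj_inverse:
  fixes T U :: "'a::euclidean_space \<Rightarrow> 'a"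
  assumes T: "linear T" "bij T" and U: "linear U" "bij U" and UTU: "\<And>x. U (T (U (T x))) = x"
    and UU: "\<And>x. U (U x) = x"
  shows "vol_factor T = 1"
proof -
  note pos = vol_factor_nn_integral(1)
  have "vol_factor (\<lambda>x. U (U x)) = 1" using UU by (simp add: vol_factor_id)
  then have "vol_factor U * vol_factor U = 1"
    using vol_factor_comp [OF U U] by simp
  then have u: "vol_factor U = 1"
    using pos [OF U] by (metis abs_of_pos abs_square_eq_1 power2_eq_square)
  have UT: "linear (\<lambda>x. U (T x))" "bij (\<lambda>x. U (T x))"
    using linear_compose [OF T(1) U(1)] bij_comp [OF T(2) U(2)] by (auto simp: o_def)
  have "vol_factor (\<lambda>x. U (T (U (T x)))) = 1" using UTU by (simp add: vol_factor_id)
  then have "vol_factor T * vol_factor T = 1"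
    using vol_factor_comp [OF UT UT] vol_factor_comp [OF U T] u by simp
  then show ?thesis
    using pos [OF T] by (metis abs_of_pos abs_square_eq_1 power2_eq_square)
qed

text \<open>The unit ball is its own preimage, so testing the change of variables formula on its
  indicator leaves only the factor 1.\<close>

lemma vol_factor_isometry:
  fixes T :: "'a::euclidean_space \<Rightarrow> 'a"
  assumes T: "linear T" and iso: "\<And>x. norm (T x) = norm x"
  shows "bij T" "vol_factor T = 1"
proof -
  have "inj T"
    using T iso by (metis (no_types, opaque_lifting) linear_injective_0 norm_eq_zero)
  then show b: "bij T" using T by (simp add: bij_def linear_inj_imp_surj)
  let ?B = "indicator (ball 0 1) :: 'a \<Rightarrow> ennreal"
  have fin: "emeasure lborel (ball (0::'a) 1) = ennreal (measure lborel (ball (0::'a) 1))"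
    using emeasure_lborel_ball_finite [of "0::'a" 1]
    by (simp add: emeasure_eq_ennreal_measure top.not_eq_extremum)
  have pos: "measure lborel (ball (0::'a) 1) > 0"
    using content_ball_pos [of 1 "0::'a"] by simp
  have "?B (T x) = ?B x" for x by (simp add: indicator_def iso)
  then have "ennreal (measure lborel (ball (0::'a) 1)) =
      ennreal (vol_factor T * measure lborel (ball (0::'a) 1))"
    using vol_factor_nn_integral(1) [OF T b]
      vol_factor_nn_integral(2) [OF T b, of ?B, OF borel_measurable_indicator] fin
    by (simp add: ennreal_mult)
  then show "vol_factor T = 1"
    using vol_factor_nn_integral(1) [OF T b] pos by (simp add: ennreal_inj)
qed

text \<open>Restates the change of variables as an equality of measures, which carries it from
  nonnegative to Bochner integrals.\<close>

lemma lborel_linear_density: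
  fixes T :: "'a::euclidean_space \<Rightarrow> 'a"
  assumes T: "linear T" "bij T"
  shows "lborel = density (distr lborel borel T) (\<lambda>_. ennreal (vol_factor T))"
proof (rule measure_eqI)
  fix A :: "'a set" assume "A \<in> sets lborel"
  then show "emeasure lborel A = emeasure (density (distr lborel borel T) (\<lambda>_. ennreal (vol_factor T))) A"
    using vol_factor_nn_integral(2) [OF T, of "indicator A"] linear_measurable [OF T(1)]
      nn_integral_distr [of T lborel borel "indicator A"]
    by (simp add: emeasure_density nn_integral_cmult)
qed simp

lemma vol_factor_integral:
  fixes T :: "'a::euclidean_space \<Rightarrow> 'a" and f :: "'a \<Rightarrow> 'b::{banach, second_countable_topology}"
  assumes T: "linear T" "bij T" and [measurable]: "f \<in> borel_measurable borel"
  shows "(LINT x|lborel. f x) = vol_factor T *\<^sub>R (LINT x|lborel. f (T x))"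
    and "integrable lborel f \<longleftrightarrow> integrable lborel (\<lambda>x. f (T x))"
proof -
  have [measurable]: "T \<in> borel_measurable borel" using T by (auto intro: linear_measurable)
  have pos: "vol_factor T > 0" by (rule vol_factor_nn_integral(1) [OF T])
  show "(LINT x|lborel. f x) = vol_factor T *\<^sub>R (LINT x|lborel. f (T x))"
    using pos by (subst lborel_linear_density [OF T], subst integral_density)
      (auto simp: integral_distr)
  show "integrable lborel f \<longleftrightarrow> integrable lborel (\<lambda>x. f (T x))"
    using pos integrable_scaleR_right [of "inverse (vol_factor T)" lborel "\<lambda>x. vol_factor T *\<^sub>R f (T x)"]
    by (subst lborel_linear_density [OF T], subst integrable_density)
      (auto simp: integrable_distr_eq)
qed

lemma vol_factor_diagonal:
  fixes c :: "'a::euclidean_space \<Rightarrow> real"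
  assumes c: "\<And>b. b \<in> Basis \<Longrightarrow> c b > 0"
  defines "T \<equiv> \<lambda>x. \<Sum>b\<in>Basis. (c b * (x \<bullet> b)) *\<^sub>R b"
  shows "linear T" "bij T" "vol_factor T = (\<Prod>b\<in>Basis. c b)"
proof -
  show l: "linear T"
    unfolding T_def by (auto intro!: linear_compose_sum linear_scaleR_left linearI
        simp: algebra_simps)
  have co: "T x \<bullet> b = c b * (x \<bullet> b)" if "b \<in> Basis" for x b
    using that by (simp add: T_def)
  have "inj T"
  proof (rule injI)
    fix x y assume "T x = T y"
    then show "x = y" using co c
      by (metis euclidean_eqI less_irrefl mult_left_cancel)
  qed
  then show b: "bij T" using l by (simp add: bij_def linear_inj_imp_surj)
  have [measurable]: "T \<in> borel_measurable borel" using l by (auto intro: linear_measurable)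
  have eq: "lborel = density (distr lborel borel T) (\<lambda>_. (\<Prod>j\<in>Basis. \<bar>c j\<bar>))"
    using lborel_affine_euclidean [of c 0] c unfolding T_def by (simp add: less_imp_neq [symmetric])
  show "vol_factor T = (\<Prod>b\<in>Basis. c b)"
  proof (rule vol_factor_unique [OF l b])
    show "(\<Prod>b\<in>Basis. c b) \<ge> 0" using c by (intro prod_nonneg) (auto simp: less_imp_le)
    fix f :: "'a \<Rightarrow> ennreal" assume [measurable]: "f \<in> borel_measurable borel"
    have "(\<Prod>b\<in>Basis. \<bar>c b\<bar>) = (\<Prod>b\<in>Basis. c b)" using c by (intro prod.cong) (auto simp: less_imp_le)
    then show "(\<integral>\<^sup>+x. f x \<partial>lborel) = ennreal (\<Prod>b\<in>Basis. c b) * (\<integral>\<^sup>+x. f (T x) \<partial>lborel)"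
      by (subst eq, subst nn_integral_density) (auto simp: nn_integral_distr nn_integral_cmult)
  qed
qed

lemma linear_smult: "linear (\<lambda>z::complex ^ 'n. \<zeta> *s z)"
  by (rule linearI) (auto simp: vec_eq_iff algebra_simps scaleR_conv_of_real)

lemma norm_smult: "norm (\<zeta> *s z) = cmod \<zeta> * norm (z :: complex ^ 'n)"
  by (simp add: norm_vec_def L2_set_def norm_mult power_mult_distrib sum_distrib_left [symmetric] real_sqrt_mult)

section \<open>Gaussian integrals\<close>

lemma lborel_integral_prod_Basis:
  fixes f :: "'a::euclidean_space \<Rightarrow> real \<Rightarrow> complex"
  assumes f: "\<And>b. b \<in> Basis \<Longrightarrow> integrable lborel (f b)"
  shows "integrable lborel (\<lambda>x::'a. \<Prod>b\<in>Basis. f b (x \<bullet> b))"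
    and "(LINT x|lborel. (\<Prod>b\<in>Basis. f b (x \<bullet> b))) = (\<Prod>b\<in>Basis. LINT t|lborel. f b t)"
proof -
  interpret product_sigma_finite "\<lambda>_::'a. lborel :: real measure" ..
  let ?P = "\<Pi>\<^sub>M b\<in>(Basis::'a set). (lborel :: real measure)"
  let ?e = "\<lambda>g. \<Sum>b\<in>(Basis::'a set). g b *\<^sub>R b"
  have eq: "(lborel :: 'a measure) = distr ?P borel ?e"
    unfolding lborel_eq_real by (rule lborel_def)
  have e [measurable]: "?e \<in> ?P \<rightarrow>\<^sub>M borel" by measurable
  have [measurable]: "(\<lambda>x. \<Prod>b\<in>Basis. f b (x \<bullet> b)) \<in> borel_measurable (borel :: 'a measure)"
  proof (rule borel_measurable_prod)
    fix b :: 'a assume "b \<in> Basis"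
    then have [measurable]: "f b \<in> borel_measurable borel"
      using f borel_measurable_integrable by fastforce
    show "(\<lambda>x. f b (x \<bullet> b)) \<in> borel_measurable borel" by measurable
  qed
  have co: "(\<Prod>b\<in>Basis. f b (?e g \<bullet> b)) = (\<Prod>b\<in>Basis. f b (g b))" for g
    by (intro prod.cong) auto
  show "integrable lborel (\<lambda>x::'a. \<Prod>b\<in>Basis. f b (x \<bullet> b))"
    unfolding eq by (subst integrable_distr_eq) (auto simp: co intro!: product_integrable_prod f)
  show "(LINT x|lborel. (\<Prod>b\<in>Basis. f b (x \<bullet> b))) = (\<Prod>b\<in>Basis. LINT t|lborel. f b t)"
    unfolding eq by (subst integral_distr) (auto simp: co intro!: product_integral_prod f)
qed

text \<open>Up to the factor sqrt(2 pi), this is the characteristic function of the standard normal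
  distribution.\<close>

lemma gaussian_fourier_real:
  fixes t :: real
  shows "integrable lborel (\<lambda>x::real. exp (complex_of_real (- (x\<^sup>2) / 2) + \<i> * (t * x)))"
    and "(LINT x|lborel. exp (complex_of_real (- (x\<^sup>2) / 2) + \<i> * (t * x))) =
      complex_of_real (sqrt (2 * pi) * exp (- (t\<^sup>2) / 2))"
proof -
  let ?s = "sqrt (2 * pi)"
  have e: "exp (complex_of_real (- (x\<^sup>2) / 2) + \<i> * (t * x)) =
      ?s *\<^sub>R (std_normal_density x *\<^sub>R iexp (t * x))" for x
    by (simp add: std_normal_density_def scaleR_conv_of_real exp_of_real [symmetric] mult_exp_exp)
  have i: "integrable lborel (\<lambda>x. std_normal_density x *\<^sub>R iexp (t * x))"
    by (rule Bochner_Integration.integrable_bound [OF integrable_std_normal_moment [of 0]]) auto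
  show "integrable lborel (\<lambda>x::real. exp (complex_of_real (- (x\<^sup>2) / 2) + \<i> * (t * x)))"
    unfolding e by (rule integrable_scaleR_right, rule i)
  have "char std_normal_distribution t = (LINT x|lborel. std_normal_density x *\<^sub>R iexp (t * x))"
    unfolding char_def by (subst integral_density) auto
  then show "(LINT x|lborel. exp (complex_of_real (- (x\<^sup>2) / 2) + \<i> * (t * x))) =
      complex_of_real (sqrt (2 * pi) * exp (- (t\<^sup>2) / 2))"
    unfolding e by (subst integral_scaleR_right)
      (auto simp: char_std_normal_distribution scaleR_conv_of_real)
qed

lemma gaussian_fourier:
  fixes v :: "'a::euclidean_space"
  shows "integrable lborel (\<lambda>x::'a. exp (complex_of_real (- ((norm x)\<^sup>2) / 2) + \<i> * (v \<bullet> x)))"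
    and "(LINT x::'a|lborel. exp (complex_of_real (- ((norm x)\<^sup>2) / 2) + \<i> * (v \<bullet> x))) =
      complex_of_real (sqrt (2 * pi) ^ DIM('a) * exp (- ((norm v)\<^sup>2) / 2))"
proof -
  let ?f = "\<lambda>b t::real. exp (complex_of_real (- (t\<^sup>2) / 2) + \<i> * ((v \<bullet> b) * t))"
  have e: "exp (complex_of_real (- ((norm x)\<^sup>2) / 2) + \<i> * (v \<bullet> x)) = (\<Prod>b\<in>Basis. ?f b (x \<bullet> b))" for x
  proof -
    have "(norm x)\<^sup>2 = (\<Sum>b\<in>Basis. (x \<bullet> b)\<^sup>2)"
      unfolding power2_norm_eq_inner by (subst euclidean_inner) (simp add: power2_eq_square)
    moreover have "v \<bullet> x = (\<Sum>b\<in>Basis. (v \<bullet> b) * (x \<bullet> b))" by (rule euclidean_inner)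
    ultimately show ?thesis
      by (simp add: exp_sum [symmetric] sum_subtractf sum_distrib_left sum_divide_distrib)
  qed
  have nv: "(norm v)\<^sup>2 = (\<Sum>b\<in>Basis. (v \<bullet> b)\<^sup>2)"
    unfolding power2_norm_eq_inner by (subst euclidean_inner) (simp add: power2_eq_square)
  show "integrable lborel (\<lambda>x::'a. exp (complex_of_real (- ((norm x)\<^sup>2) / 2) + \<i> * (v \<bullet> x)))"
    unfolding e by (intro lborel_integral_prod_Basis gaussian_fourier_real)
  show "(LINT x::'a|lborel. exp (complex_of_real (- ((norm x)\<^sup>2) / 2) + \<i> * (v \<bullet> x))) =
      complex_of_real (sqrt (2 * pi) ^ DIM('a) * exp (- ((norm v)\<^sup>2) / 2))"
  proof -
    have "(LINT x::'a|lborel. exp (complex_of_real (- ((norm x)\<^sup>2) / 2) + \<i> * (v \<bullet> x))) =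
        (\<Prod>b\<in>Basis. LINT t|lborel. ?f b t)"
      unfolding e by (intro lborel_integral_prod_Basis gaussian_fourier_real)
    also have "\<dots> = (\<Prod>b\<in>Basis. complex_of_real (sqrt (2 * pi) * exp (- ((v \<bullet> b)\<^sup>2) / 2)))"
      using gaussian_fourier_real(2) by (intro prod.cong refl) (simp del: real_sqrt_mult)
    also have "\<dots> = complex_of_real (\<Prod>b\<in>(Basis::'a set). sqrt (2 * pi) * exp (- ((v \<bullet> b)\<^sup>2) / 2))"
      by (simp only: of_real_prod)
    also have "(\<Prod>b\<in>(Basis::'a set). sqrt (2 * pi) * exp (- ((v \<bullet> b)\<^sup>2) / 2)) =
        sqrt (2 * pi) ^ DIM('a) * exp (- ((norm v)\<^sup>2) / 2)"
      by (simp add: prod.distrib nv exp_sum [symmetric] sum_divide_distrib sum_negf del: real_sqrt_mult)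
    finally show ?thesis .
  qed
qed

text \<open>After the substitution y = S x, a shift by the real vector \<open>S a\<close> absorbs
  the real linear term, and the imaginary linear term is a Fourier transform. Writing both linear
  terms through \<open>S\<close> keeps the result free of inverses.\<close>

lemma gaussian_integral:
  fixes S :: "'a::euclidean_space \<Rightarrow> 'a"
  assumes S: "linear S" "bij S"
  shows "integrable lborel (\<lambda>x. exp (complex_of_real (- ((norm (S x))\<^sup>2) / 2 + S a \<bullet> S x) + \<i> * (S b \<bullet> S x)))"
    and "(LINT x|lborel. exp (complex_of_real (- ((norm (S x))\<^sup>2) / 2 + S a \<bullet> S x) + \<i> * (S b \<bullet> S x))) =
      complex_of_real (sqrt (2 * pi) ^ DIM('a) / vol_factor S) *
      exp (complex_of_real ((norm (S a))\<^sup>2 / 2 - (norm (S b))\<^sup>2 / 2) + \<i> * (S a \<bullet> S b))"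
proof -
  let ?g = "\<lambda>y. exp (complex_of_real (- ((norm y)\<^sup>2) / 2 + S a \<bullet> y) + \<i> * (S b \<bullet> y))"
  let ?h = "\<lambda>y. exp (complex_of_real (- ((norm y)\<^sup>2) / 2) + \<i> * (S b \<bullet> y))"
  let ?c = "exp (complex_of_real ((norm (S a))\<^sup>2 / 2) + \<i> * (S a \<bullet> S b))"
  have [measurable]: "?g \<in> borel_measurable borel"
    by (intro borel_measurable_continuous_onI continuous_intros) simp_all
  have sh: "?g (S a + y) = ?c * ?h y" for y
  proof -
    have r: "- ((norm (S a + y))\<^sup>2) / 2 + S a \<bullet> (S a + y) = (norm (S a))\<^sup>2 / 2 - (norm y)\<^sup>2 / 2"
      using inner_commute [of y "S a"]
      by (simp add: power2_norm_eq_inner inner_add_left inner_add_right field_simps)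
    show ?thesis unfolding r
      using inner_commute [of "S b" "S a"] by (simp add: inner_add_right mult_exp_exp algebra_simps diff_divide_distrib)
  qed
  have "integrable lborel (\<lambda>y. ?g (S a + y))"
    unfolding sh using gaussian_fourier(1) [of "S b"] by simp
  then have ig: "integrable lborel ?g"
    using lborel_distr_plus [of "S a"] integrable_distr_eq [of "(+) (S a)" lborel borel ?g] by simp
  have "(LINT y|lborel. ?g y) = (LINT y|lborel. ?g (S a + y))"
    by (subst lborel_distr_plus [of "S a", symmetric], subst integral_distr) auto
  also have "\<dots> = ?c * (LINT y|lborel. ?h y)" unfolding sh by simp
  also have "\<dots> = complex_of_real (sqrt (2 * pi) ^ DIM('a)) *
      exp (complex_of_real ((norm (S a))\<^sup>2 / 2 - (norm (S b))\<^sup>2 / 2) + \<i> * (S a \<bullet> S b))"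
    unfolding gaussian_fourier(2) by (simp add: exp_of_real [symmetric] mult_exp_exp algebra_simps del: real_sqrt_mult)
  finally have v: "(LINT y|lborel. ?g y) = \<dots>" .
  show "integrable lborel (\<lambda>x. ?g (S x))"
    using vol_factor_integral(2) [OF S, of ?g] ig by simp
  show "(LINT x|lborel. ?g (S x)) =
      complex_of_real (sqrt (2 * pi) ^ DIM('a) / vol_factor S) *
      exp (complex_of_real ((norm (S a))\<^sup>2 / 2 - (norm (S b))\<^sup>2 / 2) + \<i> * (S a \<bullet> S b))"
    using vol_factor_integral(1) [OF S, of ?g] v vol_factor_nn_integral(1) [OF S]
    by (simp add: scaleR_conv_of_real field_simps del: real_sqrt_mult)
qed

lemma integrable_gaussian_bound:
  fixes f :: "'a::euclidean_space \<Rightarrow> 'b::{banach, second_countable_topology}"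
  assumes [measurable]: "f \<in> borel_measurable borel" and m: "m > 0"
    and bound: "\<And>x. norm (f x) \<le> K * exp (r * norm x - m * (norm x)\<^sup>2)"
  shows "integrable lborel f"
proof -
  define S where "S = (\<lambda>x::'a. sqrt m *\<^sub>R x)"
  have S: "linear S" "bij S"
  proof -
    show l: "linear S" by (auto simp: S_def intro!: linearI simp: algebra_simps)
    have "inj S" using m by (auto simp: S_def inj_on_def)
    then show "bij S" using l by (simp add: bij_def linear_inj_imp_surj)
  qed
  have "integrable lborel (\<lambda>x. cmod (exp (complex_of_real (- ((norm (S x))\<^sup>2) / 2 + S 0 \<bullet> S x) + \<i> * (S 0 \<bullet> S x))))"
    by (intro integrable_norm gaussian_integral S)
  then have i: "integrable lborel (\<lambda>x::'a. exp (- (m * (norm x)\<^sup>2 / 2)))"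
    using m by (simp add: S_def power_mult_distrib)
  have K: "K \<ge> 0"
    using bound [of 0] by (simp add: order_trans [OF norm_ge_zero])
  show ?thesis
  proof (rule Bochner_Integration.integrable_bound)
    show "integrable lborel (\<lambda>x::'a. K * exp (r\<^sup>2 / (2 * m)) * exp (- (m * (norm x)\<^sup>2 / 2)))"
      using i by simp
    have "r * t - m * t\<^sup>2 \<le> r\<^sup>2 / (2 * m) - m * t\<^sup>2 / 2" for t
    proof -
      \<comment> \<open>Completing the square absorbs the linear growth at the price of half of the
        quadratic decay.\<close>
      have "0 \<le> (r - m * t)\<^sup>2 / (2 * m)" using m by simp
      also have "\<dots> = r\<^sup>2 / (2 * m) - r * t + m * t\<^sup>2 / 2"
        using m by (simp add: power2_diff field_simps power2_eq_square)
      finally show ?thesis by simp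
    qed
    then have "K * exp (r * t - m * t\<^sup>2) \<le> K * exp (r\<^sup>2 / (2 * m)) * exp (- (m * t\<^sup>2 / 2))" for t
      using K by (simp add: mult.assoc exp_add [symmetric] mult_left_mono)
    then show "AE x in lborel. norm (f x) \<le> norm (K * exp (r\<^sup>2 / (2 * m)) * exp (- (m * (norm x)\<^sup>2 / 2)))"
      using K by (intro AE_I2 order_trans [OF bound]) (simp add: abs_mult)
  qed auto
qed

section \<open>Square integrable functions\<close>

text \<open>Functions rather than classes modulo null sets, so that weighted entire functions are
  elements as they stand; \<open>L2_norm\<close> is then only a seminorm.\<close>

definition L2 :: "'a measure \<Rightarrow> ('a \<Rightarrow> complex) set" where
  "L2 M = {f. f \<in> borel_measurable M \<and> integrable M (\<lambda>x. (cmod (f x))\<^sup>2)}"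

definition L2_inner :: "'a measure \<Rightarrow> ('a \<Rightarrow> complex) \<Rightarrow> ('a \<Rightarrow> complex) \<Rightarrow> complex" where
  "L2_inner M f g = (LINT x|M. f x * cnj (g x))"

definition L2_norm :: "'a measure \<Rightarrow> ('a \<Rightarrow> complex) \<Rightarrow> real" where
  "L2_norm M f = sqrt (LINT x|M. (cmod (f x))\<^sup>2)"

lemma L2_measurable: "f \<in> L2 M \<Longrightarrow> f \<in> borel_measurable M"
  by (simp add: L2_def)

lemma L2_scale: "f \<in> L2 M \<Longrightarrow> (\<lambda>x. c * f x) \<in> L2 M"
  by (auto simp: L2_def norm_mult power_mult_distrib)

lemma L2_add: 
  assumes "f \<in> L2 M" "g \<in> L2 M" shows "(\<lambda>x. f x + g x) \<in> L2 M"
proof -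
  have [measurable]: "f \<in> borel_measurable M" "g \<in> borel_measurable M" using assms by (auto simp: L2_def)
  have "(cmod (a + b))\<^sup>2 \<le> 2 * (cmod a)\<^sup>2 + 2 * (cmod b)\<^sup>2" for a b
  proof -
    have "(cmod (a + b))\<^sup>2 \<le> (cmod a + cmod b)\<^sup>2" by (intro power_mono norm_triangle_ineq) auto
    also have "\<dots> \<le> 2 * (cmod a)\<^sup>2 + 2 * (cmod b)\<^sup>2"
      using sum_squares_bound [of "cmod a" "cmod b"] by (simp add: power2_sum)
    finally show ?thesis .
  qed
  then have bd: "AE x in M. norm ((cmod (f x + g x))\<^sup>2) \<le> norm (2 * (cmod (f x))\<^sup>2 + 2 * (cmod (g x))\<^sup>2)"
    by (intro AE_I2) simp
  have "integrable M (\<lambda>x. 2 * (cmod (f x))\<^sup>2 + 2 * (cmod (g x))\<^sup>2)"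
    using assms by (simp add: L2_def)
  then have "integrable M (\<lambda>x. (cmod (f x + g x))\<^sup>2)"
    by (rule Bochner_Integration.integrable_bound [OF _ _ bd]) measurable
  then show ?thesis by (simp add: L2_def)
qed

lemma L2_diff: "f \<in> L2 M \<Longrightarrow> g \<in> L2 M \<Longrightarrow> (\<lambda>x. f x - g x) \<in> L2 M"
  using L2_add [of f M "\<lambda>x. -1 * g x"] L2_scale [of g M "-1"] by simp

lemma L2_integrable_mult:
  assumes "f \<in> L2 M" "g \<in> L2 M" shows "integrable M (\<lambda>x. f x * cnj (g x))"
proof -
  have [measurable]: "f \<in> borel_measurable M" "g \<in> borel_measurable M" using assms by (auto simp: L2_def)
  have [measurable]: "cnj \<in> borel_measurable borel"
    by (intro borel_measurable_continuous_onI continuous_intros)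
  have "cmod (a * cnj b) \<le> (cmod a)\<^sup>2 + (cmod b)\<^sup>2" for a b
  proof -
    have "cmod a * cmod b \<le> (cmod a)\<^sup>2 + (cmod b)\<^sup>2"
      using sum_squares_bound [of "cmod a" "cmod b"]
        mult_nonneg_nonneg [OF norm_ge_zero [of a] norm_ge_zero [of b]]
      by linarith
    then show ?thesis by (simp add: norm_mult)
  qed
  then have bd: "AE x in M. norm (f x * cnj (g x)) \<le> norm ((cmod (f x))\<^sup>2 + (cmod (g x))\<^sup>2)"
    by (intro AE_I2) simp
  have "integrable M (\<lambda>x. (cmod (f x))\<^sup>2 + (cmod (g x))\<^sup>2)"
    using assms by (simp add: L2_def)
  then show ?thesis
    by (rule Bochner_Integration.integrable_bound [OF _ _ bd]) measurable
qed

lemma L2_inner_add_left: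
  "f \<in> L2 M \<Longrightarrow> g \<in> L2 M \<Longrightarrow> h \<in> L2 M \<Longrightarrow>
    L2_inner M (\<lambda>x. f x + g x) h = L2_inner M f h + L2_inner M g h"
  unfolding L2_inner_def by (simp add: distrib_right L2_integrable_mult)

lemma L2_inner_diff_left:
  "f \<in> L2 M \<Longrightarrow> g \<in> L2 M \<Longrightarrow> h \<in> L2 M \<Longrightarrow>
    L2_inner M (\<lambda>x. f x - g x) h = L2_inner M f h - L2_inner M g h"
  unfolding L2_inner_def by (simp add: left_diff_distrib L2_integrable_mult)

lemma L2_inner_scale_left: "L2_inner M (\<lambda>x. c * f x) h = c * L2_inner M f h"
  unfolding L2_inner_def by (simp add: mult.assoc)

lemma L2_inner_commute: "L2_inner M g f = cnj (L2_inner M f g)"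
  unfolding L2_inner_def by (subst Bochner_Integration.integral_cnj [symmetric]) (simp add: mult.commute)

lemma L2_inner_add_right:
  "f \<in> L2 M \<Longrightarrow> g \<in> L2 M \<Longrightarrow> h \<in> L2 M \<Longrightarrow>
    L2_inner M h (\<lambda>x. f x + g x) = L2_inner M h f + L2_inner M h g"
  by (subst (1 2 3) L2_inner_commute) (simp add: L2_inner_add_left)

lemma L2_inner_diff_right:
  "f \<in> L2 M \<Longrightarrow> g \<in> L2 M \<Longrightarrow> h \<in> L2 M \<Longrightarrow>
    L2_inner M h (\<lambda>x. f x - g x) = L2_inner M h f - L2_inner M h g"
  by (subst (1 2 3) L2_inner_commute) (simp add: L2_inner_diff_left)

lemma L2_inner_scale_right: "L2_inner M h (\<lambda>x. c * f x) = cnj c * L2_inner M h f"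
  by (subst (1 2) L2_inner_commute) (simp add: L2_inner_scale_left)

lemma L2_norm_nonneg: "L2_norm M f \<ge> 0"
  by (simp add: L2_norm_def integral_nonneg_AE)

lemma L2_norm_square: "(L2_norm M f)\<^sup>2 = (LINT x|M. (cmod (f x))\<^sup>2)"
  by (simp add: L2_norm_def integral_nonneg_AE)

lemma L2_inner_self: "L2_inner M f f = complex_of_real ((L2_norm M f)\<^sup>2)"
  unfolding L2_norm_square L2_inner_def
  by (subst integral_complex_of_real [symmetric]) (simp add: complex_norm_square [symmetric])

lemma L2_norm_scale: "L2_norm M (\<lambda>x. c * f x) = cmod c * L2_norm M f"
  by (simp add: L2_norm_def norm_mult power_mult_distrib real_sqrt_mult)

lemma L2_Cauchy_Schwarz:
  assumes f: "f \<in> L2 M" and g: "g \<in> L2 M"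
  shows "cmod (L2_inner M f g) \<le> L2_norm M f * L2_norm M g"
proof (cases "L2_norm M g = 0")
  case True
  then have "(LINT x|M. (cmod (g x))\<^sup>2) = 0"
    using L2_norm_square [of M g] by simp
  then have "AE x in M. (cmod (g x))\<^sup>2 = 0"
    using g integral_nonneg_eq_0_iff_AE [of M "\<lambda>x. (cmod (g x))\<^sup>2"] by (simp add: L2_def)
  then have "AE x in M. f x * cnj (g x) = 0" by eventually_elim simp
  then have "L2_inner M f g = 0"
    unfolding L2_inner_def by (rule integral_eq_zero_AE)
  then show ?thesis by (simp add: True)
next
  case False
  define I where "I = L2_inner M f g"
  define b where "b = L2_norm M g"
  have b: "b > 0" using False L2_norm_nonneg [of M g] by (simp add: b_def)
  \<comment> \<open>\<open>b\<^sup>2\<close> times the component of \<open>f\<close> orthogonal to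
    \<open>g\<close>, scaled to avoid division; that its norm is nonnegative is the
    inequality.\<close>
  define h where "h = (\<lambda>x. complex_of_real (b\<^sup>2) * f x - I * g x)"
  have s: "(\<lambda>x. complex_of_real (b\<^sup>2) * f x) \<in> L2 M" "(\<lambda>x. I * g x) \<in> L2 M"
    using f g by (intro L2_scale; simp)+
  have h: "h \<in> L2 M" unfolding h_def by (intro L2_diff s)
  have "L2_inner M h h = complex_of_real (b\<^sup>2 * (b\<^sup>2 * (L2_norm M f)\<^sup>2 - (cmod I)\<^sup>2))"
  proof -
    have gf: "L2_inner M g f = cnj I" by (subst L2_inner_commute) (simp add: I_def)
    have II: "I * cnj I = complex_of_real ((cmod I)\<^sup>2)" by (simp add: complex_norm_square del: of_real_power)
    let ?B = "complex_of_real (b\<^sup>2)"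
    have "L2_inner M h h = ?B * L2_inner M f h - I * L2_inner M g h"
      unfolding h_def by (subst L2_inner_diff_left [OF s L2_diff [OF s]]) (simp only: L2_inner_scale_left)
    moreover have "L2_inner M f h = ?B * L2_inner M f f - cnj I * I"
      unfolding h_def by (subst L2_inner_diff_right [OF s f]) (simp add: L2_inner_scale_right I_def)
    moreover have "L2_inner M g h = ?B * cnj I - cnj I * L2_inner M g g"
      unfolding h_def by (subst L2_inner_diff_right [OF s g]) (simp add: L2_inner_scale_right gf)
    moreover have "L2_inner M g g = ?B" by (simp add: L2_inner_self b_def)
    ultimately have "L2_inner M h h = ?B * (?B * L2_inner M f f) - ?B * (I * cnj I)"
      by (simp add: algebra_simps)
    then show ?thesis
      unfolding L2_inner_self II by (simp add: algebra_simps)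
  qed
  then have "b\<^sup>2 * (b\<^sup>2 * (L2_norm M f)\<^sup>2 - (cmod I)\<^sup>2) = (L2_norm M h)\<^sup>2"
    by (metis L2_inner_self of_real_eq_iff)
  then have "b\<^sup>2 * (L2_norm M f)\<^sup>2 - (cmod I)\<^sup>2 \<ge> 0"
    using b by (metis zero_le_mult_iff zero_le_power2 not_less zero_less_power)
  then have "(cmod I)\<^sup>2 \<le> (L2_norm M f * b)\<^sup>2" by (simp add: power_mult_distrib mult.commute)
  then show ?thesis
    using b L2_norm_nonneg [of M f] unfolding I_def b_def by (auto intro: power2_le_imp_le)
qed

lemma L2_norm_triangle:
  assumes f: "f \<in> L2 M" and g: "g \<in> L2 M"
  shows "L2_norm M (\<lambda>x. f x + g x) \<le> L2_norm M f + L2_norm M g"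
proof (rule power2_le_imp_le)
  have "L2_inner M (\<lambda>x. f x + g x) (\<lambda>x. f x + g x) =
      L2_inner M f f + L2_inner M g g + (L2_inner M f g + cnj (L2_inner M f g))"
    using f g by (simp add: L2_inner_add_left L2_inner_add_right L2_add L2_inner_commute [of M g f])
  then have "(L2_norm M (\<lambda>x. f x + g x))\<^sup>2 = (L2_norm M f)\<^sup>2 + (L2_norm M g)\<^sup>2 + 2 * Re (L2_inner M f g)"
    unfolding L2_inner_self complex_add_cnj
    by (simp only: of_real_add [symmetric] of_real_eq_iff)
  also have "\<dots> \<le> (L2_norm M f + L2_norm M g)\<^sup>2"
    using L2_Cauchy_Schwarz [OF f g] complex_Re_le_cmod [of "L2_inner M f g"] by (simp add: power2_sum)
  finally show "(L2_norm M (\<lambda>x. f x + g x))\<^sup>2 \<le> (L2_norm M f + L2_norm M g)\<^sup>2" .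
qed (simp add: L2_norm_nonneg)

section \<open>Mean value property over rotations\<close>

text \<open>Cauchy's formula on the unit circle: under the parametrization by \<open>t\<close>, du /
  u becomes 2 pi i dt.\<close>

lemma holomorphic_circle_mean:
  assumes F: "F holomorphic_on UNIV"
  shows "(LINT t|lborel. indicator {0..1} t *\<^sub>R F (exp (2 * of_real pi * \<i> * of_real t))) = F 0"
proof -
  have cont: "continuous_on A (\<lambda>t::real. F (exp (2 * of_real pi * \<i> * of_real t)))" for A
    using holomorphic_on_imp_continuous_on [OF F]
    by (rule continuous_on_compose2 [of UNIV F]) (auto intro!: continuous_intros)
  have "((\<lambda>u. F u / (u - 0)) has_contour_integral (2 * of_real pi * \<i> * F 0)) (circlepath 0 1)"
    by (rule Cauchy_integral_circlepath_simple) (auto intro: holomorphic_on_subset [OF F])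
  then have "((\<lambda>t. F (exp (2 * of_real pi * \<i> * of_real t)) * (2 * of_real pi * \<i>))
      has_integral (2 * of_real pi * \<i> * F 0)) {0..1}"
    unfolding has_contour_integral_def
  proof (rule has_integral_eq [rotated])
    fix t :: real assume "t \<in> {0..1}"
    then have "vector_derivative (circlepath 0 1) (at t within {0..1}) =
        2 * of_real pi * \<i> * exp (2 * of_real pi * \<i> * of_real t)"
      using vector_derivative_circlepath01 [of t 0 1] by simp
    moreover have "circlepath 0 1 t = exp (2 * of_real pi * \<i> * of_real t)"
      by (simp add: circlepath)
    ultimately show "F (circlepath 0 1 t) / (circlepath 0 1 t - 0) *
        vector_derivative (circlepath 0 1) (at t within {0..1}) =
        F (exp (2 * of_real pi * \<i> * of_real t)) * (2 * of_real pi * \<i>)"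
      by simp
  qed
  from has_integral_mult_left [OF this, of "inverse (2 * of_real pi * \<i>)"]
  have "((\<lambda>t. F (exp (2 * of_real pi * \<i> * of_real t))) has_integral F 0) {0..1}"
  proof (rule back_subst [of "\<lambda>P. P"])
    define c :: complex where "c = 2 * of_real pi * \<i>"
    have "c \<noteq> 0" by (simp add: c_def)
    then have 1: "z * c * inverse c = z" "c * z * inverse c = z" for z by (auto simp: field_simps)
    show "(((\<lambda>t. F (exp (2 * of_real pi * \<i> * of_real t)) * (2 * of_real pi * \<i>) * inverse (2 * of_real pi * \<i>))
        has_integral 2 * of_real pi * \<i> * F 0 * inverse (2 * of_real pi * \<i>)) {0..1}) =
      (((\<lambda>t. F (exp (2 * of_real pi * \<i> * of_real t))) has_integral F 0) {0..1})"
      unfolding c_def [symmetric] 1 ..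
  qed
  moreover have "set_integrable lborel {0..1} (\<lambda>t::real. F (exp (2 * of_real pi * \<i> * of_real t)))"
    using borel_integrable_compact [OF _ cont] by (simp add: set_integrable_def)
  ultimately show ?thesis
    using set_borel_integral_eq_integral(2) [of "{0..1}" "\<lambda>t::real. F (exp (2 * of_real pi * \<i> * of_real t))"]
    unfolding set_lebesgue_integral_def by (simp add: integral_unique)
qed

text \<open>A rotation by exp(2 pi i t) preserves both Lebesgue measure and \<open>w\<close>, so the
  integral equals its average over \<open>t\<close> in [0, 1]. After Fubini, the inner average is
  the mean of a one-variable holomorphic function over a circle.\<close>

lemma rotation_mean_value:
  fixes f w :: "complex ^ 'n \<Rightarrow> complex"
  assumes f: "continuous_on UNIV f" and hol: "\<And>z. (\<lambda>\<zeta>. f (\<zeta> *s z)) holomorphic_on UNIV"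
    and [measurable]: "w \<in> borel_measurable borel"
    and w: "\<And>\<zeta> z. cmod \<zeta> = 1 \<Longrightarrow> w (\<zeta> *s z) = w z"
    and int: "integrable lborel (\<lambda>z. f z * w z)"
  shows "(LINT z|lborel. f z * w z) = f 0 * (LINT z|lborel. w z)"
proof -
  let ?e = "\<lambda>t::real. exp (2 * of_real pi * \<i> * of_real t) :: complex"
  let ?I = "\<lambda>t::real. indicator {0..1} t :: real"
  have e1: "cmod (?e t) = 1" for t by simp
  have [measurable]: "f \<in> borel_measurable borel" using f by (rule borel_measurable_continuous_onI)
  have rot: "(LINT z|lborel. h (?e t *s z)) = (LINT z|lborel. h z)"
      "integrable lborel h \<longleftrightarrow> integrable lborel (\<lambda>z. h (?e t *s z))"
    if "h \<in> borel_measurable borel" for h :: "complex ^ 'n \<Rightarrow> 'b::{banach, second_countable_topology}" and t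
  proof -
    have iso: "norm (?e t *s z) = norm z" for z :: "complex ^ 'n"
      unfolding norm_smult by simp
    note v = vol_factor_isometry [OF linear_smult iso]
    show "(LINT z|lborel. h (?e t *s z)) = (LINT z|lborel. h z)"
      "integrable lborel h \<longleftrightarrow> integrable lborel (\<lambda>z. h (?e t *s z))"
      using vol_factor_integral [OF linear_smult v(1) that] v(2) by simp_all
  qed
  let ?h = "\<lambda>t z. ?I t *\<^sub>R (f (?e t *s z) * w z)"
  \<comment> \<open>Both forms of the integrand are used: with \<open>w\<close> at the rotated point
    for the integral over \<open>z\<close>, with \<open>w\<close> at \<open>z\<close> for the
    integral over \<open>t\<close>.\<close>
  have hw: "?h t z = ?I t *\<^sub>R (f (?e t *s z) * w (?e t *s z))" for t z
    by (simp add: w [OF e1])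
  have smult_cont: "continuous_on UNIV (\<lambda>p::real \<times> (complex ^ 'n). ?e (fst p) *s snd p)"
    unfolding vector_scalar_mult_def by (intro continuous_on_vec_lambda continuous_intros)
  have "(\<lambda>p::real \<times> (complex ^ 'n). f (?e (fst p) *s snd p)) \<in> borel_measurable borel"
    by (rule borel_measurable_continuous_onI, rule continuous_on_compose2 [OF f smult_cont]) auto
  then have [measurable]: "(\<lambda>p::real \<times> (complex ^ 'n). f (?e (fst p) *s snd p)) \<in>
      borel_measurable (lborel \<Otimes>\<^sub>M lborel)"
    by (simp add: lborel_prod)
  have meas: "case_prod ?h \<in> borel_measurable (lborel \<Otimes>\<^sub>M lborel)"
    unfolding case_prod_beta by measurable
  have fw: "(\<lambda>z. f z * w z) \<in> borel_measurable borel" "(\<lambda>z. norm (f z * w z)) \<in> borel_measurable borel"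
    by measurable
  have int_h: "integrable lborel (?h t)" for t
    unfolding hw using rot(2) [OF fw(1), of t] int by simp
  have "integrable lborel (\<lambda>t. LINT z|lborel. norm (?h t z))"
  proof -
    have "(LINT z|lborel. norm (?h t z)) = ?I t * (LINT z|lborel. norm (f z * w z))" for t
      unfolding hw using rot(1) [OF fw(2), of t] by simp
    then have eq: "(\<lambda>t. LINT z|lborel. norm (?h t z)) = (\<lambda>t. ?I t * (LINT z|lborel. norm (f z * w z)))"
      by (rule ext)
    show ?thesis
      unfolding eq by (intro integrable_mult_left integrable_real_indicator) auto
  qed
  then have pair: "integrable (lborel \<Otimes>\<^sub>M lborel) (case_prod ?h)"
    using meas int_h by (intro lborel_pair.Fubini_integrable) auto
  have "(LINT z|lborel. (LINT t|lborel. ?h t z)) = (LINT t|lborel. (LINT z|lborel. ?h t z))"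
    using lborel_pair.Fubini_integral [OF pair] by simp
  moreover have "(LINT t|lborel. ?h t z) = f 0 * w z" for z
    using holomorphic_circle_mean [OF hol [of z]]
    by (simp add: mult_scaleR_left [symmetric] del: mult_scaleR_left)
  moreover have "(LINT z|lborel. ?h t z) = ?I t *\<^sub>R (LINT z|lborel. f z * w z)" for t
    unfolding hw by (subst integral_scaleR_right) (simp only: rot(1) [OF fw(1), of t])
  moreover have "(LINT t|lborel. ?I t *\<^sub>R (LINT z|lborel. f z * w z)) = (LINT z|lborel. f z * w z)"
    by simp
  ultimately show ?thesis by (simp only: integral_mult_right_zero)
qed

section \<open>Square roots of positive operators\<close>

lemma pos_form_lower_bound:
  fixes A :: "'a::euclidean_space \<Rightarrow> 'a"
  assumes A: "linear A" and pos: "\<And>x. x \<noteq> 0 \<Longrightarrow> 0 < A x \<bullet> x"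
  obtains m where "m > 0" "\<And>x. m * (norm x)\<^sup>2 \<le> A x \<bullet> x"
proof -
  have bl: "bounded_linear A" using A by (simp add: linear_conv_bounded_linear)
  have "continuous_on (sphere 0 1) (\<lambda>x. A x \<bullet> x)"
    by (intro continuous_intros linear_continuous_on bl)
  moreover have "sphere (0::'a) 1 \<noteq> {}" by simp
  ultimately obtain u where u: "u \<in> sphere 0 1" "\<And>x. x \<in> sphere 0 1 \<Longrightarrow> A u \<bullet> u \<le> A x \<bullet> x"
    using continuous_attains_inf [of "sphere (0::'a) 1" "\<lambda>x. A x \<bullet> x"] by auto
  show thesis
  proof
    show "A u \<bullet> u > 0" using u(1) by (intro pos) auto
    show "A u \<bullet> u * (norm x)\<^sup>2 \<le> A x \<bullet> x" for x
    proof (cases "x = 0")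
      case False
      have "A u \<bullet> u \<le> A (x /\<^sub>R norm x) \<bullet> (x /\<^sub>R norm x)"
        using False by (intro u(2)) simp
      also have "\<dots> = A x \<bullet> x / (norm x)\<^sup>2"
        using A by (simp add: linear_cmul divide_inverse power2_eq_square)
      finally show ?thesis using False by (simp add: field_simps)
    qed (use A in \<open>simp add: linear_0\<close>)
  qed
qed

text \<open>The root is \<open>sqrt c (1 - Z)\<close>, where \<open>Z\<close> is the fixed point of the contraction
  \<open>Z \<mapsto> (X + Z\<^sup>2) / 2\<close> with \<open>X = 1 - A / c\<close>, taken on the self-adjoint operators in the bicommutant of \<open>A\<close>.\<close>

lemma selfadjoint_sqrt:
  fixes A :: "'a::euclidean_space \<Rightarrow> 'a"
  assumes A: "linear A" and sym: "\<And>x y. A x \<bullet> y = x \<bullet> A y"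
    and pos: "\<And>x. x \<noteq> 0 \<Longrightarrow> 0 < A x \<bullet> x"
  obtains S where "linear S" "\<And>x y. S x \<bullet> y = x \<bullet> S y" "\<And>x. x \<noteq> 0 \<Longrightarrow> 0 < S x \<bullet> x"
    "\<And>x. S (S x) = A x"
    "\<And>T x. linear T \<Longrightarrow> (\<And>x. T (A x) = A (T x)) \<Longrightarrow> T (S x) = S (T x)"
proof -
  have bl: "bounded_linear A" using A by (simp add: linear_conv_bounded_linear)
  obtain m where m: "m > 0" "\<And>x. m * (norm x)\<^sup>2 \<le> A x \<bullet> x"
    using pos_form_lower_bound [OF A pos] by metis
  obtain K where K: "K > 0" "\<And>x. norm (A x) \<le> norm x * K"
    using bounded_linear.pos_bounded [OF bl] by blast
  \<comment> \<open>This value minimizes the bound 1 - 2 m / c + K^2 / c^2 for the squared norm of 1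
    - A / c; the minimum is 1 - m^2 / K^2.\<close>
  define c where "c = K\<^sup>2 / m"
  have c: "c > 0" using m K by (simp add: c_def)
  \<comment> \<open>The \<open>max 0\<close> makes \<open>q\<close> nonnegative without comparing
    \<open>m\<close> with \<open>K\<close>.\<close>
  define q where "q = sqrt (max 0 (1 - m\<^sup>2 / K\<^sup>2))"
  have q: "0 \<le> q" "q < 1" using m K by (auto simp: q_def)
  define X where "X = Blinfun (\<lambda>x. x - (1 / c) *\<^sub>R A x)"
  have X: "blinfun_apply X x = x - (1 / c) *\<^sub>R A x" for x
    unfolding X_def
    by (subst bounded_linear_Blinfun_apply)
      (auto intro!: bounded_linear_sub bounded_linear_ident bounded_linear_const_scaleR bl)
  have nX: "norm X \<le> q"
  proof (rule norm_blinfun_bound [OF q(1)])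
    fix x
    have "(norm (blinfun_apply X x))\<^sup>2 = (norm x)\<^sup>2 - 2 / c * (A x \<bullet> x) + (norm (A x))\<^sup>2 / c\<^sup>2"
      by (simp add: X power2_norm_eq_inner inner_diff_left inner_diff_right inner_commute [of x "A x"]
          power2_eq_square [of c] diff_divide_distrib)
    also have "\<dots> \<le> (norm x)\<^sup>2 - 2 / c * (m * (norm x)\<^sup>2) + (norm x * K)\<^sup>2 / c\<^sup>2"
      using c m(2) [of x] K(2) [of x]
      by (intro add_mono diff_mono mult_left_mono divide_right_mono power_mono) auto
    also have "\<dots> = (1 - m\<^sup>2 / K\<^sup>2) * (norm x)\<^sup>2"
      using m(1) K(1) by (simp add: c_def field_simps power2_eq_square)
    also have "\<dots> \<le> q\<^sup>2 * (norm x)\<^sup>2"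
      by (intro mult_right_mono) (auto simp: q_def)
    finally show "norm (blinfun_apply X x) \<le> q * norm x"
      using q(1) by (auto simp: power_mult_distrib intro: power2_le_imp_le)
  qed
  \<comment> \<open>The smaller root of r = (q + r^2) / 2: the ball of radius \<open>r\<close> is
    mapped into itself, and \<open>r\<close> is a contraction factor on it.\<close>
  define r where "r = 1 - sqrt (1 - q)"
  have r: "0 \<le> r" "r < 1" "r = (q + r\<^sup>2) / 2"
    using q by (auto simp: r_def power2_diff)
  define D where "D = {T. linear T \<and> (\<forall>x. T (A x) = A (T x))}"
  define s where "s = {Z :: 'a \<Rightarrow>\<^sub>L 'a. norm Z \<le> r \<and> (\<forall>x y. blinfun_apply Z x \<bullet> y = x \<bullet> blinfun_apply Z y) \<and> (\<forall>T\<in>D. \<forall>x. T (blinfun_apply Z x) = blinfun_apply Z (T x))}"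
  define f where "f = (\<lambda>Z :: 'a \<Rightarrow>\<^sub>L 'a. (1/2) *\<^sub>R (X + (Z o\<^sub>L Z)))"
  have f_app: "blinfun_apply (f Z) x = (1/2) *\<^sub>R (blinfun_apply X x + blinfun_apply Z (blinfun_apply Z x))" for Z x
    by (simp add: f_def blinfun.bilinear_simps)
  have "closed s"
  proof -
    have cT: "continuous_on UNIV T" if "T \<in> D" for T
      using that by (auto simp: D_def linear_conv_bounded_linear intro: linear_continuous_on)
    have "closed {Z :: 'a \<Rightarrow>\<^sub>L 'a. norm Z \<le> r}" by (intro closed_Collect_le continuous_intros)
    moreover have "closed {Z :: 'a \<Rightarrow>\<^sub>L 'a. \<forall>x y. blinfun_apply Z x \<bullet> y = x \<bullet> blinfun_apply Z y}"
      by (intro closed_Collect_all closed_Collect_eq continuous_intros)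
    moreover have "closed {Z :: 'a \<Rightarrow>\<^sub>L 'a. \<forall>T\<in>D. \<forall>x. T (blinfun_apply Z x) = blinfun_apply Z (T x)}"
      unfolding Ball_def
    proof (intro closed_Collect_all)
      fix T x
      show "closed {Z :: 'a \<Rightarrow>\<^sub>L 'a. T \<in> D \<longrightarrow> (\<forall>x. T (blinfun_apply Z x) = blinfun_apply Z (T x))}"
      proof (cases "T \<in> D")
        case True
        have "closed {Z :: 'a \<Rightarrow>\<^sub>L 'a. T (blinfun_apply Z x) = blinfun_apply Z (T x)}" for x
          by (intro closed_Collect_eq continuous_on_compose2 [OF cT [OF True]] continuous_intros) auto
        then show ?thesis using True by (auto intro: closed_Collect_all)
      qed auto
    qed
    ultimately show ?thesis
      unfolding s_def by (auto intro!: closed_Collect_conj)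
  qed
  moreover have "0 \<in> s" using r(1) by (auto simp: s_def D_def linear_0)
  moreover have "f Z \<in> s" if "Z \<in> s" for Z
  proof -
    have Z: "norm Z \<le> r" "\<And>x y. blinfun_apply Z x \<bullet> y = x \<bullet> blinfun_apply Z y" "\<And>T x. T \<in> D \<Longrightarrow> T (blinfun_apply Z x) = blinfun_apply Z (T x)"
      using that by (auto simp: s_def)
    have "norm (f Z) \<le> (norm X + norm (Z o\<^sub>L Z)) / 2"
      unfolding f_def using norm_triangle_ineq [of X "Z o\<^sub>L Z"] by simp
    also have "\<dots> \<le> (q + r * r) / 2"
      using nX Z(1) norm_blinfun_compose [of Z Z] mult_mono [OF Z(1) Z(1) r(1) norm_ge_zero]
      by (auto intro: order_trans)
    also have "\<dots> = r" using r(3) by (simp add: power2_eq_square)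
    finally have "norm (f Z) \<le> r" .
    moreover have "blinfun_apply (f Z) x \<bullet> y = x \<bullet> blinfun_apply (f Z) y" for x y
      using Z(2) sym by (simp add: f_app X inner_add_left inner_add_right inner_diff_left inner_diff_right)
    moreover have "T (blinfun_apply (f Z) x) = blinfun_apply (f Z) (T x)" if "T \<in> D" for T x
      using that Z(3) [OF that] by (auto simp: f_app X D_def linear_cmul linear_add linear_diff)
    ultimately show ?thesis by (auto simp: s_def)
  qed
  moreover have "dist (f Z) (f W) \<le> r * dist Z W" if "Z \<in> s" "W \<in> s" for Z W
  proof -
    have n: "norm Z \<le> r" "norm W \<le> r" using that by (auto simp: s_def)
    have "f Z - f W = (1/2) *\<^sub>R ((Z o\<^sub>L (Z - W)) + ((Z - W) o\<^sub>L W))"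
      by (rule blinfun_eqI) (simp add: f_app blinfun.bilinear_simps algebra_simps)
    then have "norm (f Z - f W) \<le> (norm (Z o\<^sub>L (Z - W)) + norm ((Z - W) o\<^sub>L W)) / 2"
      using norm_triangle_ineq [of "Z o\<^sub>L (Z - W)"] by simp
    also have "\<dots> \<le> (r * norm (Z - W) + norm (Z - W) * r) / 2"
      using n by (intro divide_right_mono add_mono order_trans [OF norm_blinfun_compose]
          mult_left_mono mult_right_mono) auto
    finally show ?thesis by (simp add: dist_norm mult.commute)
  qed
  ultimately have "\<exists>!Z. Z \<in> s \<and> f Z = Z"
    using r complete_eq_closed [of s] by (intro Banach_fix [of s r]) auto
  then obtain Z where "Z \<in> s" and fZ: "f Z = Z" by blast
  then have Z: "norm Z \<le> r" "\<And>x y. blinfun_apply Z x \<bullet> y = x \<bullet> blinfun_apply Z y" "\<And>T x. T \<in> D \<Longrightarrow> T (blinfun_apply Z x) = blinfun_apply Z (T x)"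
    by (auto simp: s_def)
  \<comment> \<open>The fixed point equation Z = (X + Z^2) / 2 says that (1 - Z)^2 = 1 - X = A /
    c.\<close>
  define S where "S = (\<lambda>x. sqrt c *\<^sub>R (x - blinfun_apply Z x))"
  show thesis
  proof
    show "linear S"
      by (rule linearI) (simp_all add: S_def blinfun.bilinear_simps algebra_simps)
    show "S x \<bullet> y = x \<bullet> S y" for x y
      using Z(2) by (simp add: S_def inner_diff_left inner_diff_right)
    show "0 < S x \<bullet> x" if "x \<noteq> 0" for x
    proof -
      have "blinfun_apply Z x \<bullet> x \<le> norm (blinfun_apply Z x) * norm x" by (rule norm_cauchy_schwarz)
      also have "\<dots> \<le> (r * norm x) * norm x"
        using norm_blinfun [of Z x] Z(1) by (intro mult_right_mono order_trans [OF norm_blinfun]) auto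
      also have "\<dots> < norm x * norm x" using that r(2) by simp
      also have "\<dots> = x \<bullet> x" by (simp add: power2_norm_eq_inner [symmetric] power2_eq_square)
      finally show ?thesis using c by (simp add: S_def inner_diff_left)
    qed
    show "S (S x) = A x" for x
    proof -
      have "blinfun_apply X x + blinfun_apply Z (blinfun_apply Z x) = 2 *\<^sub>R blinfun_apply Z x"
        using arg_cong [OF f_app [of Z x], of "\<lambda>v. 2 *\<^sub>R v"] by (simp add: fZ)
      then have "blinfun_apply Z (blinfun_apply Z x) = 2 *\<^sub>R blinfun_apply Z x - x + (1 / c) *\<^sub>R A x" by (simp add: X algebra_simps)
      moreover have "S (S x) = c *\<^sub>R (x - 2 *\<^sub>R blinfun_apply Z x + blinfun_apply Z (blinfun_apply Z x))"
        using c by (simp add: S_def blinfun.bilinear_simps algebra_simps scaleR_2)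
      ultimately show ?thesis using c by simp
    qed
    show "T (S x) = S (T x)" if "linear T" "\<And>x. T (A x) = A (T x)" for T x
      using that Z(3) [of T] by (simp add: S_def D_def linear_cmul linear_diff)
  qed
qed

section \<open>Complex matrices\<close>

definition vcnj :: "complex ^ 'n \<Rightarrow> complex ^ 'n" where
  "vcnj x = (\<chi> j. cnj (x $ j))"

lemma vcnj_simps [simp]:
  "vcnj (vcnj x) = x" "vcnj (x + y) = vcnj x + vcnj y" "vcnj (x - y) = vcnj x - vcnj y"
  "vcnj (- x) = - vcnj x" "vcnj (c *s x) = cnj c *s vcnj x" "vcnj (r *\<^sub>R x) = r *\<^sub>R vcnj x"
  "vcnj 0 = 0" "vcnj x $ j = cnj (x $ j)"
  by (simp_all add: vcnj_def vec_eq_iff)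

lemma inner_cdot: "x \<bullet> y = Re (cdot x (vcnj y))"
  by (simp add: inner_vec_def cdot_def inner_complex_def)

lemma cdot_commute: "cdot x y = cdot y x"
  by (simp add: cdot_def mult.commute)

lemma cdot_simps:
  "cdot (x + y) z = cdot x z + cdot y z" "cdot z (x + y) = cdot z x + cdot z y"
  "cdot (x - y) z = cdot x z - cdot y z" "cdot z (x - y) = cdot z x - cdot z y"
  "cdot (c *s x) z = c * cdot x z" "cdot z (c *s x) = c * cdot z x"
  "cdot (r *\<^sub>R x) z = of_real r * cdot x z" "cdot z (r *\<^sub>R x) = of_real r * cdot z x"
  "cdot (- x) z = - cdot x z" "cdot z (- x) = - cdot z x"
  by (simp_all add: cdot_def sum.distrib sum_subtractf sum_negf sum_distrib_left algebra_simps
      scaleR_conv_of_real [where 'a = complex])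

lemma cnj_cdot: "cnj (cdot x y) = cdot (vcnj x) (vcnj y)"
  by (simp add: cdot_def)

lemma cdot_matrix: "cdot (A *v x) y = cdot x (transpose A *v y)"
  unfolding cdot_def matrix_vector_mult_def transpose_def
  by (simp add: sum_distrib_left sum_distrib_right, subst sum.swap) (simp add: mult_ac)

lemma vcnj_matrix: "vcnj (A *v x) = ctranspose (transpose A) *v vcnj x"
  by (simp add: vec_eq_iff matrix_vector_mult_def ctranspose_def transpose_def)

lemma ctranspose_ctranspose [simp]: "ctranspose (ctranspose A) = A"
  by (simp add: ctranspose_def vec_eq_iff)

lemma ctranspose_mult: "ctranspose (A ** B) = ctranspose B ** ctranspose A"
  by (simp add: ctranspose_def matrix_matrix_mult_def vec_eq_iff mult.commute)

lemma ctranspose_mat_1 [simp]: "ctranspose (mat 1) = mat 1"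
  by (simp add: ctranspose_def mat_def vec_eq_iff)

lemma det_ctranspose: "det (ctranspose A) = cnj (det A)"
proof -
  have "det (\<chi> i j. cnj (A $ i $ j)) = cnj (det A)"
    unfolding det_def by simp
  moreover have "ctranspose A = transpose (\<chi> i j. cnj (A $ i $ j))"
    by (simp add: ctranspose_def transpose_def)
  ultimately show ?thesis by simp
qed

lemma inner_matrix: "(A *v x) \<bullet> y = x \<bullet> (ctranspose A *v (y :: complex ^ 'n))"
proof -
  have "vcnj (ctranspose A *v y) = transpose A *v vcnj y"
    by (simp add: vec_eq_iff matrix_vector_mult_def ctranspose_def transpose_def)
  then show ?thesis by (simp add: inner_cdot cdot_matrix)
qed

lemma linear_matrix: "linear ((*v) (A :: complex ^ 'n ^ 'n))"
  by (rule linearI) (simp_all add: vec_eq_iff matrix_vector_mult_def sum.distrib scaleR_sum_right algebra_simps)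

lemma matrix_eqI:
  fixes A B :: "complex ^ 'n ^ 'm"
  assumes "\<And>x. A *v x = B *v x" shows "A = B"
  using assms matrix_eq by blast

text \<open>The adjoint of a matrix for the real inner product is its conjugate transpose, so real
  symmetry of a complex linear map is the Hermitian property. This makes the real square root
  applicable to complex matrices.\<close>

lemma hermitian_iff:
  fixes A :: "complex ^ 'n ^ 'n"
  shows "ctranspose A = A \<longleftrightarrow> (\<forall>x y. (A *v x) \<bullet> y = x \<bullet> (A *v y))"
proof
  assume h: "\<forall>x y. (A *v x) \<bullet> y = x \<bullet> (A *v y)"
  have "ctranspose A *v y = A *v y" for y
    using h inner_matrix [of A] by (intro vector_eq_rdot [THEN iffD1]) (metis inner_commute)
  then show "ctranspose A = A" by (rule matrix_eqI)
qed (metis inner_matrix)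

lemma pos_def_matrix_iff:
  "pos_def_matrix A \<longleftrightarrow> (\<forall>x y. (A *v x) \<bullet> y = x \<bullet> (A *v y)) \<and> (\<forall>x. x \<noteq> 0 \<longrightarrow> 0 < (A *v x) \<bullet> x)"
  unfolding pos_def_matrix_def hermitian_iff inner_cdot by (simp add: vcnj_def)

lemma complex_linear_matrix:
  fixes S :: "complex ^ 'n \<Rightarrow> complex ^ 'n"
  assumes "linear S" "\<And>c x. S (c *s x) = c *s S x"
  shows "\<exists>A. S = (*v) A"
proof -
  have "S x = (\<chi> i j. S (axis j 1) $ i) *v x" for x
  proof -
    have "S x = S (\<Sum>j\<in>UNIV. x $ j *s axis j 1)" by (simp add: basis_expansion)
    also have "\<dots> = (\<Sum>j\<in>UNIV. x $ j *s S (axis j 1))" using assms by (simp add: linear_sum)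
    also have "\<dots> = (\<chi> i j. S (axis j 1) $ i) *v x"
      by (simp add: vec_eq_iff matrix_vector_mult_def mult.commute)
    finally show ?thesis .
  qed
  then show ?thesis by blast
qed

lemma invertible_pos_def: "pos_def_matrix A \<Longrightarrow> invertible A"
proof -
  assume A: "pos_def_matrix A"
  have "inj ((*v) A)"
    using A unfolding pos_def_matrix_iff
    by (subst vec.inj_iff_eq_0) (metis inner_zero_left order_less_irrefl)
  then show ?thesis by (metis invertible_left_inverse matrix_left_invertible_injective)
qed

lemma matrix_axis: "(A *v axis k (1::complex)) $ i = A $ i $ k"
  by (simp add: matrix_vector_mult_def axis_def if_distrib cong: if_cong)

lemma matrix_inv_mult:
  fixes A :: "complex ^ 'n ^ 'n"
  assumes "invertible A" shows "A ** matrix_inv A = mat 1" "matrix_inv A ** A = mat 1"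
  using someI_ex [OF assms [unfolded invertible_def]] unfolding matrix_inv_def by auto

lemma matrix_inv_vec:
  fixes A :: "complex ^ 'n ^ 'n"
  assumes "invertible A" shows "A *v (matrix_inv A *v x) = x" "matrix_inv A *v (A *v x) = x"
  using assms by (simp_all add: matrix_vector_mul_assoc matrix_inv_mult)

lemma bij_matrix:
  fixes A :: "complex ^ 'n ^ 'n"
  assumes "invertible A" shows "bij ((*v) A)"
  using matrix_inv_vec [OF assms] by (metis bijI')

text \<open>The real square root commutes with complex scalars because \<open>A\<close> does, hence
  is a matrix. Uniqueness gives the definite description its meaning: another root \<open>C\<close>
  commutes with its square \<open>A\<close>, hence with \<open>B\<close>, and then C + B annihilates
  (C - B) x.\<close>

lemma matrix_sqrt_properties:
  fixes A :: "complex ^ 'n ^ 'n"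
  assumes A: "pos_def_matrix A"
  shows "pos_def_matrix (matrix_sqrt A)" "matrix_sqrt A ** matrix_sqrt A = A"
    "\<And>T x. linear T \<Longrightarrow> (\<And>x. T (A *v x) = A *v T x) \<Longrightarrow> T (matrix_sqrt A *v x) = matrix_sqrt A *v T x"
proof -
  have As: "(A *v x) \<bullet> y = x \<bullet> (A *v y)" "x \<noteq> 0 \<Longrightarrow> 0 < (A *v x) \<bullet> x" for x y
    using A by (auto simp: pos_def_matrix_iff)
  obtain S where S: "linear S" "\<And>x y. S x \<bullet> y = x \<bullet> S y" "\<And>x. x \<noteq> 0 \<Longrightarrow> 0 < S x \<bullet> x"
    "\<And>x. S (S x) = A *v x"
    "\<And>T x. linear T \<Longrightarrow> (\<And>x. T (A *v x) = A *v T x) \<Longrightarrow> T (S x) = S (T x)"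
  proof (rule selfadjoint_sqrt [OF linear_matrix [of A]])
    show "(A *v x) \<bullet> y = x \<bullet> (A *v y)" for x y by (rule As(1))
    show "0 < (A *v x) \<bullet> x" if "x \<noteq> 0" for x using that by (rule As(2))
  next
    fix S
    assume S: "linear S" "\<And>x y. S x \<bullet> y = x \<bullet> S y" "\<And>x. x \<noteq> 0 \<Longrightarrow> 0 < S x \<bullet> x" "\<And>x. S (S x) = A *v x"
      and com: "\<And>T x. linear T \<Longrightarrow> (\<And>x. T (A *v x) = A *v T x) \<Longrightarrow> T (S x) = S (T x)"
    from S show thesis
    proof (rule that)
      show "T (S x) = S (T x)" if "linear T" "\<And>x. T (A *v x) = A *v T x" for T x
        using that by (rule com)
    qed
  qed
  have "S (c *s x) = c *s S x" for c x
    using S(5) [of "(*s) c" x] by (simp add: linear_smult vector_scalar_commute)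
  then obtain B where B: "S = (*v) B" using complex_linear_matrix [OF S(1)] by blast
  have 1: "pos_def_matrix B" using S(2,3) by (simp add: pos_def_matrix_iff B)
  have 2: "B ** B = A"
    using S(4) by (intro matrix_eqI) (simp add: B matrix_vector_mul_assoc [symmetric])
  have uniq: "C = B" if C: "pos_def_matrix C" "C ** C = A" for C
  proof (rule matrix_eqI)
    fix x
    have "C *v (A *v y) = A *v (C *v y)" for y
      unfolding C(2) [symmetric] by (simp add: matrix_vector_mul_assoc [symmetric])
    then have com: "C *v (B *v y) = B *v (C *v y)" for y
      using S(5) [of "(*v) C" y] by (simp add: B linear_matrix)
    let ?d = "C *v x - B *v x"
    have "C *v (C *v x) = B *v (B *v x)" using C(2) 2 by (simp add: matrix_vector_mul_assoc)
    then have "C *v ?d + B *v ?d = 0"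
      by (simp add: matrix_vector_mult_diff_distrib com)
    then have "(C *v ?d) \<bullet> ?d + (B *v ?d) \<bullet> ?d = 0"
      by (simp add: inner_add_left [symmetric])
    then have "?d = 0"
      using C(1) 1 unfolding pos_def_matrix_iff by (smt (verit))
    then show "C *v x = B *v x" by simp
  qed
  have eq: "matrix_sqrt A = B"
    unfolding matrix_sqrt_def
  proof (rule the_equality)
    show "pos_def_matrix B \<and> B ** B = A" using 1 2 by blast
    show "C = B" if "pos_def_matrix C \<and> C ** C = A" for C using that uniq by blast
  qed
  show "pos_def_matrix (matrix_sqrt A)" "matrix_sqrt A ** matrix_sqrt A = A"
    unfolding eq by (rule 1, rule 2)
  show "T (matrix_sqrt A *v x) = matrix_sqrt A *v T x"
    if "linear T" "\<And>x. T (A *v x) = A *v T x" for T x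
    using S(5) [OF that] by (simp add: eq B)
qed

section \<open>Volume factors and complex determinants of positive definite matrices\<close>

lemma axis_Basis_eq: "(Basis :: (complex ^ 'n) set) = (\<lambda>(i, u). axis i u) ` (UNIV \<times> {1, \<i>})"
  unfolding Basis_vec_def Basis_complex_def by auto

text \<open>Each positive entry scales two real directions, \<open>axis i 1\<close> and
  \<open>axis i \<i>\<close>; hence the square.\<close>

lemma vol_factor_matrix_diagonal:
  fixes A :: "complex ^ 'n ^ 'n"
  assumes A: "pos_def_matrix A" and diag: "\<And>i j. i \<noteq> j \<Longrightarrow> A $ i $ j = 0"
  shows "vol_factor ((*v) A) = (cmod (det A))\<^sup>2"
proof -
  have Av: "(A *v x) $ i = A $ i $ i * x $ i" for x i
    using diag unfolding matrix_vector_mult_def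
    by (simp, subst sum.remove [of _ i]) (auto intro!: sum.neutral)
  define d where "d = (\<lambda>i. Re (A $ i $ i))"
  have "cnj (A $ i $ i) = A $ i $ i" for i
    using A unfolding pos_def_matrix_def ctranspose_def by (metis vec_lambda_beta)
  then have Ad: "A $ i $ i = of_real (d i)" for i
    unfolding d_def by (metis Reals_cnj_iff of_real_Re)
  have dpos: "d i > 0" for i
  proof -
    have "axis i (1::complex) \<noteq> 0" by (simp add: axis_eq_0_iff)
    then have "0 < (A *v axis i 1) \<bullet> axis i 1" using A unfolding pos_def_matrix_iff by blast
    also have "\<dots> = d i" by (simp add: inner_axis Av d_def)
    finally show ?thesis .
  qed
  define c where "c = (\<lambda>b. (A *v b) \<bullet> b)"
  have c_axis: "c (axis i u) = d i" if "u \<in> {1, \<i>}" for i u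
    using that by (auto simp: c_def inner_axis Av Ad)
  have cpos: "c b > 0" if "b \<in> Basis" for b
    using that dpos c_axis unfolding axis_Basis_eq by auto
  have "(*v) A = (\<lambda>x. \<Sum>b\<in>Basis. (c b * (x \<bullet> b)) *\<^sub>R b)"
  proof (rule ext, rule euclidean_eqI)
    fix x b :: "complex ^ 'n" assume b: "b \<in> Basis"
    then obtain i u where iu: "b = axis i u" "u \<in> {1, \<i>}" unfolding axis_Basis_eq by auto
    have "(\<Sum>b\<in>Basis. (c b * (x \<bullet> b)) *\<^sub>R b) \<bullet> b = c b * (x \<bullet> b)" using b by simp
    then show "(A *v x) \<bullet> b = (\<Sum>b\<in>Basis. (c b * (x \<bullet> b)) *\<^sub>R b) \<bullet> b"
      using iu c_axis [OF iu(2), of i] by (auto simp: inner_axis Av Ad)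
  qed
  then have "vol_factor ((*v) A) = (\<Prod>b\<in>Basis. c b)"
    using vol_factor_diagonal(3) [of c] cpos by simp
  also have "\<dots> = (\<Prod>(i, u)\<in>UNIV \<times> {1, \<i>}. c (axis i u))"
    unfolding axis_Basis_eq
    by (subst prod.reindex) (auto simp: inj_on_def axis_eq_axis case_prod_beta)
  also have "\<dots> = (\<Prod>i\<in>UNIV. \<Prod>u\<in>{1, \<i>}. c (axis i u))"
    by (rule prod.cartesian_product [symmetric])
  also have "\<dots> = (\<Prod>i\<in>UNIV. (d i)\<^sup>2)"
    by (intro prod.cong refl) (simp add: c_axis power2_eq_square)
  also have "\<dots> = (cmod (det A))\<^sup>2"
    using dpos by (simp add: det_diagonal [OF diag] Ad norm_mult prod_norm [symmetric] prod_power_distrib less_imp_le)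
  finally show ?thesis .
qed

text \<open>Symmetric Gaussian elimination: the pivots of a positive definite matrix do not vanish, and an
  elimination matrix does not change volumes because a reflection conjugates it into its inverse.\<close>

lemma vol_factor_pos_def_matrix:
  fixes A :: "complex ^ 'n ^ 'n"
  assumes A: "pos_def_matrix A"
  shows "vol_factor ((*v) A) = (cmod (det A))\<^sup>2"
proof -
  \<comment> \<open>\<open>K\<close> is the set of indices still to be eliminated: off-diagonal
    entries may be nonzero only within \<open>K\<close>. The empty set is the diagonal case, and
    \<open>UNIV\<close> imposes nothing.\<close>
  have "\<lbrakk>pos_def_matrix A; \<And>i j. i \<noteq> j \<Longrightarrow> i \<notin> K \<or> j \<notin> K \<Longrightarrow> A $ i $ j = 0\<rbrakk> \<Longrightarrow>
      vol_factor ((*v) A) = (cmod (det A))\<^sup>2" if "finite K" for K :: "'n set" and A :: "complex ^ 'n ^ 'n"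
    using that
  proof (induction K arbitrary: A rule: finite_induct)
    case empty
    then show ?case by (intro vol_factor_matrix_diagonal) auto
  next
    case (insert k K)
    have if_mult: "(if P then a else b) * c = (if P then a * c else b * c)"
        "c * (if P then a else b) = (if P then c * a else c * b)" for P and a b c :: complex by simp_all
    note A = \<open>pos_def_matrix A\<close> and Az = insert.prems(2)
    have herm: "cnj (A $ i $ j) = A $ j $ i" for i j
      using A unfolding pos_def_matrix_def ctranspose_def by (metis vec_lambda_beta)
    have akk: "A $ k $ k \<noteq> 0"
    proof
      assume "A $ k $ k = 0"
      moreover have "(A *v axis k 1) \<bullet> axis k 1 = Re (A $ k $ k)"
        by (simp add: inner_axis matrix_axis)
      moreover have "axis k (1::complex) \<noteq> 0" by (simp add: axis_eq_0_iff)
      ultimately show False using A unfolding pos_def_matrix_iff by (metis less_irrefl zero_complex.simps(1))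
    qed
    \<comment> \<open>The multipliers that clear row \<open>k\<close> by column operations. Because
      the entry at \<open>k\<close> is 0, the elimination matrix \<open>N\<close> differs from the
      identity by a nilpotent matrix of square zero, and changing the sign of coordinate
      \<open>k\<close> inverts it.\<close>
    define r where "r = (\<lambda>j. if j = k then 0 else A $ k $ j / A $ k $ k)"
    define N :: "complex ^ 'n ^ 'n" where "N = (\<chi> i j. (if i = j then 1 else 0) - (if i = k then r j else 0))"
    define U :: "complex ^ 'n ^ 'n" where "U = (\<chi> i j. if i = j then (if i = k then - 1 else 1) else 0)"
    have Nv: "(N *v x) $ i = x $ i - (if i = k then \<Sum>j\<in>UNIV. r j * x $ j else 0)" for x i
      by (cases "i = k") (simp_all add: N_def matrix_vector_mult_def left_diff_distrib sum_subtractf if_mult cong: if_cong)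
    have Uv: "(U *v x) $ i = (if i = k then - x $ i else x $ i)" for x i
      by (cases "i = k") (simp_all add: U_def matrix_vector_mult_def if_mult cong: if_cong)
    have UU: "U ** U = mat 1"
      by (rule matrix_eqI) (simp add: matrix_vector_mul_assoc [symmetric] vec_eq_iff Uv)
    have UNU: "U *v (N *v (U *v x)) = x + (\<chi> i. if i = k then \<Sum>j\<in>UNIV. r j * x $ j else 0)" for x
    proof -
      have "(\<Sum>j\<in>UNIV. r j * (U *v x) $ j) = (\<Sum>j\<in>UNIV. r j * x $ j)"
        by (intro sum.cong) (auto simp: Uv r_def)
      then show ?thesis by (auto simp: vec_eq_iff Uv Nv)
    qed
    have UNUN: "U ** N ** U ** N = mat 1"
    proof (rule matrix_eqI)
      fix x
      have "(\<Sum>j\<in>UNIV. r j * (N *v x) $ j) = (\<Sum>j\<in>UNIV. r j * x $ j)"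
        by (intro sum.cong) (auto simp: Nv r_def)
      then show "U ** N ** U ** N *v x = mat 1 *v x"
        by (simp add: matrix_vector_mul_assoc [symmetric] UNU) (simp add: vec_eq_iff Nv)
    qed
    then have NUNU: "N ** U ** N ** U = mat 1"
      using UU by (metis matrix_left_right_inverse matrix_mul_assoc)
    have cU: "ctranspose U = U" by (auto simp: ctranspose_def U_def vec_eq_iff)
    define N' where "N' = ctranspose N"
    have UN'UN': "U ** N' ** U ** N' = mat 1"
      using arg_cong [OF NUNU, of ctranspose] cU by (simp add: ctranspose_mult N'_def matrix_mul_assoc)
    have special: "vol_factor ((*v) M) = 1 \<and> (cmod (det M))\<^sup>2 = 1 \<and> invertible M"
      if M: "U ** M ** U ** M = mat 1" for M
    proof -
      have inv: "invertible M" "invertible U"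
        using M UU by (auto simp: invertible_left_inverse)
      have d: "det U * det U = 1" using arg_cong [OF UU, of det] by (simp add: det_mul)
      have "(det U * det U) * (det M * det M) = 1"
        using arg_cong [OF M, of det] by (simp add: det_mul mult_ac)
      then have "cmod (det M * det M) = 1" using d by simp
      then have "(cmod (det M))\<^sup>2 = 1" by (simp add: norm_mult power2_eq_square)
      moreover have "vol_factor ((*v) M) = 1"
        by (rule vol_factor_conj_inverse [of "(*v) M" "(*v) U"])
          (use M UU inv in \<open>simp_all add: linear_matrix bij_matrix matrix_vector_mul_assoc matrix_mul_assoc\<close>)
      ultimately show ?thesis using inv by simp
    qed
    define B where "B = N' ** A ** N"
    have Bv: "B *v x = N' *v (A *v (N *v x))" for x by (simp add: B_def matrix_vector_mul_assoc [symmetric])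
    have invN: "invertible N" "invertible N'" using special UNUN UN'UN' by auto
    have posB: "pos_def_matrix B"
      unfolding pos_def_matrix_iff
    proof (intro conjI allI impI)
      show "(B *v x) \<bullet> y = x \<bullet> (B *v y)" for x y
        using A by (simp add: Bv inner_matrix N'_def pos_def_matrix_def)
      show "0 < (B *v x) \<bullet> x" if "x \<noteq> 0" for x
      proof -
        have "N *v x \<noteq> 0" using invN that matrix_inv_vec by (metis matrix_vector_mult_0_right)
        moreover have "(B *v x) \<bullet> x = (A *v (N *v x)) \<bullet> (N *v x)"
          by (simp only: Bv inner_matrix [of N']) (simp add: N'_def)
        moreover have "0 < (A *v y) \<bullet> y" if "y \<noteq> 0" for y
          using A that unfolding pos_def_matrix_iff by blast
        ultimately show ?thesis by simp
      qed
    qed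
    have AN: "(A ** N) $ i $ j = A $ i $ j - A $ i $ k * r j" for i j
      by (simp add: matrix_matrix_mult_def N_def right_diff_distrib sum_subtractf if_mult cong: if_cong)
    have ANk: "(A ** N) $ k $ j = 0" if "j \<noteq> k" for j using that akk by (simp add: AN r_def)
    have N'X: "(N' ** X) $ i $ j = X $ i $ j - cnj (r i) * X $ k $ j" for X i j
      by (simp add: matrix_matrix_mult_def N'_def ctranspose_def N_def
          left_diff_distrib sum_subtractf if_mult if_distrib [of cnj] cong: if_cong)
    have "B = N' ** (A ** N)" by (simp add: B_def matrix_mul_assoc)
    then have B_entry: "B $ i $ j = (A ** N) $ i $ j - cnj (r i) * (A ** N) $ k $ j" for i j
      by (simp only: N'X)
    have hermB: "cnj (B $ i $ j) = B $ j $ i" for i j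
      using posB unfolding pos_def_matrix_def ctranspose_def by (metis vec_lambda_beta)
    have Bk: "B $ k $ j = 0" if "j \<noteq> k" for j
      using that ANk by (simp add: B_entry)
    \<comment> \<open>Row \<open>k\<close> of \<open>B\<close> is cleared by \<open>N\<close>,
      column \<open>k\<close> follows by Hermitian symmetry, and entries outside \<open>K\<close>
      that were already zero stay zero because their multiplier vanishes.\<close>
    have Bzero: "B $ i $ j = 0" if "i \<noteq> j" "i \<notin> K \<or> j \<notin> K" for i j
    proof -
      have *: "B $ i $ j = 0" if "i \<noteq> j" "i \<notin> K" for i j
      proof (cases "i = k \<or> j = k")
        case True
        then show ?thesis using Bk that hermB by (metis complex_cnj_zero)
      next
        case False
        then have "A $ i $ j = 0" "A $ i $ k = 0" using Az that by auto
        then show ?thesis using False ANk by (simp add: B_entry AN)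
      qed
      show ?thesis using that *[of i j] *[of j i] hermB by (metis complex_cnj_zero)
    qed
    have invA: "invertible A" by (rule invertible_pos_def [OF A])
    have "vol_factor ((*v) B) = vol_factor ((*v) N') * (vol_factor ((*v) A) * vol_factor ((*v) N))"
    proof -
      have "bij (\<lambda>x. A *v (N *v x))"
        using bij_comp [OF bij_matrix [OF invN(1)] bij_matrix [OF invA]] by (simp add: o_def)
      moreover have "linear (\<lambda>x. A *v (N *v x))"
        using linear_compose [OF linear_matrix [of N] linear_matrix [of A]] by (simp add: o_def)
      moreover have "(*v) B = (\<lambda>x. N' *v (A *v (N *v x)))" by (rule ext) (rule Bv)
      ultimately show ?thesis
        by (simp only: vol_factor_comp [OF linear_matrix [of N'] bij_matrix [OF invN(2)]]
            vol_factor_comp [OF linear_matrix [of A] bij_matrix [OF invA] linear_matrix bij_matrix [OF invN(1)]])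
    qed
    then have "vol_factor ((*v) A) = vol_factor ((*v) B)" using special UNUN UN'UN' by simp
    also have "\<dots> = (cmod (det B))\<^sup>2" by (rule insert.IH [OF posB Bzero])
    also have "\<dots> = (cmod (det A))\<^sup>2"
      using special UNUN UN'UN' by (simp add: B_def det_mul norm_mult power_mult_distrib)
    finally show ?case .
  qed
  from this [of UNIV] A show ?thesis by auto
qed

text \<open>The determinant of the Hermitian square root is real, so that of \<open>A\<close> is the
  square of a real number, and it is nonzero by invertibility.\<close>

lemma det_pos_def_matrix:
  fixes A :: "complex ^ 'n ^ 'n"
  assumes A: "pos_def_matrix A"
  shows "Re (det A) = cmod (det A)" "cmod (det A) > 0"
proof -
  define S where "S = matrix_sqrt A"
  have S: "pos_def_matrix S" "S ** S = A" unfolding S_def using matrix_sqrt_properties [OF A] by auto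
  have "cnj (det S) = det S" using S(1) det_ctranspose [of S] by (simp add: pos_def_matrix_def)
  then obtain s where s: "det S = of_real s" by (metis Reals_cnj_iff Reals_cases)
  have "det A = of_real (s * s)" using S(2) s det_mul [of S S] by simp
  then show "Re (det A) = cmod (det A)" by (simp add: norm_mult)
  show "cmod (det A) > 0" using invertible_pos_def [OF A] by (simp add: invertible_det_nz)
qed

lemma scaleR_matrix_vector: "(r *\<^sub>R A) *v x = r *\<^sub>R (A *v (x :: complex ^ 'n))"
  by (simp add: vec_eq_iff matrix_vector_mult_def scaleR_sum_right)

lemma matrix_scaleR_vector: "A *v (r *\<^sub>R x) = r *\<^sub>R (A *v (x :: complex ^ 'n))"
  by (simp add: vec_eq_iff matrix_vector_mult_def scaleR_sum_right)

lemma uminus_matrix_vector: "(- A) *v x = - (A *v (x :: complex ^ 'n))"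
  by (simp add: vec_eq_iff matrix_vector_mult_def sum_negf)

lemma matrix_uminus_vector: "A *v (- x) = - (A *v (x :: complex ^ 'n))"
  by (simp add: vec_eq_iff matrix_vector_mult_def sum_negf)

lemma diff_matrix_vector: "(A - B) *v x = A *v x - B *v (x :: complex ^ 'n)"
  by (simp add: vec_eq_iff matrix_vector_mult_def sum_subtractf left_diff_distrib)

lemma matrix_inv_unique:
  fixes A B :: "complex ^ 'n ^ 'n"
  assumes "A ** B = mat 1" "B ** A = mat 1" shows "matrix_inv A = B"
proof -
  have "invertible A" using assms unfolding invertible_def by blast
  then have "matrix_inv A ** A = mat 1" by (rule matrix_inv_mult)
  then have "B = (matrix_inv A ** A) ** B" by simp
  also have "\<dots> = matrix_inv A" by (simp add: matrix_mul_assoc [symmetric] assms)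
  finally show ?thesis by simp
qed

lemma inner_axis_complex:
  "w \<bullet> axis k 1 = Re (w $ k)" "w \<bullet> axis k \<i> = Im (w $ k)"
  by (simp_all add: inner_axis)

lemma inner_vcnj: "vcnj x \<bullet> vcnj y = x \<bullet> y"
  by (simp add: inner_vec_def inner_complex_def)

lemma vector_inner_eqI:
  fixes u v :: "'a::real_inner"
  assumes "\<And>y. u \<bullet> y = v \<bullet> y" shows "u = v"
  using assms by (metis vector_eq_rdot)

declare transpose_matrix_vector [simp del]

section \<open>The weight and its dual\<close>

locale convex_weight =
  fixes \<Phi> :: "complex ^ 'n \<Rightarrow> real"
  assumes quad: "quadratic_form \<Phi>" and conv: "strictly_convex \<Phi>"
begin

definition polar :: "complex ^ 'n \<Rightarrow> complex ^ 'n \<Rightarrow> real" where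
  "polar = (SOME B. bilinear B \<and> (\<forall>x. \<Phi> x = B x x))"

text \<open>The bilinear form behind the weight need not be symmetric; the sum symmetrizes it, and
  the factor 2 makes \<open>P x \<bullet> x\<close> equal to \<open>4 * \<Phi> x\<close>. The
  adjoint of a functional at 1 is its Riesz vector.\<close>

definition P :: "complex ^ 'n \<Rightarrow> complex ^ 'n" where
  "P x = adjoint (\<lambda>y. 2 * (polar x y + polar y x)) 1"

lemma polar: "bilinear polar" "\<Phi> x = polar x x"
proof -
  have "bilinear polar \<and> (\<forall>x. \<Phi> x = polar x x)"
    using quad unfolding quadratic_form_def polar_def by (rule someI_ex)
  then show "bilinear polar" "\<Phi> x = polar x x" by auto
qed

lemma P_inner: "P x \<bullet> y = 2 * (polar x y + polar y x)"
proof -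
  have "linear (\<lambda>y. 2 * (polar x y + polar y x))"
    using polar(1) by (intro linearI) (simp_all add: bilinear_ladd bilinear_radd bilinear_lmul bilinear_rmul algebra_simps)
  from adjoint_works [OF this, of y 1] show ?thesis by (simp add: P_def inner_commute)
qed

lemma P_sym: "P x \<bullet> y = x \<bullet> P y"
  by (subst inner_commute [of x]) (simp add: P_inner)

lemma linear_P: "linear P"
proof (rule linearI)
  show "P (x + y) = P x + P y" for x y
    by (rule vector_inner_eqI)
      (simp add: P_inner inner_add_left bilinear_ladd [OF polar(1)] bilinear_radd [OF polar(1)])
  show "P (r *\<^sub>R x) = r *\<^sub>R P x" for r x
    by (rule vector_inner_eqI)
      (simp add: P_inner bilinear_lmul [OF polar(1)] bilinear_rmul [OF polar(1)] algebra_simps)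
qed

lemma Phi_P: "\<Phi> x = (P x \<bullet> x) / 4"
  by (simp add: P_inner polar(2) [symmetric])

lemma P_pos: assumes "x \<noteq> 0" shows "0 < P x \<bullet> x"
proof -
  have "x \<noteq> - x" using assms by (metis add_eq_0_iff scaleR_2 scaleR_eq_0_iff zero_neq_numeral)
  \<comment> \<open>Strict convexity at the midpoint 0 of \<open>x\<close> and \<open>- x\<close>,
    where the even form takes equal values.\<close>
  then have "\<Phi> ((1 - 1/2) *\<^sub>R x + (1/2) *\<^sub>R (- x)) < (1 - 1/2) * \<Phi> x + (1/2) * \<Phi> (- x)"
    using conv unfolding strictly_convex_def by (metis half_gt_zero_iff less_numeral_extra(1) field_sum_of_halves less_add_same_cancel1)
  then show ?thesis
    by (simp add: Phi_P linear_neg [OF linear_P] linear_0 [OF linear_P])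
qed

lemma bij_P: "bij P"
proof -
  have "inj P"
    using P_pos linear_injective_0 [OF linear_P] by (metis inner_zero_left less_irrefl)
  then show ?thesis using linear_P by (simp add: bij_def linear_inj_imp_surj)
qed

lemma real_dir_deriv_Phi: "real_dir_deriv v (\<lambda>x. complex_of_real (\<Phi> x)) x = of_real (P x \<bullet> v / 2)"
proof -
  let ?A = "complex_of_real (\<Phi> x)" and ?B = "complex_of_real (P x \<bullet> v / 2)" and ?C = "complex_of_real (\<Phi> v)"
  have "complex_of_real (\<Phi> (x + t *\<^sub>R v)) = ?A + t *\<^sub>R ?B + t\<^sup>2 *\<^sub>R ?C" for t
    using P_sym [of v x] inner_commute [of v "P x"]
    by (simp add: Phi_P linear_add [OF linear_P] linear_cmul [OF linear_P] inner_add_left inner_add_right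
        scaleR_conv_of_real [where 'a = complex] power2_eq_square add_divide_distrib algebra_simps
        flip: of_real_mult of_real_add of_real_divide)
  then have "((\<lambda>t. complex_of_real (\<Phi> (x + t *\<^sub>R v))) has_vector_derivative ?B) (at 0)"
    unfolding has_vector_derivative_def by (auto intro!: derivative_eq_intros)
  then show ?thesis unfolding real_dir_deriv_def by (rule vector_derivative_at)
qed

lemma real_dir_deriv_linear:
  assumes l: "linear (f :: complex ^ 'n \<Rightarrow> complex)" shows "real_dir_deriv v f x = f v"
proof -
  have "((\<lambda>t. f (x + t *\<^sub>R v)) has_vector_derivative f v) (at 0)"
    unfolding has_vector_derivative_def linear_add [OF l] linear_cmul [OF l]
    by (auto intro!: derivative_eq_intros)
  then show ?thesis unfolding real_dir_deriv_def by (rule vector_derivative_at)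
qed

text \<open>Since \<open>P x / 2\<close> is the real gradient, the first Wirtinger derivatives are
  real linear in \<open>x\<close>, and both Hessians can be read off from the values of
  \<open>P\<close> on the real basis.\<close>

lemma wirt_Phi: "wirt k (\<lambda>x. complex_of_real (\<Phi> x)) = (\<lambda>x. cnj (P x $ k) / 4)"
  by (rule ext) (simp add: wirt_def real_dir_deriv_Phi inner_axis_complex complex_eq_iff)

lemma linear_P_component: "linear (\<lambda>x. cnj (P x $ k) / 4)"
  by (rule linearI) (simp_all add: linear_add [OF linear_P] linear_cmul [OF linear_P]
      add_divide_distrib scaleR_conv_of_real [where 'a = complex])

section \<open>The Hessians as complex linear and antilinear parts\<close>

abbreviation "L \<equiv> hess_bar \<Phi>"
abbreviation "M \<equiv> hess_holo \<Phi>"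

lemma hess_entries:
  "L $ j $ k = (cnj (P (axis j 1) $ k) + \<i> * cnj (P (axis j \<i>) $ k)) / 8"
  "M $ j $ k = (cnj (P (axis j 1) $ k) - \<i> * cnj (P (axis j \<i>) $ k)) / 8"
  unfolding hess_bar_def hess_holo_def wirt_Phi
  by (simp_all add: wirt_bar_def wirt_def real_dir_deriv_linear [OF linear_P_component] field_simps)

lemma P_axis_sym:
  "Re (P (axis j 1) $ k) = Re (P (axis k 1) $ j)" "Im (P (axis j 1) $ k) = Re (P (axis k \<i>) $ j)"
  "Re (P (axis j \<i>) $ k) = Im (P (axis k 1) $ j)" "Im (P (axis j \<i>) $ k) = Im (P (axis k \<i>) $ j)"
  unfolding inner_axis_complex [symmetric] by (subst P_sym, rule inner_commute)+

lemma L_hermitian: "cnj (L $ k $ j) = L $ j $ k"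
  by (simp add: hess_entries complex_eq_iff P_axis_sym [of j k])

lemma M_sym: "M $ k $ j = M $ j $ k"
  by (simp add: hess_entries complex_eq_iff P_axis_sym [of j k])

text \<open>The splitting of a real linear map into its complex linear and antilinear parts; for
  \<open>P\<close> these are given by the mixed and the holomorphic Hessian.\<close>

lemma P_eq: "P x = 4 *\<^sub>R (L *v x + vcnj (M *v x))"
proof -
  have "x = (\<Sum>k\<in>UNIV. axis k (x $ k))"
    by (simp add: vec_eq_iff axis_def if_distrib cong: if_cong)
  then have "P x = (\<Sum>k\<in>UNIV. P (axis k (x $ k)))"
    by (metis linear_sum [OF linear_P])
  moreover have "P (axis k z) $ j = 4 * (L $ j $ k * z + cnj (M $ j $ k) * cnj z)" for j k z
  proof -
    have "axis k z = Re z *\<^sub>R axis k 1 + Im z *\<^sub>R axis k \<i>"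
      by (simp add: vec_eq_iff axis_def complex_eq_iff)
    then have "P (axis k z) = Re z *\<^sub>R P (axis k 1) + Im z *\<^sub>R P (axis k \<i>)"
      by (simp add: linear_add [OF linear_P] linear_cmul [OF linear_P])
    then have 1: "P (axis k z) $ j = of_real (Re z) * P (axis k 1) $ j + of_real (Im z) * P (axis k \<i>) $ j"
      by (simp add: scaleR_conv_of_real [where 'a = complex])
    have 2: "L $ j $ k = (P (axis k 1) $ j - \<i> * P (axis k \<i>) $ j) / 8"
      "cnj (M $ j $ k) = (P (axis k 1) $ j + \<i> * P (axis k \<i>) $ j) / 8"
      unfolding L_hermitian [of k j, symmetric] M_sym [of j k] by (simp_all add: hess_entries)
    show ?thesis unfolding 1 2
      by (simp add: complex_eq_iff field_simps)
  qed
  ultimately show ?thesis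
    by (simp add: vec_eq_iff matrix_vector_mult_def sum.distrib sum_distrib_left distrib_left
        scaleR_conv_of_real [where 'a = complex])
qed

lemma transpose_M: "transpose M = M"
  by (simp add: transpose_def vec_eq_iff M_sym)

text \<open>Adding the values of the form at \<open>x\<close> and at i x cancels the antilinear
  part.\<close>

lemma L_pos: "pos_def_matrix L"
proof -
  have c: "ctranspose L = L" by (simp add: ctranspose_def vec_eq_iff L_hermitian)
  moreover have "0 < (L *v x) \<bullet> x" if "x \<noteq> 0" for x
  proof -
    have "\<i> *s x \<noteq> 0" using that by (simp add: vec_eq_iff)
    then have "0 < P x \<bullet> x + P (\<i> *s x) \<bullet> (\<i> *s x)" using that by (intro add_pos_pos P_pos)
    also have "\<dots> = 8 * ((L *v x) \<bullet> x)"
      by (simp add: P_eq vector_scalar_commute inner_cdot cdot_simps)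
    finally show ?thesis by simp
  qed
  ultimately show ?thesis by (simp add: pos_def_matrix_iff hermitian_iff)
qed

section \<open>Normal form of the weight and the contraction \<open>R\<close>\<close>

abbreviation "G \<equiv> G_mat \<Phi>"
abbreviation "C \<equiv> C_plus \<Phi>"

lemma G_pos: "pos_def_matrix G" and G_G: "G *v (G *v x) = 4 *\<^sub>R (L *v x)"
proof -
  note S = matrix_sqrt_properties [OF L_pos]
  show "pos_def_matrix G"
    using S(1) unfolding pos_def_matrix_iff G_mat_def scaleR_matrix_vector inner_scaleR_left inner_scaleR_right
    by (metis mult_pos_pos zero_less_numeral)
  show "G *v (G *v x) = 4 *\<^sub>R (L *v x)"
  proof -
    have "matrix_sqrt L *v (matrix_sqrt L *v x) = L *v x"
      by (simp only: matrix_vector_mul_assoc S(2))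
    then show ?thesis by (simp add: G_mat_def scaleR_matrix_vector matrix_scaleR_vector)
  qed
qed

lemma G_herm: "ctranspose G = G" using G_pos by (simp add: pos_def_matrix_def)

lemma G_inv: "invertible G" by (rule invertible_pos_def [OF G_pos])

lemma G_sym: "(G *v x) \<bullet> y = x \<bullet> (G *v y)" using G_pos by (simp add: pos_def_matrix_iff)

lemma transpose_vcnj: "ctranspose A = A \<Longrightarrow> vcnj (transpose A *v x) = A *v vcnj x"
  unfolding vcnj_matrix by simp

text \<open>The antilinear map that encodes \<open>C_plus\<close>: conjugating \<open>P\<close> by
  the inverse of \<open>G\<close> gives 1 - R.\<close>

definition R :: "complex ^ 'n \<Rightarrow> complex ^ 'n" where "R z = vcnj (C *v z)"

lemma R_smult: "R (c *s z) = cnj c *s R z"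
  by (simp add: R_def vector_scalar_commute)

lemma R_add: "R (x + y) = R x + R y" and R_diff: "R (x - y) = R x - R y"
  by (simp_all add: R_def matrix_vector_right_distrib matrix_vector_mult_diff_distrib)

lemma linear_R: "linear R"
  by (rule linearI) (simp_all add: R_def matrix_vector_right_distrib matrix_scaleR_vector)

text \<open>As \<open>G\<close> is Hermitian, it moves past a complex conjugation as its transpose;
  this is why \<open>C_plus\<close> has the inverse transpose of \<open>G\<close> on the left and
  the inverse of \<open>G\<close> on the right.\<close>

lemma P_G: "P x = G *v (G *v x - R (G *v x))"
proof -
  have inv: "invertible (transpose G)" using G_inv by (simp add: invertible_det_nz)
  have "G *v R (G *v x) = vcnj (transpose G *v (C *v (G *v x)))"
    by (simp add: R_def transpose_vcnj [OF G_herm])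
  also have "transpose G *v (C *v (G *v x)) = (-4) *\<^sub>R (M *v x)"
    by (simp add: C_plus_def scaleR_matrix_vector matrix_scaleR_vector uminus_matrix_vector matrix_uminus_vector
        matrix_vector_mul_assoc [symmetric] matrix_inv_vec [OF G_inv] matrix_inv_vec [OF inv])
  finally have "G *v R (G *v x) = (-4) *\<^sub>R vcnj (M *v x)" by simp
  then show ?thesis
    by (simp add: P_eq matrix_vector_mult_diff_distrib G_G scaleR_add_right)
qed

lemma G_surj: obtains y where "z = G *v y"
  using matrix_inv_vec(1) [OF G_inv] by metis

lemma R_sym: "R x \<bullet> y = x \<bullet> R y"
proof -
  obtain u where u: "x = G *v u" using G_surj .
  obtain v where v: "y = G *v v" using G_surj .
  have "(x - R x) \<bullet> y = P u \<bullet> v" unfolding P_G u v by (simp add: G_sym)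
  moreover have "x \<bullet> (y - R y) = u \<bullet> P v" unfolding P_G u v by (simp add: G_sym)
  ultimately show ?thesis using P_sym [of u v] by (simp add: inner_diff_left inner_diff_right)
qed

lemma one_minus_R_pos: "z \<noteq> 0 \<Longrightarrow> 0 < (z - R z) \<bullet> z"
proof -
  assume "z \<noteq> 0"
  obtain u where u: "z = G *v u" using G_surj .
  have "u \<noteq> 0" using u \<open>z \<noteq> 0\<close> by auto
  then show ?thesis using P_pos [of u] by (simp add: P_G u G_sym)
qed

text \<open>Replacing \<open>z\<close> by i z changes the sign of the antilinear \<open>R\<close>
  and keeps the inner product.\<close>

lemma one_plus_R_pos: "z \<noteq> 0 \<Longrightarrow> 0 < (z + R z) \<bullet> z"
proof -
  assume "z \<noteq> 0"
  then have "\<i> *s z \<noteq> 0" by (simp add: vec_eq_iff)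
  then have "0 < (\<i> *s z - R (\<i> *s z)) \<bullet> (\<i> *s z)" by (rule one_minus_R_pos)
  also have "\<dots> = (z + R z) \<bullet> z"
    by (simp add: R_smult inner_cdot cdot_simps)
  finally show ?thesis .
qed

abbreviation "H \<equiv> mat 1 - ctranspose C ** C"

text \<open>\<open>R\<close> is symmetric for the real inner product and conjugation is an isometry,
  so the square of \<open>R\<close> is \<open>ctranspose C ** C\<close>, a complex linear
  map.\<close>

lemma H_app: "H *v z = z - R (R z)"
proof -
  have "ctranspose C *v (C *v z) = R (R z)"
  proof (rule vector_inner_eqI)
    fix y
    have "(ctranspose C *v (C *v z)) \<bullet> y = (C *v z) \<bullet> (C *v y)" by (simp add: inner_matrix)
    also have "\<dots> = R z \<bullet> R y" unfolding R_def by (simp add: inner_vcnj)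
    also have "\<dots> = R (R z) \<bullet> y" by (simp add: R_sym)
    finally show "(ctranspose C *v (C *v z)) \<bullet> y = R (R z) \<bullet> y" .
  qed
  then show ?thesis by (simp add: diff_matrix_vector matrix_vector_mul_assoc [symmetric])
qed

lemma H_pos: "pos_def_matrix H"
  unfolding pos_def_matrix_iff
proof (intro conjI allI impI)
  show "(H *v x) \<bullet> y = x \<bullet> (H *v y)" for x y
    by (simp add: H_app inner_diff_left inner_diff_right R_sym)
  fix z :: "complex ^ 'n" assume z: "z \<noteq> 0"
  let ?u = "z + R z" and ?v = "z - R z"
  have "?u \<noteq> 0" "?v \<noteq> 0" using one_plus_R_pos [OF z] one_minus_R_pos [OF z] by auto
  \<comment> \<open>With u = (1 + R) z and v = (1 - R) z, both (1 - R) u and (1 + R) v equal H z,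
    while u + v = 2 z.\<close>
  then have "0 < (?u - R ?u) \<bullet> ?u + (?v + R ?v) \<bullet> ?v"
    by (intro add_pos_pos one_plus_R_pos one_minus_R_pos)
  also have "\<dots> = 2 * ((H *v z) \<bullet> z)"
    using R_sym [of z "R z"] R_sym [of "R z" "R z"] inner_commute [of z "R z"]
    by (simp add: H_app R_add R_diff inner_add_left inner_add_right inner_diff_left inner_diff_right
        R_sym inner_commute)
  finally show "0 < (H *v z) \<bullet> z" by simp
qed

section \<open>The dual weight as a Legendre transform\<close>

abbreviation "S \<equiv> matrix_sqrt H"
abbreviation "E \<equiv> E_mat \<Phi>"

lemma S_S: "S *v (S *v z) = z - R (R z)"
  using matrix_sqrt_properties(2) [OF H_pos] by (simp add: matrix_vector_mul_assoc H_app)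

lemma S_pos: "pos_def_matrix S" by (rule matrix_sqrt_properties(1) [OF H_pos])

lemma S_inv: "invertible S" by (rule invertible_pos_def [OF S_pos])

lemma E_S: "E *v (S *v z) = z" and S_E: "S *v (E *v z) = z"
  unfolding E_mat_def using matrix_inv_vec [OF S_inv] by auto

text \<open>\<open>R\<close> commutes with H = 1 - R^2, hence with its square root, although
  \<open>R\<close> is not complex linear.\<close>

lemma S_R: "R (S *v z) = S *v R z"
  by (rule matrix_sqrt_properties(3) [OF H_pos linear_R]) (simp add: H_app R_diff)

lemma E_R: "R (E *v z) = E *v R z"
proof -
  have "S *v R (E *v z) = R z" by (simp add: S_R [symmetric] S_E)
  then show ?thesis by (metis E_S)
qed

text \<open>After complex conjugation the claim reads S R E = R, which holds because
  \<open>S\<close> commutes with \<open>R\<close> and inverts \<open>E\<close>.\<close>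

lemma C_dual_eq: "C_dual \<Phi> *v w = - (C *v w)"
proof -
  have ES: "E ** S = mat 1" "S ** E = mat 1"
    unfolding E_mat_def using matrix_inv_mult [OF S_inv] by auto
  have inv: "matrix_inv (transpose E) = transpose S"
    by (rule matrix_inv_unique) (simp_all add: matrix_transpose_mul [symmetric] ES)
  have "vcnj (transpose S *v (C *v (E *v w))) = S *v R (E *v w)"
    using S_pos by (simp add: R_def transpose_vcnj pos_def_matrix_def)
  also have "\<dots> = vcnj (C *v w)" by (simp add: S_R [symmetric] S_E) (simp add: R_def)
  finally have "transpose S *v (C *v (E *v w)) = C *v w" by (metis vcnj_simps(1))
  then show ?thesis
    by (simp add: C_dual_def inv uminus_matrix_vector matrix_vector_mul_assoc [symmetric])
qed

text \<open>As \<open>P v\<close> is the gradient of \<open>2 \<Phi>\<close> at \<open>v\<close>, this says that twice the dual weight is the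
  Legendre transform of \<open>2 \<Phi>\<close>.\<close>

lemma dual_weight_P: "dual_weight \<Phi> (P v) = \<Phi> v"
proof -
  define z where "z = G *v v"
  define w where "w = E *v (z - R z)"
  have Gd: "G_dual \<Phi> *v P v = w"
    unfolding G_dual_def G_herm P_G w_def z_def
    by (simp add: matrix_vector_mul_assoc [symmetric] matrix_inv_vec [OF G_inv])
  \<comment> \<open>Since (1 + R)(1 - R) = S^2 and \<open>E\<close> inverts \<open>S\<close>, the
    root in the dual formulas is exactly what turns w + R w into S z.\<close>
  have "w + R w = E *v (z - R (R z))"
    unfolding w_def by (simp add: E_R R_diff matrix_vector_mult_diff_distrib)
  then have wR: "w + R w = S *v z" by (simp add: S_S [symmetric] E_S)
  have "4 * dual_weight \<Phi> (P v) = w \<bullet> (w + R w)"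
    unfolding dual_weight_def Gd C_dual_eq R_def
    by (simp add: inner_add_right inner_cdot [of w "vcnj _"] cdot_simps power2_norm_eq_inner)
  also have "\<dots> = (S *v w) \<bullet> z" using S_pos unfolding wR pos_def_matrix_iff by simp
  also have "\<dots> = P v \<bullet> v" by (simp add: w_def S_E P_G z_def G_sym)
  finally show ?thesis by (simp add: Phi_P)
qed

lemma bij_one_minus_R: "bij (\<lambda>z. z - R z)" "linear (\<lambda>z. z - R z)"
  and bij_one_plus_R: "bij (\<lambda>z. z + R z)" "linear (\<lambda>z. z + R z)"
proof -
  show l: "linear (\<lambda>z. z - R z)" "linear (\<lambda>z. z + R z)"
    by (intro linear_compose_sub linear_compose_add linear_ident linear_R)+
  have "inj (\<lambda>z. z - R z)"
    using one_minus_R_pos linear_injective_0 [OF l(1)] by (metis inner_zero_left less_irrefl)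
  moreover have "inj (\<lambda>z. z + R z)"
    using one_plus_R_pos linear_injective_0 [OF l(2)] by (metis inner_zero_left less_irrefl)
  ultimately show "bij (\<lambda>z. z - R z)" "bij (\<lambda>z. z + R z)"
    using l by (simp_all add: bij_def linear_inj_imp_surj)
qed

text \<open>Multiplication by the imaginary unit conjugates \<open>1 + R\<close> into \<open>1 - R\<close>, and
  \<open>(1 - R) (1 + R)\<close> is the complex linear map \<open>H\<close>.\<close>

lemma vol_factor_one_minus_R: "vol_factor (\<lambda>z. z - R z) = cmod (det H)"
proof -
  let ?J = "\<lambda>z :: complex ^ 'n. \<i> *s z"
  have J: "linear ?J" "bij ?J" "vol_factor ?J = 1"
    using vol_factor_isometry [OF linear_smult, of \<i>] by (auto simp: norm_smult linear_smult)
  have "(\<lambda>z. ?J (z + R z)) = (\<lambda>z. ?J z - R (?J z))"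
    by (rule ext) (simp add: R_smult vector_add_ldistrib)
  then have "vol_factor (\<lambda>z. ?J (z + R z)) = vol_factor (\<lambda>z. ?J z - R (?J z))"
    by (rule arg_cong)
  then have eq: "vol_factor (\<lambda>z. z + R z) = vol_factor (\<lambda>z. z - R z)"
    by (simp only: vol_factor_comp [OF J(1,2) bij_one_plus_R(2,1)]
        vol_factor_comp [OF bij_one_minus_R(2,1) J(1,2)] J(3) mult_1_left mult_1_right)
  have "(\<lambda>z. (z + R z) - R (z + R z)) = (*v) H"
    by (rule ext) (simp add: H_app R_add)
  then have "vol_factor (\<lambda>z. z - R z) * vol_factor (\<lambda>z. z - R z) = (cmod (det H))\<^sup>2"
    using vol_factor_comp [OF bij_one_minus_R(2,1) bij_one_plus_R(2,1)] vol_factor_pos_def_matrix [OF H_pos]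
    by (simp add: eq)
  then show ?thesis
    using vol_factor_nn_integral(1) [OF bij_one_minus_R(2,1)]
    by (intro power2_eq_imp_eq [of "vol_factor _"]) (auto simp: power2_eq_square)
qed

text \<open>From P = G (1 - R) G. This is the source of the determinant in the constant.\<close>

lemma vol_factor_P: "vol_factor P = (vol_factor ((*v) G))\<^sup>2 * Re (det H)"
proof -
  note G = linear_matrix [of G] bij_matrix [OF G_inv]
  have 1: "linear (\<lambda>x. G *v x - R (G *v x))" "bij (\<lambda>x. G *v x - R (G *v x))"
    using linear_compose [OF G(1) bij_one_minus_R(2)] bij_comp [OF G(2) bij_one_minus_R(1)]
    by (auto simp: o_def)
  have "vol_factor P = vol_factor (\<lambda>x. G *v (G *v x - R (G *v x)))"
    by (rule arg_cong [of _ _ vol_factor]) (rule ext, rule P_G)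
  also have "\<dots> = vol_factor ((*v) G) * (vol_factor (\<lambda>z. z - R z) * vol_factor ((*v) G))"
    by (simp only: vol_factor_comp [OF G 1] vol_factor_comp [OF bij_one_minus_R(2,1) G])
  finally show ?thesis
    by (simp add: vol_factor_one_minus_R det_pos_def_matrix [OF H_pos] power2_eq_square)
qed

end

section \<open>The reproducing kernel as a Gaussian integral\<close>

text \<open>Up to the factor 1/4, the convexity defect between \<open>x\<close> and \<open>y\<close>
  is t (1 - t) times the form at x - y.\<close>

lemma strictly_convex_pos_form:
  fixes A :: "'a::euclidean_space \<Rightarrow> 'a"
  assumes A: "linear A" and sym: "\<And>x y. A x \<bullet> y = x \<bullet> A y" and pos: "\<And>x. x \<noteq> 0 \<Longrightarrow> 0 < A x \<bullet> x"
  shows "strictly_convex (\<lambda>x. (A x \<bullet> x) / 4)"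
  unfolding strictly_convex_def
proof (intro allI impI)
  fix x y :: 'a and t :: real assume "x \<noteq> y" "0 < t" "t < 1"
  then have "0 < t * (1 - t) * (A (x - y) \<bullet> (x - y))" by (intro mult_pos_pos pos) auto
  also have "\<dots> = (1 - t) * (A x \<bullet> x) + t * (A y \<bullet> y) -
      A ((1 - t) *\<^sub>R x + t *\<^sub>R y) \<bullet> ((1 - t) *\<^sub>R x + t *\<^sub>R y)"
    using sym [of y x] inner_commute [of y "A x"]
    by (simp add: linear_add [OF A] linear_cmul [OF A] linear_diff [OF A] inner_add_left inner_add_right
        inner_diff_left inner_diff_right algebra_simps)
  finally show "(A ((1 - t) *\<^sub>R x + t *\<^sub>R y) \<bullet> ((1 - t) *\<^sub>R x + t *\<^sub>R y)) / 4 <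
      (1 - t) * ((A x \<bullet> x) / 4) + t * ((A y \<bullet> y) / 4)"
    by simp
qed

lemma continuous_on_cdot [continuous_intros]:
  "continuous_on X f \<Longrightarrow> continuous_on X g \<Longrightarrow> continuous_on X (\<lambda>x. cdot (f x) (g x))"
  unfolding cdot_def by (intro continuous_intros)

lemma continuous_on_vcnj [continuous_intros]:
  "continuous_on X f \<Longrightarrow> continuous_on X (\<lambda>x. vcnj (f x))"
  unfolding vcnj_def by (intro continuous_on_vec_lambda continuous_intros)

lemma continuous_on_matrix_vector [continuous_intros]:
  fixes A :: "complex ^ 'n ^ 'n"
  shows "continuous_on X f \<Longrightarrow> continuous_on X (\<lambda>x. A *v f x)"
  by (rule continuous_on_compose2 [of UNIV "(*v) A"])
    (auto intro: linear_continuous_on simp: linear_conv_bounded_linear [symmetric] linear_matrix)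

lemma cmod_cdot_le: "cmod (cdot x y) \<le> real CARD('n) * (norm x * norm (y :: complex ^ 'n))"
proof -
  have "cmod (cdot x y) \<le> (\<Sum>j\<in>UNIV. cmod (x $ j * y $ j))" unfolding cdot_def by (rule norm_sum)
  also have "\<dots> \<le> (\<Sum>j\<in>(UNIV::'n set). norm x * norm y)"
    by (intro sum_mono) (simp add: norm_mult mult_mono Finite_Cartesian_Product.norm_nth_le)
  finally show ?thesis by simp
qed

lemma norm_vcnj [simp]: "norm (vcnj x) = norm x"
  by (simp add: norm_eq_sqrt_inner inner_vcnj)

lemma entire_continuous_on: "entire u \<Longrightarrow> continuous_on X u"
  unfolding entire_def by (metis continuous_at_imp_continuous_on has_derivative_continuous)

lemma entire_holomorphic_line:
  assumes "entire u" shows "(\<lambda>\<zeta>. u (a + \<zeta> *s v)) holomorphic_on X"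
proof (rule holomorphic_onI)
  fix \<zeta>
  obtain u' where u': "(u has_derivative u') (at (a + \<zeta> *s v))" "\<And>c v. u' (c *s v) = c * u' v"
    using assms unfolding entire_def by metis
  have "bounded_linear (\<lambda>h. h *s v)"
    unfolding linear_conv_bounded_linear [symmetric]
    by (rule linearI) (simp_all add: vec_eq_iff distrib_right)
  then have "((\<lambda>\<zeta>. a + \<zeta> *s v) has_derivative (\<lambda>h. h *s v)) (at \<zeta>)"
    by (auto intro!: derivative_eq_intros bounded_linear_imp_has_derivative)
  from has_derivative_compose [OF this u'(1)]
  have "((\<lambda>\<zeta>. u (a + \<zeta> *s v)) has_derivative (\<lambda>h. h * u' v)) (at \<zeta>)"
    by (simp add: u'(2))
  then have "((\<lambda>\<zeta>. u (a + \<zeta> *s v)) has_field_derivative u' v) (at \<zeta>)"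
    unfolding has_field_derivative_def by (simp add: mult.commute [of _ "u' v"])
  then show "(\<lambda>\<zeta>. u (a + \<zeta> *s v)) field_differentiable at \<zeta> within X"
    by (metis field_differentiable_at_within field_differentiable_def)
qed

section \<open>The dual form and the reproducing kernel\<close>

context convex_weight
begin

abbreviation "\<Phi>d \<equiv> dual_weight \<Phi>"

definition Q :: "complex ^ 'n \<Rightarrow> complex ^ 'n" where "Q = inv P"

lemma P_Q: "P (Q x) = x" and linear_Q: "linear Q"
  unfolding Q_def using linear_bij_inv [OF linear_P bij_P] by auto

lemma Q_sym: "Q x \<bullet> y = x \<bullet> Q y"
  by (metis P_Q P_sym)

lemma Q_pos: "x \<noteq> 0 \<Longrightarrow> 0 < Q x \<bullet> x"
  using P_pos [of "Q x"] P_Q [of x] linear_0 [OF linear_P] by (metis inner_commute)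

lemma Phid_Q: "\<Phi>d x = (Q x \<bullet> x) / 4"
  using dual_weight_P [of "Q x"] by (simp add: P_Q Phi_P inner_commute)

lemma quadratic_form_Phid: "quadratic_form \<Phi>d"
  unfolding quadratic_form_def
proof (intro exI conjI allI)
  show "bilinear (\<lambda>x y. (Q x \<bullet> y) / 4)"
    unfolding bilinear_def
    by (auto intro!: linearI simp: linear_add [OF linear_Q] linear_cmul [OF linear_Q] inner_add_left inner_add_right)
  show "\<Phi>d x = (Q x \<bullet> x) / 4" for x by (rule Phid_Q)
qed

lemma strictly_convex_Phid: "strictly_convex \<Phi>d"
  using strictly_convex_pos_form [OF linear_Q Q_sym Q_pos] by (simp add: Phid_Q [abs_def])

lemma continuous_on_Phi: "continuous_on X f \<Longrightarrow> continuous_on X (\<lambda>x. \<Phi> (f x))"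
  and continuous_on_Phid: "continuous_on X f \<Longrightarrow> continuous_on X (\<lambda>x. \<Phi>d (f x))"
proof -
  have cont: "continuous_on UNIV P" "continuous_on UNIV Q"
    using linear_P linear_Q by (simp_all add: linear_continuous_on linear_conv_bounded_linear)
  assume f: "continuous_on X f"
  have "continuous_on X (\<lambda>x. P (f x))" by (rule continuous_on_compose2 [OF cont(1) f]) simp
  then show "continuous_on X (\<lambda>x. \<Phi> (f x))"
    by (subst Phi_P, intro continuous_on_divide [OF continuous_on_inner [OF _ f] continuous_on_const]) simp_all
  have "continuous_on X (\<lambda>x. Q (f x))" by (rule continuous_on_compose2 [OF cont(2) f]) simp
  then show "continuous_on X (\<lambda>x. \<Phi>d (f x))"
    unfolding Phid_Q by (rule continuous_on_divide [OF continuous_on_inner [OF _ f] continuous_on_const]) simp_all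
qed

lemma Phi_lower_bound: obtains m where "m > 0" "\<And>x. m * (norm x)\<^sup>2 \<le> \<Phi> x"
proof -
  obtain m where "m > 0" "\<And>x. m * (norm x)\<^sup>2 \<le> P x \<bullet> x"
    using pos_form_lower_bound [OF linear_P P_pos] by metis
  then show thesis using that [of "m / 4"] by (simp add: Phi_P)
qed

lemma Phid_lower_bound: obtains m where "m > 0" "\<And>x. m * (norm x)\<^sup>2 \<le> \<Phi>d x"
proof -
  obtain m where "m > 0" "\<And>x. m * (norm x)\<^sup>2 \<le> Q x \<bullet> x"
    using pos_form_lower_bound [OF linear_Q Q_pos] by metis
  then show thesis using that [of "m / 4"] by (simp add: Phid_Q)
qed

text \<open>The polarization of 2 \<Phi>: holomorphic in \<open>s\<close>, antiholomorphic in
  \<open>t\<close>, and equal to 2 \<Phi> on the diagonal.\<close>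

definition kernel_exponent :: "complex ^ 'n \<Rightarrow> complex ^ 'n \<Rightarrow> complex" where
  "kernel_exponent s t = 2 * cdot (L *v s) (vcnj t) + cdot s (M *v s) + cnj (cdot t (M *v t))"

lemma cnj_cdot_L: "cnj (cdot (L *v x) (vcnj y)) = cdot (L *v y) (vcnj x)"
proof -
  have "ctranspose L = L" using L_pos by (simp add: pos_def_matrix_def)
  then have T: "transpose (ctranspose (transpose L)) = L"
    by (simp add: ctranspose_def transpose_def vec_eq_iff)
  have "cnj (cdot (L *v x) (vcnj y)) = cdot (vcnj (L *v x)) y" by (simp add: cnj_cdot)
  also have "\<dots> = cdot (ctranspose (transpose L) *v vcnj x) y" by (simp only: vcnj_matrix)
  also have "\<dots> = cdot (vcnj x) (L *v y)" unfolding cdot_matrix T ..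
  finally show ?thesis by (simp only: cdot_commute)
qed

lemma cdot_M: "cdot (M *v x) y = cdot x (M *v y)"
  by (simp add: cdot_matrix transpose_M)

lemma kernel_exponent_cnj: "cnj (kernel_exponent s t) = kernel_exponent t s"
  by (simp add: kernel_exponent_def cnj_cdot_L)

text \<open>Real parts are replaced by sums with conjugates, so that identities between forms can be
  checked term by term after expansion.\<close>

lemma P_inner_complex:
  "complex_of_real (P a \<bullet> b) = 2 * (cdot (L *v a) (vcnj b) + cdot (L *v b) (vcnj a)) +
    2 * (cdot a (M *v b) + cnj (cdot a (M *v b)))"
proof -
  let ?z = "cdot (L *v a) (vcnj b) + cdot a (M *v b)"
  have "P a \<bullet> b = 4 * Re (cdot (L *v a) (vcnj b)) + 4 * Re (cdot (vcnj (M *v a)) (vcnj b))"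
    by (simp add: inner_cdot P_eq cdot_simps)
  also have "cdot (vcnj (M *v a)) (vcnj b) = cnj (cdot a (M *v b))"
    by (simp add: cnj_cdot [symmetric] cdot_M)
  finally have "complex_of_real (P a \<bullet> b) = 2 * (?z + cnj ?z)"
    unfolding complex_add_cnj by (simp add: algebra_simps)
  then show ?thesis by (simp add: cnj_cdot_L algebra_simps)
qed

lemma kernel_exponent_diag: "kernel_exponent s s = complex_of_real (2 * \<Phi> s)"
proof -
  have eq: "complex_of_real (2 * \<Phi> s) = complex_of_real (P s \<bullet> s) / 2" by (simp add: Phi_P)
  show ?thesis unfolding eq P_inner_complex kernel_exponent_def by (simp add: algebra_simps)
qed

text \<open>The vectors \<open>a\<close> and \<open>b\<close> are those for which (s . cnj x + cnj t
  . x) / 2 is the sum of \<open>a \<bullet> x\<close> and i times \<open>b \<bullet> x\<close>; the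
  left side is what completing the square produces.\<close>

lemma kernel_exponent_polarization:
  fixes s t defines "a \<equiv> (1/2) *s (s + t)" and "b \<equiv> (- \<i> / 2) *s (s - t)"
  shows "complex_of_real ((P a \<bullet> a) / 2 - (P b \<bullet> b) / 2) + \<i> * complex_of_real (P a \<bullet> b) = kernel_exponent s t"
proof -
  have "cdot t (M *v s) = cdot s (M *v t)" by (metis cdot_M cdot_commute)
  then show ?thesis
    unfolding of_real_diff of_real_divide P_inner_complex a_def b_def kernel_exponent_def
    by (simp add: matrix_vector_right_distrib matrix_vector_mult_diff_distrib vector_scalar_commute
        cdot_simps field_simps)
qed

text \<open>With \<open>A\<close> the square root of \<open>P\<close> and \<open>T\<close> its
  inverse, 2 \<Phi>d(x) is half the squared norm of T x and \<open>a \<bullet> x\<close> is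
  \<open>T (P a) \<bullet> T x\<close>, which is the shape of \<open>gaussian_integral\<close>. The
  Jacobian of \<open>A\<close> is the square root of that of \<open>P\<close>.\<close>

lemma dual_gaussian:
  fixes s t
  defines "f \<equiv> \<lambda>x. exp ((cdot s (vcnj x) + cdot (vcnj t) x) / 2 - 2 * complex_of_real (\<Phi>d x))"
  shows "integrable lborel f"
    and "(LINT x|lborel. f x) = complex_of_real ((2 * pi) ^ CARD('n) * sqrt (vol_factor P)) * exp (kernel_exponent s t)"
proof -
  obtain A where A: "linear A" "\<And>x y. A x \<bullet> y = x \<bullet> A y" "\<And>x. x \<noteq> 0 \<Longrightarrow> 0 < A x \<bullet> x" "\<And>x. A (A x) = P x"
  proof (rule selfadjoint_sqrt [OF linear_P P_sym])
    show "0 < P x \<bullet> x" if "x \<noteq> 0" for x using that by (rule P_pos)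
  qed (rule that)
  have "inj A" using A(3) linear_injective_0 [OF A(1)] by (metis inner_zero_left less_irrefl)
  then have bA: "bij A" using A(1) by (simp add: bij_def linear_inj_imp_surj)
  define T where "T = inv A"
  note T = linear_bij_inv [OF A(1) bA, folded T_def]
  have vA: "vol_factor A > 0" by (rule vol_factor_nn_integral(1) [OF A(1) bA])
  have "vol_factor P = vol_factor A * vol_factor A"
    using vol_factor_comp [OF A(1) bA A(1) bA] A(4) by simp
  then have vP: "sqrt (vol_factor P) = vol_factor A" using vA by simp
  have "vol_factor A * vol_factor T = 1"
  proof -
    have "vol_factor (\<lambda>x. A (T x)) = 1" unfolding T(3) by (rule vol_factor_id)
    then show ?thesis unfolding vol_factor_comp [OF A(1) bA T(1,2)] .
  qed
  moreover from this have "vol_factor T \<noteq> 0" by auto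
  ultimately have vT: "1 / vol_factor T = vol_factor A" by (simp add: divide_eq_eq)
  define a where "a = (1/2) *s (s + t)"
  define b where "b = (- \<i> / 2) *s (s - t)"
  have TP: "T (P x) = A x" for x by (simp add: A(4) [symmetric] T(4))
  have AT: "A x \<bullet> T y = x \<bullet> y" for x y by (simp add: A(2) T(3))
  have nA: "(norm (A x))\<^sup>2 = P x \<bullet> x" for x
    unfolding power2_norm_eq_inner A(2) A(4) by (simp add: inner_commute)
  have nT: "(norm (T x))\<^sup>2 = 4 * \<Phi>d x" for x
    using nA [of "Q x"] TP [of "Q x"] by (simp add: P_Q Phid_Q inner_commute)
  have ab: "complex_of_real (a \<bullet> x) + \<i> * complex_of_real (b \<bullet> x) = (cdot s (vcnj x) + cdot (vcnj t) x) / 2" for x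
  proof -
    have "complex_of_real (y \<bullet> x) = (cdot y (vcnj x) + cdot (vcnj y) x) / 2" for y
      using complex_add_cnj [of "cdot y (vcnj x)"] by (simp add: inner_cdot cnj_cdot)
    then show ?thesis by (simp add: a_def b_def cdot_simps field_simps)
  qed
  have f: "f = (\<lambda>x. exp (complex_of_real (- ((norm (T x))\<^sup>2) / 2 + T (P a) \<bullet> T x) + \<i> * (T (P b) \<bullet> T x)))"
    unfolding f_def TP AT nT ab [symmetric] by (simp add: algebra_simps)
  show "integrable lborel f" unfolding f by (rule gaussian_integral(1) [OF T(1,2)])
  have "(LINT x|lborel. f x) = complex_of_real (sqrt (2 * pi) ^ DIM(complex ^ 'n) / vol_factor T) *
      exp (complex_of_real ((norm (T (P a)))\<^sup>2 / 2 - (norm (T (P b)))\<^sup>2 / 2) + \<i> * (T (P a) \<bullet> T (P b)))"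
    unfolding f by (rule gaussian_integral(2) [OF T(1,2)])
  also have "complex_of_real ((norm (T (P a)))\<^sup>2 / 2 - (norm (T (P b)))\<^sup>2 / 2) + \<i> * (T (P a) \<bullet> T (P b)) = kernel_exponent s t"
  proof -
    have "A a \<bullet> A b = P a \<bullet> b" by (simp add: A(2) A(4) P_sym)
    then show ?thesis unfolding TP nA using kernel_exponent_polarization [of s t] by (simp add: a_def b_def)
  qed
  also have "sqrt (2 * pi) ^ DIM(complex ^ 'n) / vol_factor T = (2 * pi) ^ CARD('n) * sqrt (vol_factor P)"
  proof -
    have "DIM(complex ^ 'n) = 2 * CARD('n)" by simp
    then have "sqrt (2 * pi) ^ DIM(complex ^ 'n) = (2 * pi) ^ CARD('n)"
      by (simp only: power_mult) simp
    then show ?thesis unfolding vP vT [symmetric] by simp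
  qed
  finally show "(LINT x|lborel. f x) = complex_of_real ((2 * pi) ^ CARD('n) * sqrt (vol_factor P)) * exp (kernel_exponent s t)" .
qed

text \<open>The reciprocal of the integral of the Gaussian with exponent -2 L z . cnj z, which
  normalizes the reproducing kernel.\<close>

definition kernel_const :: real where "kernel_const = vol_factor ((*v) G) / (2 * pi) ^ CARD('n)"

lemma kernel_const_pos: "kernel_const > 0"
  using vol_factor_nn_integral(1) [OF linear_matrix bij_matrix [OF G_inv]] by (simp add: kernel_const_def)

lemma C_const_pos: "C_const \<Phi> > 0"
  using det_pos_def_matrix [OF H_pos] by (simp add: C_const_def)

text \<open>The origin of the exponent -1/4: sqrt(vol P) is vol G times sqrt(det H), and the square
  of \<open>C_const\<close> has to cancel sqrt(det H) and (2 pi)^(2 n) to leave the kernel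
  constant.\<close>

lemma C_const_sqrt: "(C_const \<Phi>)\<^sup>2 * ((2 * pi) ^ CARD('n) * sqrt (vol_factor P)) = kernel_const"
proof -
  define d where "d = Re (det H)"
  have d: "d > 0" using det_pos_def_matrix [OF H_pos] by (simp add: d_def)
  define p where "p = (2 * pi) ^ CARD('n)"
  have p: "p > 0" by (simp add: p_def)
  have vG: "vol_factor ((*v) G) > 0" by (rule vol_factor_nn_integral(1) [OF linear_matrix bij_matrix [OF G_inv]])
  have "(d powr (- 1 / 4))\<^sup>2 = d powr (- 1 / 2)"
    using d by (simp add: powr_powr power2_eq_square powr_add [symmetric])
  also have "\<dots> = 1 / sqrt d"
    using d powr_minus_divide [of d "1/2"] powr_half_sqrt [of d] by simp
  finally have 1: "(C_const \<Phi>)\<^sup>2 = 1 / sqrt d / p\<^sup>2"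
    unfolding C_const_def d_def [symmetric] p_def [symmetric] power_divide by simp
  have 2: "sqrt (vol_factor P) = vol_factor ((*v) G) * sqrt d"
    using vG by (simp add: vol_factor_P d_def real_sqrt_mult)
  show ?thesis
    unfolding 1 2 kernel_const_def p_def [symmetric] using d p by (simp add: field_simps power2_eq_square)
qed

lemma kernel_gaussian:
  "complex_of_real ((C_const \<Phi>)\<^sup>2) *
    (LINT x|lborel. exp ((cdot s (vcnj x) + cdot (vcnj t) x) / 2 - 2 * complex_of_real (\<Phi>d x))) =
    complex_of_real kernel_const * exp (kernel_exponent s t)"
  unfolding dual_gaussian(2) mult.assoc [symmetric] of_real_mult [symmetric]
  by (simp only: mult.assoc C_const_sqrt)

lemma LINT_L_form: "(LINT z|lborel. exp (- 2 * cdot (L *v z) (vcnj z))) = complex_of_real (1 / kernel_const)"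
proof -
  have "(norm (G *v z))\<^sup>2 = 4 * ((L *v z) \<bullet> z)" for z
    using G_G [of z] by (simp add: power2_norm_eq_inner G_sym inner_commute)
  moreover have "complex_of_real ((L *v z) \<bullet> z) = cdot (L *v z) (vcnj z)" for z
    using cnj_cdot_L [of z z] unfolding inner_cdot by (intro of_real_Re) (simp add: Reals_cnj_iff)
  ultimately have "exp (- 2 * cdot (L *v z) (vcnj z)) =
      exp (complex_of_real (- ((norm (G *v z))\<^sup>2) / 2 + (G *v 0) \<bullet> (G *v z)) + \<i> * ((G *v 0) \<bullet> (G *v z)))" for z
    by simp
  then have "(LINT z|lborel. exp (- 2 * cdot (L *v z) (vcnj z))) =
     complex_of_real (sqrt (2 * pi) ^ DIM(complex ^ 'n) / vol_factor ((*v) G))"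
    using gaussian_integral(2) [OF linear_matrix bij_matrix [OF G_inv], of 0 0] by simp
  moreover have "DIM(complex ^ 'n) = 2 * CARD('n)" by simp
  then have "sqrt (2 * pi) ^ DIM(complex ^ 'n) = (2 * pi) ^ CARD('n)"
    by (simp only: power_mult) simp
  ultimately show ?thesis by (simp only:) (simp add: kernel_const_def)
qed

definition repr_kernel :: "complex ^ 'n \<Rightarrow> complex ^ 'n \<Rightarrow> complex" where
  "repr_kernel s y = complex_of_real kernel_const * exp (kernel_exponent y s)"

definition weighted :: "(complex ^ 'n \<Rightarrow> complex) \<Rightarrow> complex ^ 'n \<Rightarrow> complex" where
  "weighted u = (\<lambda>x. u x * exp (- complex_of_real (\<Phi> x)))"

lemma weighted_repr_kernel_L2: "weighted (repr_kernel s) \<in> L2 lborel"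
proof -
  have "continuous_on UNIV (weighted (repr_kernel s))"
    unfolding weighted_def repr_kernel_def kernel_exponent_def by (intro continuous_intros continuous_on_Phi)
  then have [measurable]: "weighted (repr_kernel s) \<in> borel_measurable borel"
    by (rule borel_measurable_continuous_onI)
  obtain m where m: "m > 0" "\<And>x. m * (norm x)\<^sup>2 \<le> (L *v x) \<bullet> x"
    using pos_form_lower_bound [OF linear_matrix, of L] L_pos unfolding pos_def_matrix_iff by metis
  define k where "k = Re (cdot s (M *v s))"
  \<comment> \<open>The terms y . M y of the kernel and of the weight cancel in the real part. What
    remains decays by the positive definite \<open>L\<close>.\<close>
  have re: "Re (kernel_exponent y s) - \<Phi> y = 2 * (y \<bullet> (L *v s)) - (L *v y) \<bullet> y + k" for y
  proof -
    have "2 * \<Phi> y = Re (kernel_exponent y y)" by (simp add: kernel_exponent_diag)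
    also have "\<dots> = 2 * ((L *v y) \<bullet> y) + 2 * Re (cdot y (M *v y))"
      by (simp add: kernel_exponent_def inner_cdot)
    finally have "\<Phi> y = (L *v y) \<bullet> y + Re (cdot y (M *v y))" by simp
    moreover have "(L *v y) \<bullet> s = y \<bullet> (L *v s)" using L_pos unfolding pos_def_matrix_iff by blast
    ultimately show ?thesis by (simp add: kernel_exponent_def k_def inner_cdot)
  qed
  have "integrable lborel (\<lambda>y. (cmod (weighted (repr_kernel s) y))\<^sup>2)"
  proof (rule integrable_gaussian_bound)
    show "2 * m > 0" using m by simp
    fix y
    have "cmod (weighted (repr_kernel s) y) = kernel_const * exp (Re (kernel_exponent y s) - \<Phi> y)"
      using kernel_const_pos by (simp add: weighted_def repr_kernel_def norm_mult norm_exp_eq_Re mult_exp_exp)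
    also have "\<dots> \<le> kernel_const * exp (k + 2 * norm (L *v s) * norm y - m * (norm y)\<^sup>2)"
      using kernel_const_pos m(2) [of y] norm_cauchy_schwarz [of y "L *v s"] unfolding re
      by (intro mult_left_mono) (auto simp: mult.commute)
    finally have "(cmod (weighted (repr_kernel s) y))\<^sup>2 \<le> (kernel_const * exp (k + 2 * norm (L *v s) * norm y - m * (norm y)\<^sup>2))\<^sup>2"
      by (rule power_mono) simp
    also have "\<dots> = kernel_const\<^sup>2 * exp (2 * k) * exp (4 * norm (L *v s) * norm y - 2 * m * (norm y)\<^sup>2)"
      by (simp add: power_mult_distrib exp_double [symmetric] mult.assoc exp_add [symmetric] algebra_simps)
    finally show "norm ((cmod (weighted (repr_kernel s) y))\<^sup>2) \<le>
        kernel_const\<^sup>2 * exp (2 * k) * exp (4 * norm (L *v s) * norm y - 2 * m * (norm y)\<^sup>2)" by simp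
  qed measurable
  then show ?thesis by (simp add: L2_def)
qed

text \<open>After the shift \<open>y = s + z\<close> the integrand is a holomorphic function of \<open>z\<close> times a weight
  invariant under rotations \<open>z \<mapsto> \<zeta> z\<close>.\<close>

lemma reproducing:
  assumes u: "entire u" and uL2: "weighted u \<in> L2 lborel"
  shows "L2_inner lborel (weighted u) (weighted (repr_kernel s)) = u s"
proof -
  let ?g = "\<lambda>y. weighted u y * cnj (weighted (repr_kernel s) y)"
  define f where "f = (\<lambda>z. u (s + z) * exp (- 2 * cdot (L *v z) (vcnj s) + cdot s (M *v s) -
      cdot (s + z) (M *v (s + z))))"
  define w where "w = (\<lambda>z. exp (- 2 * cdot (L *v z) (vcnj z)))"
  have g: "?g (s + z) = complex_of_real kernel_const * (f z * w z)" for z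
  proof -
    \<comment> \<open>The weight exp(-2 \<Phi>) is the diagonal kernel exponential. Subtracting it
      cancels the antiholomorphic terms, so only the Hermitian term in \<open>z\<close> fails to be
      holomorphic; it becomes \<open>w\<close>.\<close>
    have "kernel_exponent s (s + z) - kernel_exponent (s + z) (s + z) =
       (- 2 * cdot (L *v z) (vcnj s) + cdot s (M *v s) - cdot (s + z) (M *v (s + z))) - 2 * cdot (L *v z) (vcnj z)"
      by (simp add: kernel_exponent_def matrix_vector_right_distrib cdot_simps algebra_simps)
    moreover have "cnj (weighted (repr_kernel s) y) * exp (- complex_of_real (\<Phi> y)) =
        complex_of_real kernel_const * exp (kernel_exponent s y - kernel_exponent y y)" for y
      by (simp add: weighted_def repr_kernel_def exp_cnj kernel_exponent_cnj kernel_exponent_diag mult_exp_exp)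
    ultimately show ?thesis
      by (simp add: weighted_def [of u] f_def w_def mult_exp_exp mult_ac)
  qed
  have int: "integrable lborel ?g" by (intro L2_integrable_mult uL2 weighted_repr_kernel_L2)
  have [measurable]: "?g \<in> borel_measurable borel" using borel_measurable_integrable [OF int] by simp
  have "integrable lborel (\<lambda>z. ?g (s + z))"
    using int lborel_distr_plus [of s] integrable_distr_eq [of "(+) s" lborel borel ?g] by simp
  then have "integrable lborel (\<lambda>z. inverse (complex_of_real kernel_const) * ?g (s + z))"
    by (intro integrable_mult_right)
  then have int': "integrable lborel (\<lambda>z. f z * w z)"
    unfolding g using kernel_const_pos by (simp add: mult.assoc [symmetric])
  have "L2_inner lborel (weighted u) (weighted (repr_kernel s)) = (LINT z|lborel. ?g (s + z))"
    unfolding L2_inner_def by (subst lborel_distr_plus [of s, symmetric], subst integral_distr) auto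
  also have "\<dots> = complex_of_real kernel_const * (LINT z|lborel. f z * w z)" unfolding g by simp
  also have "(LINT z|lborel. f z * w z) = f 0 * (LINT z|lborel. w z)"
  proof (rule rotation_mean_value [OF _ _ _ _ int'])
    show "continuous_on UNIV f"
      unfolding f_def
      by (intro continuous_intros continuous_on_compose2 [OF entire_continuous_on [OF u, of UNIV]]) auto
    show "w \<in> borel_measurable borel"
      unfolding w_def by (intro borel_measurable_continuous_onI continuous_intros)
    show "w (\<zeta> *s z) = w z" if "cmod \<zeta> = 1" for \<zeta> z
    proof -
      have "\<zeta> * cnj \<zeta> = 1" using that complex_norm_square [of \<zeta>] by simp
      then have "cnj \<zeta> * (\<zeta> * a) = a" for a by (simp add: mult.assoc [symmetric] mult.commute [of "cnj \<zeta>"])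
      then show ?thesis by (simp only: w_def vector_scalar_commute vcnj_simps cdot_simps)
    qed
    show "(\<lambda>\<zeta>. f (\<zeta> *s z)) holomorphic_on UNIV" for z
    proof -
      define c1 where "c1 = - 2 * cdot (L *v z) (vcnj s) - cdot s (M *v z) - cdot z (M *v s)"
      define c2 where "c2 = - cdot z (M *v z)"
      have "(\<lambda>\<zeta>. f (\<zeta> *s z)) = (\<lambda>\<zeta>. u (s + \<zeta> *s z) * exp (\<zeta> * c1 + \<zeta> * \<zeta> * c2))"
        by (rule ext) (simp add: f_def c1_def c2_def matrix_vector_right_distrib vector_scalar_commute
            cdot_simps algebra_simps)
      moreover have "(\<lambda>\<zeta>. exp (\<zeta> * c1 + \<zeta> * \<zeta> * c2)) holomorphic_on UNIV"
        by (intro holomorphic_intros)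
      ultimately show ?thesis
        using holomorphic_on_mult [OF entire_holomorphic_line [OF u]] by simp
    qed
  qed
  also have "f 0 = u s" by (simp add: f_def cdot_def)
  finally show ?thesis unfolding w_def LINT_L_form using kernel_const_pos by simp
qed

end

section \<open>Representation of Taylor coefficients in the dual space\<close>

lemma L2_norm_mono:
  assumes [measurable]: "f \<in> borel_measurable M" and g: "g \<in> L2 M" and le: "\<And>x. cmod (f x) \<le> cmod (g x)"
  shows "f \<in> L2 M" "L2_norm M f \<le> L2_norm M g"
proof -
  have le2: "(cmod (f x))\<^sup>2 \<le> (cmod (g x))\<^sup>2" for x by (rule power_mono [OF le]) simp
  have ig: "integrable M (\<lambda>x. (cmod (g x))\<^sup>2)" using g by (simp add: L2_def)
  have if': "integrable M (\<lambda>x. (cmod (f x))\<^sup>2)"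
    by (rule Bochner_Integration.integrable_bound [OF ig]) (simp_all add: le2)
  then show "f \<in> L2 M" by (simp add: L2_def)
  show "L2_norm M f \<le> L2_norm M g"
    unfolding L2_norm_def by (intro real_sqrt_le_mono integral_mono if' ig le2)
qed

lemma cmod_exp_remainder: "cmod (exp w - 1 - w) \<le> (cmod w)\<^sup>2 * exp (cmod w)"
proof -
  have "cmod (exp w - (\<Sum>k\<le>1. w ^ k / fact k)) \<le> exp \<bar>Re w\<bar> * cmod w ^ Suc 1 / fact 1"
    by (rule Taylor_exp)
  also have "\<dots> \<le> exp (cmod w) * (cmod w)\<^sup>2"
    by (simp add: power2_eq_square mult_right_mono abs_Re_le_cmod)
  finally show ?thesis by (simp add: algebra_simps)
qed

section \<open>Entire functions, monomials and multi-indices\<close>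

lemma entire_const: "entire (\<lambda>x. c)"
  unfolding entire_def by (auto intro!: exI [of _ "\<lambda>_. 0"])

lemma entire_add:
  assumes "entire u" "entire v" shows "entire (\<lambda>x. u x + v x)"
  unfolding entire_def
proof
  fix x
  obtain u' v' where *: "(u has_derivative u') (at x)" "\<And>c y. u' (c *s y) = c * u' y"
    "(v has_derivative v') (at x)" "\<And>c y. v' (c *s y) = c * v' y"
    using assms unfolding entire_def by metis
  show "\<exists>w'. ((\<lambda>x. u x + v x) has_derivative w') (at x) \<and> (\<forall>c y. w' (c *s y) = c * w' y)"
    using has_derivative_add [OF *(1,3)]
    by (intro exI [of _ "\<lambda>h. u' h + v' h"]) (simp add: * algebra_simps)
qed

lemma entire_mult:
  assumes "entire u" "entire v" shows "entire (\<lambda>x. u x * v x)"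
  unfolding entire_def
proof
  fix x
  obtain u' v' where *: "(u has_derivative u') (at x)" "\<And>c y. u' (c *s y) = c * u' y"
    "(v has_derivative v') (at x)" "\<And>c y. v' (c *s y) = c * v' y"
    using assms unfolding entire_def by metis
  show "\<exists>w'. ((\<lambda>x. u x * v x) has_derivative w') (at x) \<and> (\<forall>c y. w' (c *s y) = c * w' y)"
    using has_derivative_mult [OF *(1,3)]
    by (intro exI [of _ "\<lambda>h. u x * v' h + u' h * v x"]) (simp add: * algebra_simps)
qed

lemma entire_component: "entire (\<lambda>x. x $ j)"
  unfolding entire_def
  by (intro allI exI [of _ "\<lambda>h. h $ j"] conjI bounded_linear_imp_has_derivative bounded_linear_vec_nth) simp

lemma entire_power: "entire u \<Longrightarrow> entire (\<lambda>x. u x ^ k)"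
  by (induction k) (simp_all add: entire_const entire_mult)

lemma entire_monomial: "entire (monomial \<alpha>)"
proof -
  have "entire (\<lambda>x. \<Prod>j\<in>A. (x $ j) ^ \<alpha> j)" if "finite A" for A
    using that by induction (simp_all add: entire_const entire_mult entire_power entire_component)
  then show ?thesis by (simp add: monomial_def [abs_def])
qed

text \<open>An exponential bound, so that monomials fall under the same integrability criterion as
  exponentials.\<close>

lemma cmod_monomial_le: "cmod (monomial \<alpha> x) \<le> exp (real (mi_size \<alpha>) * norm x)"
proof -
  have "cmod (x $ j) \<le> exp (norm x)" for j
    using Finite_Cartesian_Product.norm_nth_le [of x j] exp_ge_add_one_self [of "norm x"] by linarith
  then have "cmod (monomial \<alpha> x) \<le> (\<Prod>j\<in>UNIV. exp (norm x) ^ \<alpha> j)"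
    unfolding monomial_def by (simp add: prod_norm [symmetric] norm_power prod_mono power_mono)
  also have "\<dots> = exp (real (mi_size \<alpha>) * norm x)"
    by (simp add: mi_size_def exp_of_nat_mult [symmetric] exp_sum [symmetric] sum_distrib_right)
  finally show ?thesis .
qed

lemma monomial_in_H_space:
  assumes m: "m > 0" "\<And>x. m * (norm x)\<^sup>2 \<le> \<Psi> x" and cont: "continuous_on UNIV \<Psi>"
  shows "monomial \<alpha> \<in> H_space \<Psi> 1"
proof -
  have c: "continuous_on UNIV (monomial \<alpha>)" by (rule entire_continuous_on [OF entire_monomial])
  have "integrable lborel (\<lambda>x. (cmod (monomial \<alpha> x))\<^sup>2 * exp (- 2 * \<Psi> x / 1))"
  proof (rule integrable_gaussian_bound)
    show "(\<lambda>x. (cmod (monomial \<alpha> x))\<^sup>2 * exp (- 2 * \<Psi> x / 1)) \<in> borel_measurable borel"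
      by (intro borel_measurable_continuous_onI continuous_on_mult continuous_on_power
          continuous_on_norm c continuous_on_exp continuous_on_divide cont continuous_on_const) simp
    show "2 * m > 0" using m by simp
    fix x
    have "(cmod (monomial \<alpha> x))\<^sup>2 * exp (- 2 * \<Psi> x / 1) \<le>
        (exp (real (mi_size \<alpha>) * norm x))\<^sup>2 * exp (- (2 * m * (norm x)\<^sup>2))"
      using m(2) [of x] by (intro mult_mono power_mono cmod_monomial_le) auto
    then show "norm ((cmod (monomial \<alpha> x))\<^sup>2 * exp (- 2 * \<Psi> x / 1)) \<le>
        1 * exp (2 * real (mi_size \<alpha>) * norm x - 2 * m * (norm x)\<^sup>2)"
      by (simp add: exp_double [symmetric] mult_exp_exp mult.assoc)
  qed
  then show ?thesis by (simp add: H_space_def entire_monomial)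
qed

text \<open>Existence of the list chosen by \<open>SOME\<close> in
  \<open>holo_multi_deriv\<close>.\<close>

lemma multi_index_list: "\<exists>js. \<forall>j. count_list js j = (\<alpha> :: 'n::finite \<Rightarrow> nat) j"
proof -
  have "\<exists>js. \<forall>j. count_list js j = (if j \<in> A then \<alpha> j else 0)" if "finite A" for A
    using that
  proof induction
    case empty
    show ?case by (intro exI [of _ "[]"]) simp
  next
    case (insert i A)
    then obtain js where js: "\<forall>j. count_list js j = (if j \<in> A then \<alpha> j else 0)" by blast
    have "count_list (replicate n i) j = (if j = i then n else 0)" for n j by (induction n) auto
    then show ?case using js insert.hyps by (intro exI [of _ "replicate (\<alpha> i) i @ js"]) auto
  qed
  from this [of UNIV] show ?thesis by simp
qed

lemma prod_list_count:
  fixes f :: "'n::finite \<Rightarrow> 'b::comm_monoid_mult"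
  shows "prod_list (map f js) = (\<Prod>j\<in>UNIV. f j ^ count_list js j)"
proof (induction js)
  case (Cons i js)
  have "(\<Prod>j\<in>UNIV. f j ^ count_list (i # js) j) = (\<Prod>j\<in>UNIV. (if j = i then f j else 1) * f j ^ count_list js j)"
    by (intro prod.cong) auto
  then show ?case by (simp add: Cons prod.distrib)
qed simp

section \<open>Exponentials in the dual space and their transform\<close>

context convex_weight
begin

text \<open>\<open>Es s\<close> is the exponential \<open>exp (s \<cdot> cnj x / 2)\<close> times the square root of the Gaussian weight
  of the dual space, so that inner products in the dual space become plain \<open>L2\<close> inner products.\<close>

definition Es :: "complex ^ 'n \<Rightarrow> complex ^ 'n \<Rightarrow> complex" where
  "Es s x = exp (cdot s (vcnj x) / 2 - complex_of_real (\<Phi>d x))"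

text \<open>A class inside L2 that contains the exponentials and is stable under factors of
  exponential growth, hence under the factors produced by differentiating in
  \<open>s\<close>.\<close>

definition gauss_dominated :: "(complex ^ 'n \<Rightarrow> complex) set" where
  "gauss_dominated = {f. f \<in> borel_measurable borel \<and> (\<exists>K r. \<forall>x. cmod (f x) \<le> K * exp (r * norm x - \<Phi>d x))}"

lemma gauss_dominated_L2: assumes "f \<in> gauss_dominated" shows "f \<in> L2 lborel"
proof -
  obtain K r where f [measurable]: "f \<in> borel_measurable borel"
    and K: "\<And>x. cmod (f x) \<le> K * exp (r * norm x - \<Phi>d x)"
    using assms unfolding gauss_dominated_def by blast
  obtain m where m: "m > 0" "\<And>x. m * (norm x)\<^sup>2 \<le> \<Phi>d x" using Phid_lower_bound by blast
  have "integrable lborel (\<lambda>x. (cmod (f x))\<^sup>2)"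
  proof (rule integrable_gaussian_bound)
    show "2 * m > 0" using m by simp
    fix x
    have "(cmod (f x))\<^sup>2 \<le> (K * exp (r * norm x - \<Phi>d x))\<^sup>2" by (rule power_mono [OF K]) simp
    also have "\<dots> = K\<^sup>2 * exp (2 * r * norm x - 2 * \<Phi>d x)"
      by (simp add: power_mult_distrib exp_double [symmetric] algebra_simps)
    also have "\<dots> \<le> K\<^sup>2 * exp (2 * r * norm x - 2 * m * (norm x)\<^sup>2)"
      using m(2) [of x] by (intro mult_left_mono) auto
    finally show "norm ((cmod (f x))\<^sup>2) \<le> K\<^sup>2 * exp (2 * r * norm x - 2 * m * (norm x)\<^sup>2)" by simp
  qed measurable
  then show ?thesis by (simp add: L2_def)
qed

lemma gauss_dominated_mult:
  assumes f: "f \<in> gauss_dominated" and p: "p \<in> borel_measurable borel" "\<And>x. cmod (p x) \<le> exp (r * norm x)"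
  shows "(\<lambda>x. p x * f x) \<in> gauss_dominated"
proof -
  obtain K r' where fm: "f \<in> borel_measurable borel"
    and K: "\<And>x. cmod (f x) \<le> K * exp (r' * norm x - \<Phi>d x)"
    using f unfolding gauss_dominated_def by blast
  have "(\<lambda>x. p x * f x) \<in> borel_measurable borel" by (intro borel_measurable_times p fm)
  moreover have "cmod (p x * f x) \<le> K * exp ((r + r') * norm x - \<Phi>d x)" for x
  proof -
    have "cmod (p x * f x) \<le> exp (r * norm x) * (K * exp (r' * norm x - \<Phi>d x))"
      unfolding norm_mult by (intro mult_mono p K) auto
    then show ?thesis by (simp add: mult_exp_exp mult.left_commute algebra_simps)
  qed
  ultimately show ?thesis unfolding gauss_dominated_def by blast
qed

lemma cmod_cdot_half_le: "cmod (cdot v (vcnj x) / 2) \<le> real CARD('n) * norm v * norm (x :: complex ^ 'n)"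
proof -
  have "cmod (cdot v (vcnj x) / 2) \<le> cmod (cdot v (vcnj x))" by (simp add: norm_divide)
  also have "\<dots> \<le> real CARD('n) * (norm v * norm x)" using cmod_cdot_le [of v "vcnj x"] by simp
  finally show ?thesis by (simp only: mult.assoc)
qed

lemma Es_gauss_dominated: "Es s \<in> gauss_dominated"
proof -
  have "Es s \<in> borel_measurable borel"
    unfolding Es_def
    by (intro borel_measurable_continuous_onI continuous_on_exp continuous_on_diff continuous_on_divide
        continuous_on_cdot continuous_on_vcnj continuous_on_of_real continuous_on_Phid
        continuous_on_const continuous_on_id) simp
  moreover have "cmod (Es s x) \<le> 1 * exp (real CARD('n) * norm s * norm x - \<Phi>d x)" for x
    using cmod_cdot_half_le [of s x] complex_Re_le_cmod [of "cdot s (vcnj x) / 2"]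
    by (simp add: Es_def norm_exp_eq_Re)
  ultimately show ?thesis unfolding gauss_dominated_def by blast
qed

text \<open>The second order remainder of exp in \<open>v\<close> is at most the squared norm of
  \<open>v\<close> times one fixed L2 function. It serves both for differentiating transforms and
  for the difference quotients of the representing functions.\<close>

lemma remainder_bound:
  assumes f: "f \<in> gauss_dominated"
  obtains B where "B \<ge> 0" "\<And>v. norm v \<le> 1 \<Longrightarrow>
    (\<lambda>x. (exp (cdot v (vcnj x) / 2) - 1 - cdot v (vcnj x) / 2) * f x) \<in> L2 lborel \<and>
    L2_norm lborel (\<lambda>x. (exp (cdot v (vcnj x) / 2) - 1 - cdot v (vcnj x) / 2) * f x) \<le> B * (norm v)\<^sup>2"
proof
  define n where "n = real CARD('n)"
  \<comment> \<open>With t = n |x|, the factor t^2 is at most exp(2 t), and the exponential in the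
    remainder is at most exp(t) for \<open>v\<close> in the unit ball; hence the 3.\<close>
  define g where "g = (\<lambda>x. complex_of_real (exp (3 * n * norm x)) * f x)"
  have [measurable]: "f \<in> borel_measurable borel" using f unfolding gauss_dominated_def by blast
  have "g \<in> gauss_dominated"
    unfolding g_def
  proof (rule gauss_dominated_mult [OF f])
    show "(\<lambda>x. complex_of_real (exp (3 * n * norm x))) \<in> borel_measurable borel" by measurable
    show "cmod (complex_of_real (exp (3 * n * norm x))) \<le> exp (3 * n * norm x)" for x :: "complex ^ 'n" by simp
  qed
  then have g: "g \<in> L2 lborel" by (rule gauss_dominated_L2)
  show "L2_norm lborel g \<ge> 0" by (rule L2_norm_nonneg)
  fix v :: "complex ^ 'n" assume v: "norm v \<le> 1"
  let ?w = "\<lambda>x. cdot v (vcnj x) / 2"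
  let ?h = "\<lambda>x. (exp (?w x) - 1 - ?w x) * f x"
  have "(\<lambda>x. exp (?w x) - 1 - ?w x) \<in> borel_measurable borel"
    by (intro borel_measurable_continuous_onI continuous_on_exp continuous_on_diff continuous_on_divide
        continuous_on_cdot continuous_on_vcnj continuous_on_const continuous_on_id) simp_all
  then have hm: "?h \<in> borel_measurable lborel" by measurable
  have le: "cmod (?h x) \<le> cmod (complex_of_real ((norm v)\<^sup>2) * g x)" for x
  proof -
    let ?t = "n * norm x"
    have t: "0 \<le> ?t" by (simp add: n_def)
    have w: "cmod (?w x) \<le> norm v * ?t"
      using cmod_cdot_half_le [of v x] by (simp add: n_def mult_ac)
    also have "\<dots> \<le> 1 * ?t" by (rule mult_right_mono [OF v t])
    finally have w1: "cmod (?w x) \<le> ?t" by simp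
    have "?t \<le> exp ?t" using exp_ge_add_one_self [of ?t] by linarith
    then have t2: "?t\<^sup>2 \<le> (exp ?t)\<^sup>2" by (rule power_mono [OF _ t])
    have "cmod (exp (?w x) - 1 - ?w x) \<le> (cmod (?w x))\<^sup>2 * exp (cmod (?w x))" by (rule cmod_exp_remainder)
    also have "\<dots> \<le> (norm v * ?t)\<^sup>2 * exp ?t"
      using w w1 by (intro mult_mono power_mono) auto
    also have "\<dots> = (norm v)\<^sup>2 * (?t\<^sup>2 * exp ?t)" by (simp only: power_mult_distrib mult.assoc)
    also have "\<dots> \<le> (norm v)\<^sup>2 * ((exp ?t)\<^sup>2 * exp ?t)"
      by (intro mult_left_mono mult_right_mono t2) auto
    also have "(exp ?t)\<^sup>2 * exp ?t = exp (3 * n * norm x)"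
      by (simp add: power2_eq_square mult_exp_exp)
    finally have "cmod (exp (?w x) - 1 - ?w x) * cmod (f x) \<le> (norm v)\<^sup>2 * exp (3 * n * norm x) * cmod (f x)"
      by (rule mult_right_mono) simp
    then show ?thesis by (simp add: g_def norm_mult norm_power mult.assoc)
  qed
  note mono = L2_norm_mono [OF hm L2_scale [OF g] le]
  show "?h \<in> L2 lborel \<and> L2_norm lborel ?h \<le> L2_norm lborel g * (norm v)\<^sup>2"
    using mono unfolding L2_norm_scale by (simp add: norm_power mult.commute [of "L2_norm lborel g"])
qed

lemma Es_add: "Es (s + v) x = exp (cdot v (vcnj x) / 2) * Es s x"
  by (simp add: Es_def cdot_simps mult_exp_exp add_divide_distrib algebra_simps)

text \<open>Conjugate linear in \<phi>. The factor is the one that sends \<open>Es s\<close> exactly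
  to the reproducing kernel at \<open>s\<close>; norms are then multiplied by
  \<open>C_const \<Phi>\<close>.\<close>

definition transform :: "(complex ^ 'n \<Rightarrow> complex) \<Rightarrow> complex ^ 'n \<Rightarrow> complex" where
  "transform \<phi> y = complex_of_real ((C_const \<Phi>)\<^sup>2) * L2_inner lborel (Es y) \<phi>"

lemma transform_Es: "transform (Es s) = repr_kernel s"
proof
  fix y
  have "Es y x * cnj (Es s x) = exp ((cdot y (vcnj x) + cdot (vcnj s) x) / 2 - 2 * complex_of_real (\<Phi>d x))" for x
    by (simp add: Es_def exp_cnj cnj_cdot mult_exp_exp add_divide_distrib algebra_simps)
  then show "transform (Es s) y = repr_kernel s y"
    unfolding transform_def repr_kernel_def L2_inner_def kernel_gaussian [symmetric] by simp
qed

lemma transform_linear: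
  assumes "\<phi> \<in> L2 lborel" "\<psi> \<in> L2 lborel"
  shows "transform (\<lambda>x. a * \<phi> x + b * \<psi> x) y = cnj a * transform \<phi> y + cnj b * transform \<psi> y"
  unfolding transform_def L2_inner_add_right [OF L2_scale [OF assms(1)] L2_scale [OF assms(2)] gauss_dominated_L2 [OF Es_gauss_dominated]]
    L2_inner_scale_right by (simp add: algebra_simps)

text \<open>\<open>Es\<close> is differentiable in its parameter as a map into L2, with quadratic
  remainder, and Cauchy-Schwarz passes this to the inner product. The derivative is complex linear
  because the exponent of \<open>Es\<close> is.\<close>

lemma entire_transform:
  assumes \<phi>: "\<phi> \<in> L2 lborel"
  shows "entire (transform \<phi>)"
  unfolding entire_def
proof
  fix y
  define n where "n = real CARD('n)"
  let ?w = "\<lambda>v x :: complex ^ 'n. cdot v (vcnj x) / 2"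
  define u' where "u' = (\<lambda>v. complex_of_real ((C_const \<Phi>)\<^sup>2) * L2_inner lborel (\<lambda>x. ?w v x * Es y x) \<phi>)"
  have wEs: "(\<lambda>x. ?w v x * Es y x) \<in> L2 lborel" for v
  proof (rule gauss_dominated_L2, rule gauss_dominated_mult [OF Es_gauss_dominated])
    show "?w v \<in> borel_measurable borel"
      by (intro borel_measurable_continuous_onI continuous_on_divide
        continuous_on_cdot continuous_on_vcnj continuous_on_const continuous_on_id) simp
    show "cmod (?w v x) \<le> exp (n * norm v * norm x)" for x
      using cmod_cdot_half_le [of v x] exp_ge_add_one_self [of "n * norm v * norm x"]
      unfolding n_def by linarith
  qed
  have lin: "linear u'"
  proof (rule linearI)
    have eq: "(\<lambda>x. ?w (v + v') x * Es y x) = (\<lambda>x. ?w v x * Es y x + ?w v' x * Es y x)" for v v'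
      by (rule ext) (simp add: cdot_simps algebra_simps add_divide_distrib)
    show "u' (v + v') = u' v + u' v'" for v v'
      unfolding u'_def eq L2_inner_add_left [OF wEs wEs \<phi>] by (simp add: distrib_left)
    have eq: "(\<lambda>x. ?w (r *\<^sub>R v) x * Es y x) = (\<lambda>x. complex_of_real r * (?w v x * Es y x))" for r v
      by (rule ext) (simp add: cdot_simps)
    show "u' (r *\<^sub>R v) = r *\<^sub>R u' v" for r v
      unfolding u'_def eq L2_inner_scale_left by (simp add: scaleR_conv_of_real)
  qed
  have clin: "u' (c *s v) = c * u' v" for c v
  proof -
    have eq: "(\<lambda>x. ?w (c *s v) x * Es y x) = (\<lambda>x. c * (?w v x * Es y x))"
      by (rule ext) (simp add: cdot_simps)
    show ?thesis unfolding u'_def eq L2_inner_scale_left by simp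
  qed
  obtain B where B0: "B \<ge> 0" and B: "\<And>v. norm v \<le> 1 \<Longrightarrow>
    (\<lambda>x. (exp (?w v x) - 1 - ?w v x) * Es y x) \<in> L2 lborel \<and>
    L2_norm lborel (\<lambda>x. (exp (?w v x) - 1 - ?w v x) * Es y x) \<le> B * (norm v)\<^sup>2"
    by (rule remainder_bound [OF Es_gauss_dominated [of y]]) (rule that)
  define K where "K = (C_const \<Phi>)\<^sup>2 * (B * L2_norm lborel \<phi>)"
  have rem: "cmod (transform \<phi> (y + v) - transform \<phi> y - u' v) \<le> K * (norm v)\<^sup>2" if v: "norm v \<le> 1" for v
  proof -
    have eq: "(\<lambda>x. (exp (?w v x) - 1 - ?w v x) * Es y x) = (\<lambda>x. (Es (y + v) x - Es y x) - ?w v x * Es y x)"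
      unfolding Es_add [of y v] by (rule ext) (simp add: algebra_simps)
    have E: "Es z \<in> L2 lborel" for z by (rule gauss_dominated_L2 [OF Es_gauss_dominated])
    have "transform \<phi> (y + v) - transform \<phi> y - u' v =
        complex_of_real ((C_const \<Phi>)\<^sup>2) * L2_inner lborel (\<lambda>x. (exp (?w v x) - 1 - ?w v x) * Es y x) \<phi>"
      unfolding eq L2_inner_diff_left [OF L2_diff [OF E E] wEs \<phi>] L2_inner_diff_left [OF E E \<phi>]
      by (simp add: transform_def u'_def right_diff_distrib)
    also have "cmod \<dots> = (C_const \<Phi>)\<^sup>2 * cmod (L2_inner lborel (\<lambda>x. (exp (?w v x) - 1 - ?w v x) * Es y x) \<phi>)"
      by (simp add: norm_mult norm_power)
    also have "\<dots> \<le> (C_const \<Phi>)\<^sup>2 * (L2_norm lborel (\<lambda>x. (exp (?w v x) - 1 - ?w v x) * Es y x) * L2_norm lborel \<phi>)"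
      by (intro mult_left_mono L2_Cauchy_Schwarz B [THEN conjunct1] v \<phi>) simp
    also have "\<dots> \<le> (C_const \<Phi>)\<^sup>2 * (B * (norm v)\<^sup>2 * L2_norm lborel \<phi>)"
      by (intro mult_left_mono mult_right_mono B [THEN conjunct2] v L2_norm_nonneg) simp
    finally show ?thesis by (simp add: K_def mult_ac)
  qed
  have "(transform \<phi> has_derivative u') (at y)"
  proof (rule has_derivativeI_sandwich [of 1])
    show "bounded_linear u'" using lin by (simp add: linear_conv_bounded_linear)
    show "cmod (transform \<phi> z - transform \<phi> y - u' (z - y)) / norm (z - y) \<le> K * norm (z - y)"
      if "z \<noteq> y" "dist z y < 1" for z
    proof -
      have "cmod (transform \<phi> z - transform \<phi> y - u' (z - y)) \<le> K * (norm (z - y))\<^sup>2"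
        using rem [of "z - y"] that by (simp add: dist_norm)
      then show ?thesis using that by (simp add: divide_le_eq power2_eq_square mult.assoc)
    qed
    have "((\<lambda>z. K * norm (z - y)) \<longlongrightarrow> K * norm (y - y)) (at y)" by (intro tendsto_intros)
    then show "((\<lambda>z. K * norm (z - y)) \<longlongrightarrow> 0) (at y)" by simp
  qed simp
  then show "\<exists>u'. (transform \<phi> has_derivative u') (at y) \<and> (\<forall>c v. u' (c *s v) = c * u' v)"
    using clin by blast
qed

section \<open>The transform on the closed span of the exponentials\<close>

inductive_set exp_span :: "(complex ^ 'n \<Rightarrow> complex) set" where
  exp_span_Es: "Es s \<in> exp_span"
| exp_span_lin: "f \<in> exp_span \<Longrightarrow> g \<in> exp_span \<Longrightarrow> (\<lambda>x. a * f x + b * g x) \<in> exp_span"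

lemma weighted_transform_linear:
  assumes "\<phi> \<in> L2 lborel" "\<psi> \<in> L2 lborel"
  shows "weighted (transform (\<lambda>x. a * \<phi> x + b * \<psi> x)) =
    (\<lambda>x. cnj a * weighted (transform \<phi>) x + cnj b * weighted (transform \<psi>) x)"
  by (rule ext) (simp add: weighted_def transform_linear [OF assms] algebra_simps)

lemma exp_span_L2: "\<phi> \<in> exp_span \<Longrightarrow> \<phi> \<in> L2 lborel \<and> weighted (transform \<phi>) \<in> L2 lborel"
proof (induction rule: exp_span.induct)
  case (exp_span_Es s)
  show ?case by (simp add: gauss_dominated_L2 Es_gauss_dominated transform_Es weighted_repr_kernel_L2)
next
  case (exp_span_lin f g a b)
  then show ?case by (simp add: weighted_transform_linear L2_add L2_scale)
qed

text \<open>By linearity in \<psi> it suffices to take an exponential, whose transform is a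
  reproducing kernel: the left side is then a value of the entire function
  \<open>transform \<phi>\<close>. The arguments swap because the transform is conjugate
  linear.\<close>

lemma exp_span_inner:
  assumes "\<phi> \<in> exp_span" "\<psi> \<in> exp_span"
  shows "L2_inner lborel (weighted (transform \<phi>)) (weighted (transform \<psi>)) =
    complex_of_real ((C_const \<Phi>)\<^sup>2) * L2_inner lborel \<psi> \<phi>"
  using assms(2)
proof (induction rule: exp_span.induct)
  case (exp_span_Es s)
  have "L2_inner lborel (weighted (transform \<phi>)) (weighted (repr_kernel s)) = transform \<phi> s"
    using exp_span_L2 [OF assms(1)] by (intro reproducing entire_transform) auto
  moreover have "transform \<phi> s = complex_of_real ((C_const \<Phi>)\<^sup>2) * L2_inner lborel (Es s) \<phi>" by (rule transform_def)
  ultimately show ?case by (simp only: transform_Es)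
next
  case (exp_span_lin f g a b)
  have f: "f \<in> L2 lborel" "weighted (transform f) \<in> L2 lborel" using exp_span_L2 exp_span_lin.hyps by auto
  have g: "g \<in> L2 lborel" "weighted (transform g) \<in> L2 lborel" using exp_span_L2 exp_span_lin.hyps by auto
  have \<phi>: "\<phi> \<in> L2 lborel" "weighted (transform \<phi>) \<in> L2 lborel" using exp_span_L2 assms(1) by auto
  show ?case
    unfolding weighted_transform_linear [OF f(1) g(1)]
      L2_inner_add_right [OF L2_scale [OF f(2)] L2_scale [OF g(2)] \<phi>(2)]
      L2_inner_add_left [OF L2_scale [OF f(1)] L2_scale [OF g(1)] \<phi>(1)]
      L2_inner_scale_right L2_inner_scale_left exp_span_lin.IH
    by (simp add: algebra_simps)
qed

lemma exp_span_norm: assumes "\<phi> \<in> exp_span" shows "L2_norm lborel (weighted (transform \<phi>)) = C_const \<Phi> * L2_norm lborel \<phi>"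
proof -
  have "(L2_norm lborel (weighted (transform \<phi>)))\<^sup>2 = (C_const \<Phi> * L2_norm lborel \<phi>)\<^sup>2"
    using exp_span_inner [OF assms assms] unfolding L2_inner_self of_real_mult [symmetric] of_real_eq_iff power_mult_distrib .
  then show ?thesis
    using C_const_pos by (intro power2_eq_imp_eq [of "L2_norm lborel _"]) (auto simp: L2_norm_nonneg)
qed

text \<open>The closure in L2, which captures the derivatives of \<open>Es\<close> in
  \<open>s\<close> as limits of difference quotients.\<close>

definition exp_closure :: "(complex ^ 'n \<Rightarrow> complex) set" where
  "exp_closure = {\<phi> \<in> L2 lborel. \<forall>\<epsilon>>0. \<exists>\<psi>\<in>exp_span. L2_norm lborel (\<lambda>x. \<phi> x - \<psi> x) < \<epsilon>}"

lemma exp_closure_L2: "\<phi> \<in> exp_closure \<Longrightarrow> \<phi> \<in> L2 lborel"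
  by (simp add: exp_closure_def)

lemma exp_span_subset_closure: "\<phi> \<in> exp_span \<Longrightarrow> \<phi> \<in> exp_closure"
  using exp_span_L2 [of \<phi>] unfolding exp_closure_def
  by (auto intro!: bexI [of _ \<phi>] simp: L2_norm_def)

lemma exp_closure_lin:
  assumes \<phi>: "\<phi> \<in> exp_closure" and \<psi>: "\<psi> \<in> exp_closure"
  shows "(\<lambda>x. a * \<phi> x + b * \<psi> x) \<in> exp_closure"
proof -
  note L2 = \<phi> [THEN exp_closure_L2] \<psi> [THEN exp_closure_L2]
  have "\<exists>f\<in>exp_span. L2_norm lborel (\<lambda>x. a * \<phi> x + b * \<psi> x - f x) < \<epsilon>" if e: "\<epsilon> > 0" for \<epsilon>
  proof -
    define c where "c = cmod a + cmod b + 1"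
    have c: "c > 0" unfolding c_def by (simp add: add_nonneg_pos)
    have "\<exists>f\<in>exp_span. L2_norm lborel (\<lambda>x. \<phi> x - f x) < \<epsilon> / c" "\<exists>f\<in>exp_span. L2_norm lborel (\<lambda>x. \<psi> x - f x) < \<epsilon> / c"
      using \<phi> \<psi> e c unfolding exp_closure_def by auto
    then obtain f g where f: "f \<in> exp_span" "L2_norm lborel (\<lambda>x. \<phi> x - f x) < \<epsilon> / c"
      and g: "g \<in> exp_span" "L2_norm lborel (\<lambda>x. \<psi> x - g x) < \<epsilon> / c" by blast
    have d: "(\<lambda>x. \<phi> x - f x) \<in> L2 lborel" "(\<lambda>x. \<psi> x - g x) \<in> L2 lborel"
      using L2 exp_span_L2 f g by (auto intro: L2_diff)
    have "(\<lambda>x. a * \<phi> x + b * \<psi> x - (a * f x + b * g x)) =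
        (\<lambda>x. a * (\<phi> x - f x) + b * (\<psi> x - g x))"
      by (rule ext) (simp add: algebra_simps)
    then have "L2_norm lborel (\<lambda>x. a * \<phi> x + b * \<psi> x - (a * f x + b * g x)) \<le>
        cmod a * L2_norm lborel (\<lambda>x. \<phi> x - f x) + cmod b * L2_norm lborel (\<lambda>x. \<psi> x - g x)"
      using L2_norm_triangle [OF L2_scale [OF d(1), of a] L2_scale [OF d(2), of b]] by (simp add: L2_norm_scale)
    also have "\<dots> \<le> cmod a * (\<epsilon> / c) + cmod b * (\<epsilon> / c)"
      using f g by (intro add_mono mult_left_mono) auto
    also have "\<dots> < c * (\<epsilon> / c)"
      unfolding distrib_right [symmetric] using e c by (intro mult_strict_right_mono) (auto simp: c_def)
    finally show ?thesis using c exp_span_lin [OF f(1) g(1)] by (intro bexI) auto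
  qed
  then show ?thesis
    using L2 unfolding exp_closure_def by (auto intro: L2_add L2_scale)
qed

lemma exp_closure_closed:
  assumes \<phi>: "\<phi> \<in> L2 lborel" and "\<And>\<epsilon>. \<epsilon> > 0 \<Longrightarrow> \<exists>\<psi>\<in>exp_closure. L2_norm lborel (\<lambda>x. \<phi> x - \<psi> x) < \<epsilon>"
  shows "\<phi> \<in> exp_closure"
proof -
  have "\<exists>f\<in>exp_span. L2_norm lborel (\<lambda>x. \<phi> x - f x) < \<epsilon>" if e: "\<epsilon> > 0" for \<epsilon>
  proof -
    have e2: "\<epsilon> / 2 > 0" using e by simp
    obtain \<psi> where \<psi>: "\<psi> \<in> exp_closure" "L2_norm lborel (\<lambda>x. \<phi> x - \<psi> x) < \<epsilon> / 2"
      using assms(2) [OF e2] by blast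
    obtain f where f: "f \<in> exp_span" "L2_norm lborel (\<lambda>x. \<psi> x - f x) < \<epsilon> / 2"
      using \<psi>(1) e2 unfolding exp_closure_def by blast
    have "L2_norm lborel (\<lambda>x. (\<phi> x - \<psi> x) + (\<psi> x - f x)) \<le>
        L2_norm lborel (\<lambda>x. \<phi> x - \<psi> x) + L2_norm lborel (\<lambda>x. \<psi> x - f x)"
      using \<phi> exp_closure_L2 [OF \<psi>(1)] exp_span_L2 [OF f(1)] by (intro L2_norm_triangle L2_diff) auto
    then show ?thesis using f \<psi>(2) by (intro bexI [of _ f]) auto
  qed
  then show ?thesis using \<phi> by (simp add: exp_closure_def)
qed

text \<open>L2 convergence of functions forces pointwise convergence of their transforms, as Fatou's
  lemma requires.\<close>

lemma transform_bound:
  assumes "\<phi> \<in> L2 lborel" "\<psi> \<in> L2 lborel"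
  shows "cmod (transform \<phi> y - transform \<psi> y) \<le>
    (C_const \<Phi>)\<^sup>2 * L2_norm lborel (Es y) * L2_norm lborel (\<lambda>x. \<phi> x - \<psi> x)"
proof -
  have E: "Es y \<in> L2 lborel" by (rule gauss_dominated_L2 [OF Es_gauss_dominated])
  have "transform \<phi> y - transform \<psi> y = complex_of_real ((C_const \<Phi>)\<^sup>2) * L2_inner lborel (Es y) (\<lambda>x. \<phi> x - \<psi> x)"
    unfolding transform_def L2_inner_diff_right [OF assms E] by (rule right_diff_distrib [symmetric])
  also have "cmod \<dots> = (C_const \<Phi>)\<^sup>2 * cmod (L2_inner lborel (Es y) (\<lambda>x. \<phi> x - \<psi> x))"
    by (simp add: norm_mult norm_power)
  also have "\<dots> \<le> (C_const \<Phi>)\<^sup>2 * (L2_norm lborel (Es y) * L2_norm lborel (\<lambda>x. \<phi> x - \<psi> x))"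
    by (intro mult_left_mono L2_Cauchy_Schwarz E L2_diff assms) simp
  finally show ?thesis by (simp only: mult.assoc)
qed

text \<open>The bound passes to \<open>L2\<close> limits by Fatou's lemma.\<close>

lemma exp_closure_transform_le:
  assumes \<phi>: "\<phi> \<in> exp_closure"
  shows "weighted (transform \<phi>) \<in> L2 lborel" "L2_norm lborel (weighted (transform \<phi>)) \<le> C_const \<Phi> * L2_norm lborel \<phi>"
proof -
  note L2 = exp_closure_L2 [OF \<phi>]
  have "\<exists>\<psi>\<in>exp_span. L2_norm lborel (\<lambda>x. \<phi> x - \<psi> x) < inverse (real (Suc n))" for n
    using \<phi> unfolding exp_closure_def by (auto simp del: of_nat_Suc)
  then obtain \<psi> where \<psi>: "\<And>n. \<psi> n \<in> exp_span" "\<And>n. L2_norm lborel (\<lambda>x. \<phi> x - \<psi> n x) < inverse (real (Suc n))"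
    by metis
  have \<psi>L2: "\<psi> n \<in> L2 lborel" "weighted (transform (\<psi> n)) \<in> L2 lborel" for n using exp_span_L2 \<psi>(1) by auto
  have lim: "(\<lambda>n. weighted (transform (\<psi> n)) y) \<longlonglongrightarrow> weighted (transform \<phi>) y" for y
  proof -
    let ?K = "(C_const \<Phi>)\<^sup>2 * L2_norm lborel (Es y)"
    have "(\<lambda>n. transform (\<psi> n) y - transform \<phi> y) \<longlonglongrightarrow> 0"
    proof (rule Lim_null_comparison)
      show "\<forall>\<^sub>F n in sequentially. cmod (transform (\<psi> n) y - transform \<phi> y) \<le> ?K * inverse (real (Suc n))"
      proof (intro always_eventually allI)
        fix n
        have "cmod (transform (\<psi> n) y - transform \<phi> y) \<le> ?K * L2_norm lborel (\<lambda>x. \<phi> x - \<psi> n x)"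
          using transform_bound [OF L2 \<psi>L2(1)] by (simp only: norm_minus_commute)
        also have "\<dots> \<le> ?K * inverse (real (Suc n))"
          using \<psi>(2) [of n] by (intro mult_left_mono) (auto simp: L2_norm_nonneg)
        finally show "cmod (transform (\<psi> n) y - transform \<phi> y) \<le> ?K * inverse (real (Suc n))" .
      qed
      show "(\<lambda>n. ?K * inverse (real (Suc n))) \<longlonglongrightarrow> 0"
        using tendsto_mult_right_zero [OF LIMSEQ_inverse_real_of_nat] by simp
    qed
    then have "(\<lambda>n. transform (\<psi> n) y) \<longlonglongrightarrow> transform \<phi> y" by (rule LIM_zero_cancel)
    then show ?thesis unfolding weighted_def by (intro tendsto_intros)
  qed
  have meas: "weighted (transform (\<psi> n)) \<in> borel_measurable lborel" for n by (rule L2_measurable [OF \<psi>L2(2)])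
  have [measurable]: "weighted (transform \<phi>) \<in> borel_measurable lborel"
    by (rule borel_measurable_LIMSEQ_metric [OF meas lim])
  define b where "b = (\<lambda>t. ennreal ((C_const \<Phi> * (L2_norm lborel \<phi> + t))\<^sup>2))"
  have le: "(\<integral>\<^sup>+y. ennreal ((cmod (weighted (transform (\<psi> n)) y))\<^sup>2) \<partial>lborel) \<le> b (inverse (real (Suc n)))" for n
  proof -
    have "(\<integral>\<^sup>+y. ennreal ((cmod (weighted (transform (\<psi> n)) y))\<^sup>2) \<partial>lborel) =
        ennreal (LINT y|lborel. (cmod (weighted (transform (\<psi> n)) y))\<^sup>2)"
      using \<psi>L2(2) [of n] by (intro nn_integral_eq_integral) (auto simp: L2_def)
    also have "\<dots> = ennreal ((C_const \<Phi> * L2_norm lborel (\<psi> n))\<^sup>2)"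
      by (simp only: L2_norm_square [symmetric] exp_span_norm [OF \<psi>(1)])
    also have "\<dots> \<le> b (inverse (real (Suc n)))"
    proof -
      have "L2_norm lborel (\<lambda>x. \<phi> x + (- 1) * (\<phi> x - \<psi> n x)) \<le>
          L2_norm lborel \<phi> + L2_norm lborel (\<lambda>x. (- 1) * (\<phi> x - \<psi> n x))"
        by (intro L2_norm_triangle L2_scale L2_diff L2 \<psi>L2(1))
      then have "L2_norm lborel (\<psi> n) \<le> L2_norm lborel \<phi> + L2_norm lborel (\<lambda>x. \<phi> x - \<psi> n x)"
        unfolding L2_norm_scale by simp
      then have "L2_norm lborel (\<psi> n) \<le> L2_norm lborel \<phi> + inverse (real (Suc n))"
        using \<psi>(2) [of n] by linarith
      then show ?thesis
        unfolding b_def using C_const_pos L2_norm_nonneg [of lborel "\<psi> n"]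
        by (intro ennreal_leI power_mono mult_left_mono) (auto simp: mult_nonneg_nonneg)
    qed
    finally show ?thesis .
  qed
  have "(\<integral>\<^sup>+y. ennreal ((cmod (weighted (transform \<phi>) y))\<^sup>2) \<partial>lborel) =
      (\<integral>\<^sup>+y. liminf (\<lambda>n. ennreal ((cmod (weighted (transform (\<psi> n)) y))\<^sup>2)) \<partial>lborel)"
  proof (rule nn_integral_cong)
    fix y
    have "(\<lambda>n. ennreal ((cmod (weighted (transform (\<psi> n)) y))\<^sup>2)) \<longlonglongrightarrow> ennreal ((cmod (weighted (transform \<phi>) y))\<^sup>2)"
      by (intro tendsto_ennrealI tendsto_power tendsto_norm lim)
    then show "ennreal ((cmod (weighted (transform \<phi>) y))\<^sup>2) = liminf (\<lambda>n. ennreal ((cmod (weighted (transform (\<psi> n)) y))\<^sup>2))"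
      by (rule lim_imp_Liminf [OF sequentially_bot, symmetric])
  qed
  also have "\<dots> \<le> liminf (\<lambda>n. \<integral>\<^sup>+y. ennreal ((cmod (weighted (transform (\<psi> n)) y))\<^sup>2) \<partial>lborel)"
    using meas by (intro nn_integral_liminf) simp
  also have "\<dots> \<le> liminf (\<lambda>n. b (inverse (real (Suc n))))"
    by (intro Liminf_mono always_eventually allI le)
  also have "\<dots> = b 0"
  proof (rule lim_imp_Liminf [OF sequentially_bot])
    show "(\<lambda>n. b (inverse (real (Suc n)))) \<longlonglongrightarrow> b 0"
      unfolding b_def
      by (intro tendsto_ennrealI tendsto_power tendsto_mult tendsto_add tendsto_const LIMSEQ_inverse_real_of_nat)
  qed
  finally have fin: "(\<integral>\<^sup>+y. ennreal ((cmod (weighted (transform \<phi>) y))\<^sup>2) \<partial>lborel) \<le> ennreal ((C_const \<Phi> * L2_norm lborel \<phi>)\<^sup>2)"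
    by (simp add: b_def)
  then have int: "integrable lborel (\<lambda>y. (cmod (weighted (transform \<phi>) y))\<^sup>2)"
    by (intro integrableI_bounded) (auto intro: le_less_trans)
  then show "weighted (transform \<phi>) \<in> L2 lborel" by (simp add: L2_def)
  have "ennreal ((L2_norm lborel (weighted (transform \<phi>)))\<^sup>2) \<le> ennreal ((C_const \<Phi> * L2_norm lborel \<phi>)\<^sup>2)"
    unfolding L2_norm_square using fin nn_integral_eq_integral [OF int] by simp
  then have "(L2_norm lborel (weighted (transform \<phi>)))\<^sup>2 \<le> (C_const \<Phi> * L2_norm lborel \<phi>)\<^sup>2"
    by (simp add: ennreal_le_iff)
  then show "L2_norm lborel (weighted (transform \<phi>)) \<le> C_const \<Phi> * L2_norm lborel \<phi>"
    by (rule power2_le_imp_le) (simp add: C_const_pos less_imp_le L2_norm_nonneg)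
qed

text \<open>For the lower bound, \<phi> is compared with an element of the span, where equality
  holds; the upper bound applied to the difference controls the error.\<close>

lemma exp_closure_transform_norm:
  assumes \<phi>: "\<phi> \<in> exp_closure"
  shows "L2_norm lborel (weighted (transform \<phi>)) = C_const \<Phi> * L2_norm lborel \<phi>"
proof (rule antisym [OF exp_closure_transform_le(2) [OF \<phi>]], rule field_le_epsilon)
  fix e :: real assume e: "e > 0"
  note L2 = exp_closure_L2 [OF \<phi>]
  note C = C_const_pos
  \<comment> \<open>The approximation error enters twice, in the norm of \<phi> and in that of its
    transform, each time with the factor \<open>C_const \<Phi>\<close>.\<close>
  have "e / (2 * C_const \<Phi>) > 0" using e C by simp
  then obtain \<psi> where \<psi>: "\<psi> \<in> exp_span" "L2_norm lborel (\<lambda>x. \<phi> x - \<psi> x) < e / (2 * C_const \<Phi>)"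
    using \<phi> unfolding exp_closure_def by blast
  define \<delta> where "\<delta> = (\<lambda>x. 1 * \<phi> x + (- 1) * \<psi> x)"
  have \<delta>: "\<delta> \<in> exp_closure" unfolding \<delta>_def by (intro exp_closure_lin \<phi> exp_span_subset_closure \<psi>(1))
  have \<psi>L2: "\<psi> \<in> L2 lborel" "weighted (transform \<psi>) \<in> L2 lborel" using exp_span_L2 \<psi>(1) by auto
  have n\<delta>: "C_const \<Phi> * L2_norm lborel \<delta> \<le> e / 2"
    using \<psi>(2) C by (simp add: \<delta>_def field_simps)
  have "\<phi> = (\<lambda>x. \<psi> x + \<delta> x)" by (rule ext) (simp add: \<delta>_def)
  then have "L2_norm lborel \<phi> \<le> L2_norm lborel \<psi> + L2_norm lborel \<delta>"
    using L2_norm_triangle [OF \<psi>L2(1) exp_closure_L2 [OF \<delta>]] by simp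
  then have "C_const \<Phi> * L2_norm lborel \<phi> \<le> C_const \<Phi> * (L2_norm lborel \<psi> + L2_norm lborel \<delta>)"
    using C by (intro mult_left_mono) auto
  also have "\<dots> \<le> L2_norm lborel (weighted (transform \<psi>)) + e / 2"
    using n\<delta> by (simp add: exp_span_norm [OF \<psi>(1)] distrib_left)
  also have "L2_norm lborel (weighted (transform \<psi>)) \<le> L2_norm lborel (weighted (transform \<phi>)) + e / 2"
  proof -
    have w: "weighted (transform \<delta>) = (\<lambda>x. cnj 1 * weighted (transform \<phi>) x + cnj (- 1) * weighted (transform \<psi>) x)"
      unfolding \<delta>_def by (rule weighted_transform_linear [OF L2 \<psi>L2(1)])
    have "weighted (transform \<psi>) = (\<lambda>x. weighted (transform \<phi>) x + (- 1) * weighted (transform \<delta>) x)"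
      by (rule ext) (simp add: w)
    then have "L2_norm lborel (weighted (transform \<psi>)) \<le>
        L2_norm lborel (weighted (transform \<phi>)) + L2_norm lborel (\<lambda>x. (- 1) * weighted (transform \<delta>) x)"
      using L2_norm_triangle [OF exp_closure_transform_le(1) [OF \<phi>] L2_scale [OF exp_closure_transform_le(1) [OF \<delta>]], of "- 1"]
      by simp
    also have "L2_norm lborel (\<lambda>x. (- 1) * weighted (transform \<delta>) x) = L2_norm lborel (weighted (transform \<delta>))"
      unfolding L2_norm_scale by simp
    finally show ?thesis using exp_closure_transform_le(2) [OF \<delta>] n\<delta> by linarith
  qed
  finally show "C_const \<Phi> * L2_norm lborel \<phi> \<le> L2_norm lborel (weighted (transform \<phi>)) + e" by simp
qed

section \<open>Derivatives as inner products\<close>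

text \<open>\<open>dEs js s\<close> is the derivative of \<open>Es\<close> at \<open>s\<close> along the directions in \<open>js\<close>; it represents the
  corresponding derivative of functions in the weighted space at \<open>s\<close>.\<close>

definition dEs :: "'n list \<Rightarrow> complex ^ 'n \<Rightarrow> complex ^ 'n \<Rightarrow> complex" where
  "dEs js s x = prod_list (map (\<lambda>j. cnj (x $ j) / 2) js) * Es s x"

lemma dEs_Nil: "dEs [] s = Es s" and dEs_Cons: "dEs (j # js) s x = cnj (x $ j) / 2 * dEs js s x"
  by (simp_all add: dEs_def fun_eq_iff mult.assoc)

lemma dEs_gauss_dominated: "dEs js s \<in> gauss_dominated"
proof (induction js)
  case Nil
  show ?case by (simp only: dEs_Nil Es_gauss_dominated)
next
  case (Cons j js)
  have "(\<lambda>x. cnj (x $ j) / 2 * dEs js s x) \<in> gauss_dominated"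
  proof (rule gauss_dominated_mult [OF Cons])
    show "(\<lambda>x. cnj (x $ j) / 2) \<in> borel_measurable (borel :: (complex ^ 'n) measure)"
      by (intro borel_measurable_continuous_onI continuous_intros) simp
    show "cmod (cnj (x $ j) / 2) \<le> exp (1 * norm x)" for x :: "complex ^ 'n"
      using Finite_Cartesian_Product.norm_nth_le [of x j] exp_ge_add_one_self [of "norm x"] norm_ge_zero [of x]
      unfolding norm_divide complex_mod_cnj mult_1_left norm_numeral by linarith
  qed
  then show ?case by (simp add: dEs_Cons [abs_def])
qed

text \<open>Linear in \<phi>, since the two conjugations, in the transform and in the inner product,
  cancel.\<close>

definition pairing :: "(complex ^ 'n \<Rightarrow> complex) \<Rightarrow> (complex ^ 'n \<Rightarrow> complex) \<Rightarrow> complex" where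
  "pairing u \<phi> = L2_inner lborel (weighted u) (weighted (transform \<phi>))"

lemma pairing_lin:
  assumes u: "weighted u \<in> L2 lborel" and \<phi>: "\<phi> \<in> exp_closure" and \<psi>: "\<psi> \<in> exp_closure"
  shows "pairing u (\<lambda>x. a * \<phi> x + b * \<psi> x) = a * pairing u \<phi> + b * pairing u \<psi>"
  unfolding pairing_def weighted_transform_linear [OF exp_closure_L2 [OF \<phi>] exp_closure_L2 [OF \<psi>]]
    L2_inner_add_right [OF L2_scale [OF exp_closure_transform_le(1) [OF \<phi>]] L2_scale [OF exp_closure_transform_le(1) [OF \<psi>]] u]
    L2_inner_scale_right by simp

lemma pairing_le:
  assumes u: "weighted u \<in> L2 lborel" and \<phi>: "\<phi> \<in> exp_closure"
  shows "cmod (pairing u \<phi>) \<le> L2_norm lborel (weighted u) * (C_const \<Phi> * L2_norm lborel \<phi>)"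
  using L2_Cauchy_Schwarz [OF u exp_closure_transform_le(1) [OF \<phi>]]
  unfolding pairing_def exp_closure_transform_norm [OF \<phi>] .

text \<open>The error of the complex difference quotient is -1 / z times the second order remainder
  of the exponential, hence of order |z|. The quotient is spelled out as a linear combination so
  that linearity on the closure applies to it.\<close>

lemma dEs_quotient:
  obtains B where "B \<ge> 0" "\<And>z. z \<noteq> 0 \<Longrightarrow> cmod z \<le> 1 \<Longrightarrow>
    L2_norm lborel (\<lambda>x. dEs (j # js) s x - (1 / z * dEs js (s + axis j z) x + (- 1 / z) * dEs js s x)) \<le> B * cmod z"
proof (rule remainder_bound [OF dEs_gauss_dominated [of js s]])
  fix B
  assume B0: "B \<ge> 0" and B: "\<And>v. norm v \<le> 1 \<Longrightarrow>
    (\<lambda>x. (exp (cdot v (vcnj x) / 2) - 1 - cdot v (vcnj x) / 2) * dEs js s x) \<in> L2 lborel \<and>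
    L2_norm lborel (\<lambda>x. (exp (cdot v (vcnj x) / 2) - 1 - cdot v (vcnj x) / 2) * dEs js s x) \<le> B * (norm v)\<^sup>2"
  show thesis
  proof (rule that [OF B0])
    fix z :: complex assume z: "z \<noteq> 0" "cmod z \<le> 1"
    let ?v = "axis j z :: complex ^ 'n"
    let ?r = "\<lambda>x. (exp (cdot ?v (vcnj x) / 2) - 1 - cdot ?v (vcnj x) / 2) * dEs js s x"
    have nv: "norm ?v = cmod z" 
      by (simp add: norm_vec_def L2_set_def axis_def if_distrib [of "\<lambda>t. (cmod t)\<^sup>2"] cong: if_cong)
    have cv: "cdot ?v (vcnj x) = z * cnj (x $ j)" for x
      by (simp add: cdot_def axis_def if_distrib [of "\<lambda>t. t * _"] cong: if_cong)
    have "dEs (j # js) s x - (1 / z * dEs js (s + ?v) x + (- 1 / z) * dEs js s x) = (- 1 / z) * ?r x" for x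
      using z(1) unfolding dEs_Cons by (simp add: dEs_def Es_add cv field_simps)
    then have "L2_norm lborel (\<lambda>x. dEs (j # js) s x - (1 / z * dEs js (s + ?v) x + (- 1 / z) * dEs js s x)) =
        L2_norm lborel ?r / cmod z"
      by (simp only: L2_norm_scale) (simp add: norm_divide)
    also have "\<dots> \<le> B * (cmod z)\<^sup>2 / cmod z"
      using B [of ?v] z nv by (intro divide_right_mono) auto
    also have "\<dots> = B * cmod z" using z(1) by (simp add: power2_eq_square)
    finally show "L2_norm lborel (\<lambda>x. dEs (j # js) s x - (1 / z * dEs js (s + ?v) x + (- 1 / z) * dEs js s x)) \<le> B * cmod z" .
  qed
qed

lemma dEs_exp_closure: "dEs js s \<in> exp_closure"
proof (induction js arbitrary: s)
  case Nil
  show ?case by (simp add: dEs_Nil exp_span_subset_closure exp_span_Es)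
next
  case (Cons j js)
  obtain B where B: "B \<ge> 0" "\<And>z. z \<noteq> 0 \<Longrightarrow> cmod z \<le> 1 \<Longrightarrow>
    L2_norm lborel (\<lambda>x. dEs (j # js) s x - (1 / z * dEs js (s + axis j z) x + (- 1 / z) * dEs js s x)) \<le> B * cmod z"
    by (rule dEs_quotient [of j js s]) (rule that)
  show ?case
  proof (rule exp_closure_closed [OF gauss_dominated_L2 [OF dEs_gauss_dominated]])
    fix \<epsilon> :: real assume e: "\<epsilon> > 0"
    \<comment> \<open>Dividing by \<open>B + 1\<close> keeps the quotient defined when
      \<open>B\<close> is 0 and makes the final estimate strict.\<close>
    define t where "t = min 1 (\<epsilon> / (B + 1))"
    have t: "t > 0" "t \<le> 1" using e B(1) by (auto simp: t_def)
    let ?q = "\<lambda>x. 1 / complex_of_real t * dEs js (s + axis j (complex_of_real t)) x + (- 1 / complex_of_real t) * dEs js s x"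
    have "L2_norm lborel (\<lambda>x. dEs (j # js) s x - ?q x) \<le> B * t"
      using B(2) [of "complex_of_real t"] t by simp
    also have "\<dots> < (B + 1) * t" using t by simp
    also have "\<dots> \<le> (B + 1) * (\<epsilon> / (B + 1))" using B(1) by (intro mult_left_mono) (auto simp: t_def)
    also have "\<dots> = \<epsilon>" using B(1) by simp
    finally have "L2_norm lborel (\<lambda>x. dEs (j # js) s x - ?q x) < \<epsilon>" .
    then show "\<exists>\<psi>\<in>exp_closure. L2_norm lborel (\<lambda>x. dEs (j # js) s x - \<psi> x) < \<epsilon>"
      by (intro bexI [where x = ?q] exp_closure_lin Cons.IH)
  qed
qed

text \<open>The empty list is the reproducing property. Each further derivative passes through the
  pairing, which is continuous on the closure; the point \<open>s\<close> varies because the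
  difference quotient uses shifted points.\<close>

lemma foldr_holo_partial:
  assumes u: "entire u" "weighted u \<in> L2 lborel"
  shows "foldr holo_partial js u s = pairing u (dEs js s)"
proof (induction js arbitrary: s)
  case Nil
  show ?case using reproducing [OF u] by (simp add: dEs_Nil pairing_def transform_Es)
next
  case (Cons j js)
  obtain B where B: "B \<ge> 0" "\<And>z. z \<noteq> 0 \<Longrightarrow> cmod z \<le> 1 \<Longrightarrow>
    L2_norm lborel (\<lambda>x. dEs (j # js) s x - (1 / z * dEs js (s + axis j z) x + (- 1 / z) * dEs js s x)) \<le> B * cmod z"
    by (rule dEs_quotient [of j js s]) (rule that)
  let ?F = "\<lambda>z. foldr holo_partial js u (s + axis j z)"
  let ?D = "pairing u (dEs (j # js) s)"
  define K where "K = L2_norm lborel (weighted u) * (C_const \<Phi> * B)"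
  have ax: "axis j 0 = (0 :: complex ^ 'n)" by (simp add: vec_eq_iff axis_def)
  have "(?F has_field_derivative ?D) (at 0)"
    unfolding DERIV_def
  proof (rule LIM_zero_cancel, rule Lim_null_comparison)
    show "\<forall>\<^sub>F h in at 0. cmod ((?F (0 + h) - ?F 0) / h - ?D) \<le> K * cmod h"
      unfolding eventually_at
    proof (intro exI [of _ 1] conjI ballI impI)
      fix z :: complex assume "z \<noteq> 0 \<and> dist z 0 < 1"
      then have z: "z \<noteq> 0" "cmod z \<le> 1" by auto
      let ?q = "\<lambda>x. 1 / z * dEs js (s + axis j z) x + (- 1 / z) * dEs js s x"
      have q: "?q \<in> exp_closure" by (intro exp_closure_lin dEs_exp_closure)
      have pq: "pairing u ?q = (?F z - ?F 0) / z"
        unfolding pairing_lin [OF u(2) dEs_exp_closure dEs_exp_closure] Cons.IH ax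
        using z(1) by (simp add: field_simps)
      have "pairing u (\<lambda>x. 1 * dEs (j # js) s x + (- 1) * ?q x) = 1 * ?D + (- 1) * pairing u ?q"
        by (rule pairing_lin [OF u(2) dEs_exp_closure q])
      then have "pairing u ?q - ?D = - pairing u (\<lambda>x. 1 * dEs (j # js) s x + (- 1) * ?q x)"
        by (simp only:) simp
      then have "(?F z - ?F 0) / z - ?D = - pairing u (\<lambda>x. 1 * dEs (j # js) s x + (- 1) * ?q x)"
        unfolding pq .
      then have "cmod ((?F z - ?F 0) / z - ?D) = cmod (pairing u (\<lambda>x. 1 * dEs (j # js) s x + (- 1) * ?q x))"
        by (simp only: norm_minus_cancel)
      also have "\<dots> \<le> L2_norm lborel (weighted u) *
          (C_const \<Phi> * L2_norm lborel (\<lambda>x. 1 * dEs (j # js) s x + (- 1) * ?q x))"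
        by (rule pairing_le [OF u(2) exp_closure_lin [OF dEs_exp_closure q]])
      also have "(\<lambda>x. 1 * dEs (j # js) s x + (- 1) * ?q x) = (\<lambda>x. dEs (j # js) s x - ?q x)"
        by (rule ext) simp
      also have "L2_norm lborel (weighted u) * (C_const \<Phi> * L2_norm lborel (\<lambda>x. dEs (j # js) s x - ?q x)) \<le>
          L2_norm lborel (weighted u) * (C_const \<Phi> * (B * cmod z))"
        by (intro mult_left_mono B(2) z L2_norm_nonneg) (simp add: C_const_pos less_imp_le)
      finally show "cmod ((?F (0 + z) - ?F 0) / z - ?D) \<le> K * cmod z" by (simp add: K_def mult.assoc)
    qed simp
    have "((\<lambda>h. K * cmod h) \<longlongrightarrow> K * cmod 0) (at 0)" by (intro tendsto_intros)
    then show "((\<lambda>h. K * cmod h) \<longlongrightarrow> 0) (at 0)" by simp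
  qed
  then have "deriv ?F 0 = ?D" by (rule DERIV_imp_deriv)
  then show ?case by (simp add: holo_partial_def [of j "foldr holo_partial js u"])
qed

section \<open>The norm of the Taylor projections\<close>

lemma H_space_iff: "u \<in> H_space \<Phi> 1 \<longleftrightarrow> entire u \<and> weighted u \<in> L2 lborel"
proof -
  have c: "continuous_on UNIV (weighted u)" if "entire u"
    unfolding weighted_def
    by (intro continuous_on_mult entire_continuous_on [OF that] continuous_on_exp continuous_on_minus
        continuous_on_of_real continuous_on_Phi continuous_on_id)
  have sq: "(cmod (weighted u x))\<^sup>2 = (cmod (u x))\<^sup>2 * exp (- 2 * \<Phi> x / 1)" for x
    by (simp add: weighted_def norm_mult norm_exp_eq_Re power_mult_distrib exp_double [symmetric])
  have m: "weighted u \<in> borel_measurable lborel" if "entire u"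
    using borel_measurable_continuous_onI [OF c [OF that]] by simp
  have i: "integrable lborel (\<lambda>x. (cmod (weighted u x))\<^sup>2) \<longleftrightarrow>
      integrable lborel (\<lambda>x. (cmod (u x))\<^sup>2 * exp (- 2 * \<Phi> x / 1))"
    by (simp only: sq)
  show ?thesis
    unfolding H_space_def L2_def mem_Collect_eq i by (cases "entire u") (simp_all only: m simp_thms)
qed

lemma H_norm_weighted: "H_norm \<Phi> 1 u = L2_norm lborel (weighted u)"
proof -
  have sq: "(cmod (weighted u x))\<^sup>2 = (cmod (u x))\<^sup>2 * exp (- 2 * \<Phi> x / 1)" for x
    by (simp add: weighted_def norm_mult norm_exp_eq_Re power_mult_distrib exp_double [symmetric])
  show ?thesis unfolding H_norm_def L2_norm_def sq ..
qed

text \<open>Each derivative contributes half a conjugate coordinate, which yields the power of 2; at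
  parameter 0 the exponential reduces to the square root of the dual weight factor.\<close>

lemma dEs_norm:
  assumes js: "\<And>j. count_list js j = \<alpha> j"
  shows "L2_norm lborel (dEs js 0) = H_norm \<Phi>d 1 (monomial \<alpha>) / 2 ^ mi_size \<alpha>"
proof -
  have "cmod (dEs js 0 x) = cmod (monomial \<alpha> x) * exp (- \<Phi>d x) / 2 ^ mi_size \<alpha>" for x
  proof -
    have "cmod (prod_list (map (\<lambda>j. cnj (x $ j) / 2) js)) = (\<Prod>j\<in>UNIV. (cmod (x $ j) / 2) ^ \<alpha> j)"
      unfolding prod_list_count js by (simp add: prod_norm [symmetric] norm_power norm_divide)
    also have "\<dots> = cmod (monomial \<alpha> x) / 2 ^ mi_size \<alpha>"
      by (simp add: monomial_def mi_size_def prod_norm [symmetric] norm_power power_divide prod_dividef power_sum)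
    finally show ?thesis by (simp add: dEs_def Es_def norm_mult norm_exp_eq_Re cdot_def)
  qed
  then have "(cmod (dEs js 0 x))\<^sup>2 = (cmod (monomial \<alpha> x))\<^sup>2 * exp (- 2 * \<Phi>d x / 1) / (2 ^ mi_size \<alpha>)\<^sup>2" for x
    by (simp add: power_divide power_mult_distrib exp_double [symmetric])
  then show ?thesis
    unfolding L2_norm_def H_norm_def by (simp add: real_sqrt_divide)
qed

text \<open>The Riesz representer of the Taylor coefficient, up to the factorial, is the transform
  of the derivative of \<open>Es\<close> at 0.\<close>

lemma Taylor_functional:
  obtains k where "k \<in> H_space \<Phi> 1"
    "\<And>u. u \<in> H_space \<Phi> 1 \<Longrightarrow> holo_multi_deriv \<alpha> u 0 = L2_inner lborel (weighted u) (weighted k)"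
    "H_norm \<Phi> 1 k = C_const \<Phi> * H_norm \<Phi>d 1 (monomial \<alpha>) / 2 ^ mi_size \<alpha>"
proof -
  define js where "js = (SOME js. \<forall>j. count_list js j = \<alpha> j)"
  have js: "count_list js j = \<alpha> j" for j
    using someI_ex [OF multi_index_list [of \<alpha>]] by (simp add: js_def)
  let ?k = "transform (dEs js 0)"
  show thesis
  proof
    show "?k \<in> H_space \<Phi> 1"
      unfolding H_space_iff
      by (intro conjI entire_transform exp_closure_transform_le(1) exp_closure_L2 dEs_exp_closure)
    show "holo_multi_deriv \<alpha> u 0 = L2_inner lborel (weighted u) (weighted ?k)" if "u \<in> H_space \<Phi> 1" for u
      using foldr_holo_partial [of u js 0] that
      by (simp add: H_space_iff holo_multi_deriv_def js_def pairing_def)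
    show "H_norm \<Phi> 1 ?k = C_const \<Phi> * H_norm \<Phi>d 1 (monomial \<alpha>) / 2 ^ mi_size \<alpha>"
      by (simp add: H_norm_weighted exp_closure_transform_norm [OF dEs_exp_closure] dEs_norm [OF js])
  qed
qed

lemma H_norm_scale: "H_norm \<Phi> 1 (\<lambda>x. c * u x) = cmod c * H_norm \<Phi> 1 u"
proof -
  have "weighted (\<lambda>x. c * u x) = (\<lambda>x. c * weighted u x)" by (simp add: weighted_def mult.assoc)
  then show ?thesis by (simp add: H_norm_weighted L2_norm_scale)
qed

lemma H_space_scale: "u \<in> H_space \<Phi> 1 \<Longrightarrow> (\<lambda>x. c * u x) \<in> H_space \<Phi> 1"
proof -
  have "weighted (\<lambda>x. c * u x) = (\<lambda>x. c * weighted u x)" by (simp add: weighted_def mult.assoc)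
  then show "u \<in> H_space \<Phi> 1 \<Longrightarrow> (\<lambda>x. c * u x) \<in> H_space \<Phi> 1"
    by (simp add: H_space_iff L2_scale entire_mult entire_const)
qed

lemma H_space_add: "u \<in> H_space \<Phi> 1 \<Longrightarrow> v \<in> H_space \<Phi> 1 \<Longrightarrow> (\<lambda>x. u x + v x) \<in> H_space \<Phi> 1"
proof -
  have "weighted (\<lambda>x. u x + v x) = (\<lambda>x. weighted u x + weighted v x)" by (simp add: weighted_def distrib_right)
  then show "u \<in> H_space \<Phi> 1 \<Longrightarrow> v \<in> H_space \<Phi> 1 \<Longrightarrow> (\<lambda>x. u x + v x) \<in> H_space \<Phi> 1"
    by (simp add: H_space_iff L2_add entire_add)
qed

lemma monomial_H_space: "monomial \<alpha> \<in> H_space \<Phi> 1" "monomial \<alpha> \<in> H_space \<Phi>d 1"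
proof -
  obtain m where "m > 0" "\<And>x. m * (norm x)\<^sup>2 \<le> \<Phi> x" using Phi_lower_bound by blast
  then show "monomial \<alpha> \<in> H_space \<Phi> 1"
    by (rule monomial_in_H_space) (rule continuous_on_Phi [OF continuous_on_id])
  obtain m where "m > 0" "\<And>x. m * (norm x)\<^sup>2 \<le> \<Phi>d x" using Phid_lower_bound by blast
  then show "monomial \<alpha> \<in> H_space \<Phi>d 1"
    by (rule monomial_in_H_space) (rule continuous_on_Phid [OF continuous_on_id])
qed

text \<open>The projection is the rank one operator that multiplies the monomial by the inner
  product with \<open>k\<close>, divided by the factorial. Its norm is the product of the norms of
  \<open>k\<close> and the monomial over the factorial, attained at \<open>k\<close>.\<close>

lemma Taylor_proj_norm:
  "H_bounded_linear \<Phi> 1 (Taylor_proj \<alpha>)"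
  "H_opnorm \<Phi> 1 (Taylor_proj \<alpha>) = C_const \<Phi> / (real (mi_fact \<alpha>) * 2 ^ mi_size \<alpha>)
    * H_norm \<Phi> 1 (monomial \<alpha>) * H_norm \<Phi>d 1 (monomial \<alpha>)"
proof -
  obtain k where k: "k \<in> H_space \<Phi> 1"
    "\<And>u. u \<in> H_space \<Phi> 1 \<Longrightarrow> holo_multi_deriv \<alpha> u 0 = L2_inner lborel (weighted u) (weighted k)"
    "H_norm \<Phi> 1 k = C_const \<Phi> * H_norm \<Phi>d 1 (monomial \<alpha>) / 2 ^ mi_size \<alpha>"
    by (rule Taylor_functional [of \<alpha>]) (rule that)
  let ?H = "H_space \<Phi> 1" and ?N = "H_norm \<Phi> 1" and ?T = "Taylor_proj \<alpha>"
  let ?m = "?N (monomial \<alpha>) / real (mi_fact \<alpha>)"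
  have m: "?m \<ge> 0" by (simp add: H_norm_weighted L2_norm_nonneg)
  have kL2: "weighted k \<in> L2 lborel" using k(1) by (simp add: H_space_iff)
  have T: "?T u = (\<lambda>x. (L2_inner lborel (weighted u) (weighted k) / of_nat (mi_fact \<alpha>)) * monomial \<alpha> x)"
    if "u \<in> ?H" for u
    unfolding Taylor_proj_def k(2) [OF that] ..
  have NT: "?N (?T u) = cmod (L2_inner lborel (weighted u) (weighted k)) * ?m" if "u \<in> ?H" for u
    unfolding T [OF that] H_norm_scale by (simp add: norm_divide)
  have le: "?N (?T u) \<le> ?m * ?N k * ?N u" if u: "u \<in> ?H" for u
  proof -
    have "cmod (L2_inner lborel (weighted u) (weighted k)) \<le> ?N u * ?N k"
      using L2_Cauchy_Schwarz [OF _ kL2, of "weighted u"] u by (simp add: H_space_iff H_norm_weighted)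
    from mult_right_mono [OF this m] show ?thesis by (simp only: NT [OF u] mult_ac)
  qed
  show "H_bounded_linear \<Phi> 1 ?T"
    unfolding H_bounded_linear_def
  proof (intro conjI ballI allI)
    show "?T u \<in> ?H" if "u \<in> ?H" for u
      unfolding T [OF that] by (rule H_space_scale [OF monomial_H_space(1)])
    show "?T (\<lambda>x. u x + v x) = (\<lambda>x. ?T u x + ?T v x)" if u: "u \<in> ?H" and v: "v \<in> ?H" for u v
    proof -
      have "weighted (\<lambda>x. u x + v x) = (\<lambda>x. weighted u x + weighted v x)"
        by (simp add: weighted_def distrib_right)
      then have "L2_inner lborel (weighted (\<lambda>x. u x + v x)) (weighted k) =
          L2_inner lborel (weighted u) (weighted k) + L2_inner lborel (weighted v) (weighted k)"
        using u v kL2 by (simp add: L2_inner_add_left H_space_iff)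
      then show ?thesis
        unfolding T [OF u] T [OF v] T [OF H_space_add [OF u v]]
        by (simp add: add_divide_distrib distrib_right)
    qed
    show "?T (\<lambda>x. c * u x) = (\<lambda>x. c * ?T u x)" if u: "u \<in> ?H" for c u
    proof -
      have "weighted (\<lambda>x. c * u x) = (\<lambda>x. c * weighted u x)" by (simp add: weighted_def mult.assoc)
      then have "L2_inner lborel (weighted (\<lambda>x. c * u x)) (weighted k) =
          c * L2_inner lborel (weighted u) (weighted k)"
        by (simp add: L2_inner_scale_left)
      then show ?thesis unfolding T [OF u] T [OF H_space_scale [OF u]] by (simp add: mult.assoc)
    qed
    show "\<exists>K. \<forall>u\<in>?H. ?N (?T u) \<le> K * ?N u"
      by (intro exI [of _ "?m * ?N k"] ballI le)
  qed
  have "H_opnorm \<Phi> 1 ?T = ?m * ?N k"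
    unfolding H_opnorm_def
  proof (rule cSup_eq_maximum)
    have "cmod (L2_inner lborel (weighted k) (weighted k)) = ?N k * ?N k"
      by (simp add: L2_inner_self H_norm_weighted power2_eq_square norm_mult L2_norm_nonneg)
    \<comment> \<open>If the norm of \<open>k\<close> is 0, both sides vanish by the convention x /
      0 = 0.\<close>
    then have e: "?m * ?N k = ?N (?T k) / ?N k"
      unfolding NT [OF k(1)] by (cases "?N k = 0") simp_all
    show "?m * ?N k \<in> (\<lambda>u. ?N (?T u) / ?N u) ` ?H"
      unfolding e by (rule imageI [OF k(1), of "\<lambda>u. ?N (?T u) / ?N u"])
    fix q assume "q \<in> (\<lambda>u. ?N (?T u) / ?N u) ` ?H"
    then obtain u where u: "u \<in> ?H" "q = ?N (?T u) / ?N u" by blast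
    show "q \<le> ?m * ?N k"
    proof (cases "?N u = 0")
      case True
      then show ?thesis using m by (simp add: u(2) H_norm_weighted L2_norm_nonneg)
    next
      case False
      then have "?N u > 0" using L2_norm_nonneg [of lborel "weighted u"] by (simp add: H_norm_weighted)
      then show ?thesis using le [OF u(1)] by (simp add: u(2) divide_le_eq)
    qed
  qed
  also have "\<dots> = C_const \<Phi> / (real (mi_fact \<alpha>) * 2 ^ mi_size \<alpha>) * ?N (monomial \<alpha>) * H_norm \<Phi>d 1 (monomial \<alpha>)"
    unfolding k(3) by simp
  finally show "H_opnorm \<Phi> 1 ?T = \<dots>" .
qed

end

theorem theorem1p3:
  fixes \<Phi> :: "complex ^ 'n \<Rightarrow> real"
  assumes "quadratic_form \<Phi>" and "strictly_convex \<Phi>"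
  shows "\<exists>\<Phi>d C\<^sub>\<Phi>.
    \<Phi>d = dual_weight \<Phi> \<and> C\<^sub>\<Phi> = C_const \<Phi> \<and>
    quadratic_form \<Phi>d \<and> strictly_convex \<Phi>d \<and>
    (\<forall>\<alpha> :: 'n \<Rightarrow> nat.
      H_bounded_linear \<Phi> 1 (Taylor_proj \<alpha>) \<and>
      monomial \<alpha> \<in> H_space \<Phi> 1 \<and> monomial \<alpha> \<in> H_space \<Phi>d 1 \<and>
      H_opnorm \<Phi> 1 (Taylor_proj \<alpha>) =
        C\<^sub>\<Phi> / (real (mi_fact \<alpha>) * 2 ^ mi_size \<alpha>)
          * H_norm \<Phi> 1 (monomial \<alpha>) * H_norm \<Phi>d 1 (monomial \<alpha>))"
proof -
  have cw: "convex_weight \<Phi>" by (rule convex_weight.intro [OF assms])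
  show ?thesis
  proof (intro exI conjI allI)
    show "dual_weight \<Phi> = dual_weight \<Phi>" "C_const \<Phi> = C_const \<Phi>" by (rule refl)+
    show "quadratic_form (dual_weight \<Phi>)" by (rule convex_weight.quadratic_form_Phid [OF cw])
    show "strictly_convex (dual_weight \<Phi>)" by (rule convex_weight.strictly_convex_Phid [OF cw])
  next
    fix \<alpha>
    show "H_bounded_linear \<Phi> 1 (Taylor_proj \<alpha>)" by (rule convex_weight.Taylor_proj_norm(1) [OF cw])
    show "monomial \<alpha> \<in> H_space \<Phi> 1" by (rule convex_weight.monomial_H_space(1) [OF cw])
    show "monomial \<alpha> \<in> H_space (dual_weight \<Phi>) 1" by (rule convex_weight.monomial_H_space(2) [OF cw])
    show "H_opnorm \<Phi> 1 (Taylor_proj \<alpha>) = C_const \<Phi> / (real (mi_fact \<alpha>) * 2 ^ mi_size \<alpha>)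
        * H_norm \<Phi> 1 (monomial \<alpha>) * H_norm (dual_weight \<Phi>) 1 (monomial \<alpha>)"
      by (rule convex_weight.Taylor_proj_norm(2) [OF cw])
  qed
qed

end
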